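(* Let $s\in(0,1)$, $T>0$, $f\in L^2(0,T;L^2(\Omega))$, $g\in\mathbb{H}^s(\Omega)$ and $h\in L^2(\Omega)$. Then the problem $$\partial_t^2u+\mathcal{L}^su=f\ \text{ in }\Omega\times(0,T),\qquad u(0)=g,\quad \partial_tu(0)=h\ \text{ in }\Omega,$$ has a unique weak solution $u$. In addition, $$\|u\|_{L^\infty(0,T;\mathbb{H}^s(\Omega))}+\|\partial_tu\|_{L^\infty(0,T;L^2(\Omega))}\le C\left(\|f\|_{L^2(0,T;L^2(\Omega))}+\|g\|_{\mathbb{H}^s(\Omega)}+\|h\|_{L^2(\Omega)}\right),$$ where the constant $C$ is independent of the problem data $f,g,h$.
   Context: $\Omega\subset\mathbb{R}^n$ ($n\ge1$) is open, bounded and convex. $\mathcal{L}w=-\mathrm{div}(A\nabla w)+cw$ with homogeneous Dirichlet boundary conditions, where $0\le c\in L^\infty(\Omega)$ and $A$ is a Lipschitz ($C^{0,1}$), symmetric, uniformly positive definite matrix field on $\Omega$. $\{(\lambda_k,\varphi_k)\}_{k\ge1}\subset\mathbb{R}_+\times H_0^1(\Omega)$ are the eigenpairs of $\mathcal{L}$, with $\{\varphi_k\}$ an orthonormal basis of $L^2(\Omega)$. For $r\ge0$, $\mathbb{H}^r(\Omega)=\{w=\sum_kw_k\varphi_k:\|w\|_{\mathbb{H}^r(\Omega)}^2=\sum_k\lambda_k^r|w_k|^2<\infty\}$, and $\mathbb{H}^{-r}(\Omega)$ is its dual. The spectral fractional power is $\mathcal{L}^s:\mathbb{H}^s(\Omega)\to\mathbb{H}^{-s}(\Omega)$,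 $\mathcal{L}^sw=\sum_k\lambda_k^sw_k\varphi_k$. Weak solution: $u\in L^2(0,T;\mathbb{H}^s(\Omega))$ with $\partial_tu\in L^2(0,T;L^2(\Omega))$ and $\partial_t^2u\in L^2(0,T;\mathbb{H}^{-s}(\Omega))$, such that $u(0)=g$, $\partial_tu(0)=h$ and, for a.e. $t\in(0,T)$, $$\langle\partial_t^2u,v\rangle+\langle\mathcal{L}^su,v\rangle=\langle f,v\rangle\quad\forall v\in\mathbb{H}^s(\Omega),$$ where $\langle\cdot,\cdot\rangle$ is the duality pairing between $\mathbb{H}^{-s}(\Omega)$ and $\mathbb{H}^s(\Omega)$. The initial conditions are meaningful because such $u$ satisfies $u\in C([0,T];L^2(\Omega))$ and $\partial_tu\in C([0,T];\mathbb{H}^{-s}(\Omega))$. *)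

theory Defs
  imports "HOL-Analysis.Analysis" "HOL-Probability.Essential_Supremum"
begin

section \<open>Smooth functions with compact support\<close>

fun continuously_diff :: "nat \<Rightarrow> ('a::euclidean_space \<Rightarrow> real) \<Rightarrow> bool" where
  "continuously_diff 0 f \<longleftrightarrow> continuous_on UNIV f"
| "continuously_diff (Suc k) f \<longleftrightarrow> f differentiable_on UNIV \<and>
     (\<forall>b\<in>Basis. continuously_diff k (\<lambda>x. frechet_derivative f (at x) b))"

definition test_function :: "'a::euclidean_space set \<Rightarrow> ('a \<Rightarrow> real) \<Rightarrow> bool" where
  "test_function S p \<longleftrightarrow> (\<forall>k. continuously_diff k p) \<and>
     compact (closure {x. p x \<noteq> 0}) \<and> closure {x. p x \<noteq> 0} \<subseteq> S"

definition partial_deriv :: "'n::finite \<Rightarrow> (real^'n \<Rightarrow> real) \<Rightarrow> real^'n \<Rightarrow> real" where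
  "partial_deriv i p x = frechet_derivative p (at x) (axis i 1)"

section \<open>Spaces of real-valued functions with a (semi)norm\<close>

text \<open>
  A normed space is represented by a set of real-valued functions and a seminorm on it; elements at
  distance 0 are identified. The operations are pointwise. This covers function spaces on
  \<open>\<Omega>\<close> (equality almost everywhere) as well as their duals (functionals that agree on the primal
  space; their values outside it are irrelevant).
\<close>

record 'a fspace =
  elems :: "('a \<Rightarrow> real) set"
  nrm :: "('a \<Rightarrow> real) \<Rightarrow> real"

definition L2_space :: "'a::euclidean_space set \<Rightarrow> 'a fspace" where
  "L2_space S = \<lparr>
     elems = {w. w \<in> borel_measurable (lebesgue_on S) \<and> integrable (lebesgue_on S) (\<lambda>x. (w x)\<^sup>2)},
     nrm = (\<lambda>w. sqrt (\<integral>x. (w x)\<^sup>2 \<partial>lebesgue_on S)) \<rparr>"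

definition L2_inner :: "'a::euclidean_space set \<Rightarrow> ('a \<Rightarrow> real) \<Rightarrow> ('a \<Rightarrow> real) \<Rightarrow> real" where
  "L2_inner S v w = (\<integral>x. v x * w x \<partial>lebesgue_on S)"

definition dual_space :: "'a fspace \<Rightarrow> ('a \<Rightarrow> real) fspace" where
  "dual_space X = \<lparr>
     elems = {F. (\<forall>v\<in>elems X. \<forall>w\<in>elems X. \<forall>a b.
                    F (\<lambda>x. a * v x + b * w x) = a * F v + b * F w) \<and>
                 (\<exists>B. \<forall>v\<in>elems X. \<bar>F v\<bar> \<le> B * nrm X v)},
     nrm = (\<lambda>F. Sup {\<bar>F v\<bar> |v. v \<in> elems X \<and> nrm X v \<le> 1}) \<rparr>"

section \<open>Sobolev spaces on \<open>\<Omega>\<close>\<close>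

definition has_weak_grad ::
  "(real^'n::finite) set \<Rightarrow> (real^'n \<Rightarrow> real) \<Rightarrow> (real^'n \<Rightarrow> real^'n) \<Rightarrow> bool" where
  "has_weak_grad \<Omega> w G \<longleftrightarrow>
     (\<forall>i. (\<lambda>x. G x $ i) \<in> elems (L2_space \<Omega>)) \<and>
     (\<forall>p i. test_function \<Omega> p \<longrightarrow>
        (\<integral>x. w x * partial_deriv i p x \<partial>lebesgue_on \<Omega>) = - (\<integral>x. G x $ i * p x \<partial>lebesgue_on \<Omega>))"

definition weak_grad :: "(real^'n::finite) set \<Rightarrow> (real^'n \<Rightarrow> real) \<Rightarrow> real^'n \<Rightarrow> real^'n" where
  "weak_grad \<Omega> w = (SOME G. has_weak_grad \<Omega> w G)"

definition H1 :: "(real^'n::finite) set \<Rightarrow> (real^'n \<Rightarrow> real) set" where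
  "H1 \<Omega> = {w \<in> elems (L2_space \<Omega>). \<exists>G. has_weak_grad \<Omega> w G}"

text \<open>Closure of the test functions in the norm of \<open>H1\<close>.\<close>

definition H10 :: "(real^'n::finite) set \<Rightarrow> (real^'n \<Rightarrow> real) set" where
  "H10 \<Omega> = {w \<in> H1 \<Omega>. \<exists>p. (\<forall>n. test_function \<Omega> (p n)) \<and>
     (\<lambda>n::nat. nrm (L2_space \<Omega>) (\<lambda>x. p n x - w x)) \<longlonglongrightarrow> 0 \<and>
     (\<forall>i. (\<lambda>n. nrm (L2_space \<Omega>) (\<lambda>x. partial_deriv i (p n) x - weak_grad \<Omega> w x $ i)) \<longlonglongrightarrow> 0)}"

section \<open>The elliptic operator, its eigenpairs and the spectral spaces\<close>

definition admissible_coeffs ::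
  "(real^'n::finite) set \<Rightarrow> (real^'n \<Rightarrow> real^'n^'n) \<Rightarrow> (real^'n \<Rightarrow> real) \<Rightarrow> bool" where
  "admissible_coeffs \<Omega> A c \<longleftrightarrow>
     (\<exists>L. L-lipschitz_on \<Omega> A) \<and>
     (\<forall>x\<in>\<Omega>. transpose (A x) = A x) \<and>
     (\<exists>\<alpha>>0. \<forall>x\<in>\<Omega>. \<forall>\<xi>. \<alpha> * (\<xi> \<bullet> \<xi>) \<le> \<xi> \<bullet> (A x *v \<xi>)) \<and>
     c \<in> borel_measurable (lebesgue_on \<Omega>) \<and>
     (AE x in lebesgue_on \<Omega>. 0 \<le> c x) \<and>
     (\<exists>M. AE x in lebesgue_on \<Omega>. c x \<le> M)"

text \<open>
  \<open>-div (A grad w) + c w = \<mu> w\<close> in \<open>\<Omega>\<close> with homogeneous Dirichlet boundary conditions, in weak form.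
\<close>

definition eigenpair ::
  "(real^'n::finite) set \<Rightarrow> (real^'n \<Rightarrow> real^'n^'n) \<Rightarrow> (real^'n \<Rightarrow> real)
     \<Rightarrow> real \<Rightarrow> (real^'n \<Rightarrow> real) \<Rightarrow> bool" where
  "eigenpair \<Omega> A c \<mu> w \<longleftrightarrow> w \<in> H10 \<Omega> \<and> nrm (L2_space \<Omega>) w \<noteq> 0 \<and>
     (\<forall>v\<in>H10 \<Omega>.
        (\<integral>x. (A x *v weak_grad \<Omega> w x) \<bullet> weak_grad \<Omega> v x + c x * w x * v x \<partial>lebesgue_on \<Omega>)
          = \<mu> * L2_inner \<Omega> w v)"

definition orthonormal_basis :: "'a::euclidean_space set \<Rightarrow> (nat \<Rightarrow> 'a \<Rightarrow> real) \<Rightarrow> bool" where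
  "orthonormal_basis S \<phi> \<longleftrightarrow>
     (\<forall>k. \<phi> k \<in> elems (L2_space S)) \<and>
     (\<forall>j k. L2_inner S (\<phi> j) (\<phi> k) = (if j = k then 1 else 0)) \<and>
     (\<forall>w\<in>elems (L2_space S).
        (\<lambda>n. nrm (L2_space S) (\<lambda>x. w x - (\<Sum>k<n. L2_inner S w (\<phi> k) * \<phi> k x))) \<longlonglongrightarrow> 0)"

text \<open>The eigenpairs are indexed from 0, in no particular order.\<close>

definition eigensystem ::
  "(real^'n::finite) set \<Rightarrow> (real^'n \<Rightarrow> real^'n^'n) \<Rightarrow> (real^'n \<Rightarrow> real)
     \<Rightarrow> (nat \<Rightarrow> real) \<Rightarrow> (nat \<Rightarrow> real^'n \<Rightarrow> real) \<Rightarrow> bool" where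
  "eigensystem \<Omega> A c lam \<phi> \<longleftrightarrow>
     (\<forall>k. 0 < lam k \<and> eigenpair \<Omega> A c (lam k) (\<phi> k)) \<and> orthonormal_basis \<Omega> \<phi>"

definition spectral_space ::
  "'a::euclidean_space set \<Rightarrow> (nat \<Rightarrow> real) \<Rightarrow> (nat \<Rightarrow> 'a \<Rightarrow> real) \<Rightarrow> real \<Rightarrow> 'a fspace" where
  "spectral_space \<Omega> lam \<phi> r = \<lparr>
     elems = {w \<in> elems (L2_space \<Omega>). summable (\<lambda>k. lam k powr r * (L2_inner \<Omega> w (\<phi> k))\<^sup>2)},
     nrm = (\<lambda>w. sqrt (\<Sum>k. lam k powr r * (L2_inner \<Omega> w (\<phi> k))\<^sup>2)) \<rparr>"

abbreviation spectral_dual ::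
  "'a::euclidean_space set \<Rightarrow> (nat \<Rightarrow> real) \<Rightarrow> (nat \<Rightarrow> 'a \<Rightarrow> real) \<Rightarrow> real \<Rightarrow> ('a \<Rightarrow> real) fspace" where
  "spectral_dual \<Omega> lam \<phi> r \<equiv> dual_space (spectral_space \<Omega> lam \<phi> r)"

text \<open>
  A function \<open>w\<close> in \<open>L2\<close> is identified with the functional \<open>L2_inner \<Omega> w\<close>. In particular the sum
  below is the series of \<open>lam k powr s * w\<^sub>k * \<phi> k\<close>, seen in the dual space and applied to \<open>v\<close>.
\<close>

definition fractional_power ::
  "'a::euclidean_space set \<Rightarrow> (nat \<Rightarrow> real) \<Rightarrow> (nat \<Rightarrow> 'a \<Rightarrow> real) \<Rightarrow> real
     \<Rightarrow> ('a \<Rightarrow> real) \<Rightarrow> ('a \<Rightarrow> real) \<Rightarrow> real" where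
  "fractional_power \<Omega> lam \<phi> s w =
     (\<lambda>v. \<Sum>k. lam k powr s * L2_inner \<Omega> w (\<phi> k) * L2_inner \<Omega> (\<phi> k) v)"

section \<open>Bochner spaces on the time interval \<open>(0,T)\<close>\<close>

abbreviation time_measure :: "real \<Rightarrow> real measure" where
  "time_measure T \<equiv> lebesgue_on {0<..<T}"

definition simple_in :: "real \<Rightarrow> 'a fspace \<Rightarrow> (real \<Rightarrow> 'a \<Rightarrow> real) \<Rightarrow> bool" where
  "simple_in T X S \<longleftrightarrow> finite (S ` {0<..<T}) \<and> S ` {0<..<T} \<subseteq> elems X \<and>
     (\<forall>y. {t \<in> {0<..<T}. S t = y} \<in> sets (time_measure T))"

definition simple_integral_in :: "real \<Rightarrow> (real \<Rightarrow> 'a \<Rightarrow> real) \<Rightarrow> 'a \<Rightarrow> real" where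
  "simple_integral_in T S =
     (\<lambda>x. \<Sum>y\<in>S ` {0<..<T}. measure (time_measure T) {t \<in> {0<..<T}. S t = y} * y x)"

definition strongly_measurable :: "real \<Rightarrow> 'a fspace \<Rightarrow> (real \<Rightarrow> 'a \<Rightarrow> real) \<Rightarrow> bool" where
  "strongly_measurable T X u \<longleftrightarrow>
     (AE t in time_measure T. u t \<in> elems X) \<and>
     (\<exists>S. (\<forall>n::nat. simple_in T X (S n)) \<and>
          (AE t in time_measure T. (\<lambda>n. nrm X (\<lambda>x. u t x - S n t x)) \<longlonglongrightarrow> 0))"

definition has_integral_in ::
  "real \<Rightarrow> 'a fspace \<Rightarrow> (real \<Rightarrow> 'a \<Rightarrow> real) \<Rightarrow> ('a \<Rightarrow> real) \<Rightarrow> bool" where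
  "has_integral_in T X u y \<longleftrightarrow> strongly_measurable T X u \<and> y \<in> elems X \<and>
     (\<exists>S. (\<forall>n::nat. simple_in T X (S n)) \<and>
          (\<lambda>n. \<integral>\<^sup>+t. ennreal (nrm X (\<lambda>x. u t x - S n t x)) \<partial>time_measure T) \<longlonglongrightarrow> 0 \<and>
          (\<lambda>n. nrm X (\<lambda>x. simple_integral_in T (S n) x - y x)) \<longlonglongrightarrow> 0)"

definition bochner_L2 :: "real \<Rightarrow> 'a fspace \<Rightarrow> (real \<Rightarrow> 'a \<Rightarrow> real) set" where
  "bochner_L2 T X = {u. strongly_measurable T X u \<and> integrable (time_measure T) (\<lambda>t. (nrm X (u t))\<^sup>2)}"

definition bochner_L2_norm :: "real \<Rightarrow> 'a fspace \<Rightarrow> (real \<Rightarrow> 'a \<Rightarrow> real) \<Rightarrow> real" where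
  "bochner_L2_norm T X u = sqrt (\<integral>t. (nrm X (u t))\<^sup>2 \<partial>time_measure T)"

definition bochner_Linf_norm :: "real \<Rightarrow> 'a fspace \<Rightarrow> (real \<Rightarrow> 'a \<Rightarrow> real) \<Rightarrow> ennreal" where
  "bochner_Linf_norm T X u = esssup (time_measure T) (\<lambda>t. ennreal (nrm X (u t)))"

text \<open>\<open>v\<close> belongs to \<open>L2(0,T;X)\<close> and is the weak derivative of the \<open>X\<close>-valued function \<open>u\<close>.\<close>

definition weak_time_deriv ::
  "real \<Rightarrow> 'a fspace \<Rightarrow> (real \<Rightarrow> 'a \<Rightarrow> real) \<Rightarrow> (real \<Rightarrow> 'a \<Rightarrow> real) \<Rightarrow> bool" where
  "weak_time_deriv T X u v \<longleftrightarrow> v \<in> bochner_L2 T X \<and>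
     (\<forall>\<psi>. test_function {0<..<T} \<psi> \<longrightarrow>
        (\<exists>y. has_integral_in T X (\<lambda>t x. deriv \<psi> t * u t x) y \<and>
             has_integral_in T X (\<lambda>t x. \<psi> t * v t x) (\<lambda>x. - y x)))"

text \<open>The representative of \<open>u\<close> in \<open>C([0,T];X)\<close> has the value \<open>y\<close> at time 0.\<close>

definition initial_value :: "real \<Rightarrow> 'a fspace \<Rightarrow> (real \<Rightarrow> 'a \<Rightarrow> real) \<Rightarrow> ('a \<Rightarrow> real) \<Rightarrow> bool" where
  "initial_value T X u y \<longleftrightarrow>
     (\<exists>w. (\<forall>t\<in>{0..T}. w t \<in> elems X \<and>
                ((\<lambda>r. nrm X (\<lambda>x. w r x - w t x)) \<longlongrightarrow> 0) (at t within {0..T})) \<and>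
          (AE t in time_measure T. nrm X (\<lambda>x. u t x - w t x) = 0) \<and>
          nrm X (\<lambda>x. w 0 x - y x) = 0)"

section \<open>Weak solutions\<close>

definition weak_solution ::
  "(real^'n::finite) set \<Rightarrow> (nat \<Rightarrow> real) \<Rightarrow> (nat \<Rightarrow> real^'n \<Rightarrow> real) \<Rightarrow> real \<Rightarrow> real
     \<Rightarrow> (real \<Rightarrow> real^'n \<Rightarrow> real) \<Rightarrow> (real^'n \<Rightarrow> real) \<Rightarrow> (real^'n \<Rightarrow> real)
     \<Rightarrow> (real \<Rightarrow> real^'n \<Rightarrow> real) \<Rightarrow> bool" where
  "weak_solution \<Omega> lam \<phi> s T f g h u \<longleftrightarrow>
     u \<in> bochner_L2 T (spectral_space \<Omega> lam \<phi> s) \<and>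
     (\<exists>ut utt.
        weak_time_deriv T (L2_space \<Omega>) u ut \<and>
        weak_time_deriv T (spectral_dual \<Omega> lam \<phi> s) (\<lambda>t. L2_inner \<Omega> (ut t)) utt \<and>
        initial_value T (L2_space \<Omega>) u g \<and>
        initial_value T (spectral_dual \<Omega> lam \<phi> s) (\<lambda>t. L2_inner \<Omega> (ut t)) (L2_inner \<Omega> h) \<and>
        (AE t in time_measure T. \<forall>v\<in>elems (spectral_space \<Omega> lam \<phi> s).
           utt t v + fractional_power \<Omega> lam \<phi> s (u t) v = L2_inner \<Omega> (f t) v))"

end

theory Submission
  imports Defs
begin

text \<open>
  The equation is diagonal in the eigenfunctions \<open>\<phi> k\<close>. The coefficient \<open>u\<^sub>k(t)\<close> of a solution
  satisfies the scalar equation \<open>u\<^sub>k'' + \<kappa>\<^sub>k u\<^sub>k = f\<^sub>k\<close> with \<open>\<kappa>\<^sub>k = \<lambda>\<^sub>k\<^sup>s\<close> and initial data \<open>g\<^sub>k, h\<^sub>k\<close>, a forced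
  harmonic oscillator. Variation of constants solves it and gives, with a constant that does not
  depend on \<open>k\<close>,
    \<open>\<kappa>\<^sub>k u\<^sub>k(t)\<^sup>2, u\<^sub>k'(t)\<^sup>2 \<le> 3 (\<kappa>\<^sub>k g\<^sub>k\<^sup>2 + h\<^sub>k\<^sup>2 + 4 T \<integral> f\<^sub>k\<^sup>2)\<close>
  (\<open>oscillator_solution\<close>, \<open>mode_solution_exists\<close>). Summation over \<open>k\<close> bounds the energy at every time
  by the data, so the series \<open>\<Sum> u\<^sub>k(t) \<phi>\<^sub>k\<close> and \<open>\<Sum> u\<^sub>k'(t) \<phi>\<^sub>k\<close> define elements of the spectral space and
  of \<open>L2\<close>, and these form a weak solution (\<open>weak_solution_exists\<close>).

  Conversely, testing an arbitrary weak solution with \<open>\<phi> k\<close> shows that its coefficient solves the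
  scalar equation in the weak sense. The lemma of du Bois-Reymond turns this into a classical
  differential equation, for which conservation of the energy \<open>\<kappa> d\<^sup>2 + d'\<^sup>2\<close> of a difference \<open>d\<close> of two
  solutions gives uniqueness (\<open>weak_oscillator_unique\<close>). Hence the coefficients of every weak solution
  are the explicit ones (\<open>weak_solution_modes\<close>), which yields uniqueness and the estimate together.

  Two tools make the passage to coefficients rigorous. First, \<open>L2\<close>, the spectral spaces and their duals
  are all weighted sequence spaces in suitable coordinates; the locale \<open>coord_space\<close> captures this, and
  the dual of such a space is again one, with reciprocal weights (\<open>dual_coord_space\<close>). In a
  \<open>coord_space\<close>, strong measurability, Bochner integrals, weak time derivatives and initial values are
  all determined coordinate by coordinate. Second, the spectral space has to embed into \<open>L2\<close>
  and \<open>L2\<close> into the dual, which needs a positive lower bound for the eigenvalues. It comes from the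
  ellipticity and the Poincare inequality (\<open>eigenvalues_bounded_below\<close>).
\<close>

section \<open>Smooth functions of a real variable\<close>

text \<open>
  On the real line 1 is the only basis vector, so the recursion that defines \<open>continuously_diff\<close> runs
  along the ordinary derivative, and smoothness can be proved with the rules for real derivatives.
\<close>

lemma continuously_diff_Suc_real:
  fixes f :: "real \<Rightarrow> real"
  assumes "\<And>x. (f has_real_derivative f' x) (at x)"
  shows "continuously_diff (Suc k) f \<longleftrightarrow> continuously_diff k f'"
proof -
  have "frechet_derivative f (at x) 1 = f' x" for x
    using frechet_derivative_at[OF assms[of x, unfolded has_field_derivative_def]]
    by (metis mult.right_neutral)
  moreover have "f differentiable_on UNIV"
    using assms by (auto simp: differentiable_on_def real_differentiable_def)
  ultimately show ?thesis by simp
qed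

lemma continuously_diff_SucE:
  fixes f :: "real \<Rightarrow> real"
  assumes "continuously_diff (Suc k) f"
  obtains f' where "\<And>x. (f has_real_derivative f' x) (at x)" "continuously_diff k f'"
proof -
  have *: "(f has_real_derivative deriv f x) (at x)" for x
    using assms by (auto simp: differentiable_on_def DERIV_deriv_iff_real_differentiable)
  show ?thesis
    using that[OF *] continuously_diff_Suc_real[of f "deriv f", OF *] assms by blast
qed

lemma continuously_diff_const: "continuously_diff k (\<lambda>x::real. c)"
proof (induction k arbitrary: c)
  case (Suc k)
  show ?case
    by (subst continuously_diff_Suc_real[where f' = "\<lambda>_. 0"]) (auto intro: Suc)
qed auto

lemma continuously_diff_Suc_imp:
  fixes f :: "real \<Rightarrow> real"
  shows "continuously_diff (Suc k) f \<Longrightarrow> continuously_diff k f"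
proof (induction k arbitrary: f)
  case 0
  then show ?case by (auto simp: differentiable_imp_continuous_on)
next
  case (Suc k)
  from Suc.prems obtain f' where f': "\<And>x. (f has_real_derivative f' x) (at x)"
    and "continuously_diff (Suc k) f'" by (rule continuously_diff_SucE) blast
  then show ?case
    using Suc.IH continuously_diff_Suc_real[of f f', OF f'] by blast
qed

lemma continuously_diff_add:
  fixes f g :: "real \<Rightarrow> real"
  shows "continuously_diff k f \<Longrightarrow> continuously_diff k g \<Longrightarrow> continuously_diff k (\<lambda>x. f x + g x)"
proof (induction k arbitrary: f g)
  case 0
  then show ?case by (auto intro: continuous_intros)
next
  case (Suc k)
  obtain f' g' where f': "\<And>x. (f has_real_derivative f' x) (at x)" "continuously_diff k f'"
    and g': "\<And>x. (g has_real_derivative g' x) (at x)" "continuously_diff k g'"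
    using Suc.prems by (metis continuously_diff_SucE)
  show ?case
    by (subst continuously_diff_Suc_real[where f' = "\<lambda>x. f' x + g' x"])
      (auto intro!: derivative_eq_intros f'(1) g'(1) Suc.IH f'(2) g'(2))
qed

lemma continuously_diff_mult:
  fixes f g :: "real \<Rightarrow> real"
  shows "continuously_diff k f \<Longrightarrow> continuously_diff k g \<Longrightarrow> continuously_diff k (\<lambda>x. f x * g x)"
proof (induction k arbitrary: f g)
  case 0
  then show ?case by (auto intro: continuous_intros)
next
  case (Suc k)
  obtain f' g' where f': "\<And>x. (f has_real_derivative f' x) (at x)" "continuously_diff k f'"
    and g': "\<And>x. (g has_real_derivative g' x) (at x)" "continuously_diff k g'"
    using Suc.prems by (metis continuously_diff_SucE)
  have fg: "continuously_diff k f" "continuously_diff k g"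
    using Suc.prems continuously_diff_Suc_imp by blast+
  show ?case
    by (subst continuously_diff_Suc_real[where f' = "\<lambda>x. f' x * g x + g' x * f x"])
      (auto intro!: DERIV_mult f'(1) g'(1) continuously_diff_add Suc.IH f'(2) g'(2) fg)
qed

lemma continuously_diff_affine:
  fixes f :: "real \<Rightarrow> real"
  shows "continuously_diff k f \<Longrightarrow> continuously_diff k (\<lambda>x. f (a * x + b))"
proof (induction k arbitrary: f)
  case 0
  then show ?case by (auto intro!: continuous_intros continuous_on_compose2[of UNIV f])
next
  case (Suc k)
  obtain f' where f': "\<And>x. (f has_real_derivative f' x) (at x)" "continuously_diff k f'"
    using Suc.prems by (metis continuously_diff_SucE)
  show ?case
    by (subst continuously_diff_Suc_real[where f' = "\<lambda>x. f' (a * x + b) * a"])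
      (auto intro!: DERIV_chain2[OF f'(1)] derivative_eq_intros continuously_diff_mult
        continuously_diff_const Suc.IH f'(2))
qed

text \<open>
  The functions \<open>x\<^sup>-\<^sup>k e\<^sup>-\<^sup>1\<^sup>/\<^sup>x\<close>, extended by 0 to the left half line. The exponent \<open>k\<close> makes the family
  closed under differentiation up to linear combinations, so that smoothness follows by induction.
\<close>

definition flat_exp :: "nat \<Rightarrow> real \<Rightarrow> real" where
  "flat_exp k x = (if x > 0 then (1 / x) ^ k * exp (- (1 / x)) else 0)"

text \<open>
  Exponential decay beats every power of \<open>1/x\<close>. Applied to \<open>k + 1\<close> this is differentiability at
  the origin.
\<close>

lemma flat_exp_tendsto: "(flat_exp k \<longlongrightarrow> 0) (at 0)"
proof -
  have "((\<lambda>y::real. y ^ k / exp y) \<longlongrightarrow> 0) at_top"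
    by (rule tendsto_power_div_exp_0)
  then have "((\<lambda>x::real. (1 / x) ^ k / exp (1 / x)) \<longlongrightarrow> 0) (at_right 0)"
    unfolding filterlim_at_top_to_right by (simp add: field_simps)
  then have r: "(flat_exp k \<longlongrightarrow> 0) (at_right 0)"
    by (rule Lim_transform_eventually)
      (auto simp: flat_exp_def eventually_at_right_less exp_minus divide_simps
        intro!: eventually_mono[OF eventually_at_right_less[of 0]])
  have l: "(flat_exp k \<longlongrightarrow> 0) (at_left 0)"
    by (rule tendsto_eventually) (auto simp: flat_exp_def eventually_at_left_field intro!: exI[of _ "-1"])
  show ?thesis using l r by (simp add: filterlim_split_at)
qed

lemma flat_exp_deriv:
  "(flat_exp k has_real_derivative flat_exp (k + 2) x - real k * flat_exp (k + 1) x) (at x)"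
proof -
  consider "x > 0" | "x < 0" | "x = 0" by linarith
  then show ?thesis
  proof cases
    case 1
    have "((\<lambda>x. (1 / x) ^ k * exp (- (1 / x))) has_real_derivative
        flat_exp (k + 2) x - real k * flat_exp (k + 1) x) (at x)"
      using 1 by (auto intro!: derivative_eq_intros simp: flat_exp_def)
        (cases k; simp add: field_simps power2_eq_square)
    then show ?thesis
      by (rule has_field_derivative_transform_within_open[where S = "{0<..}"])
        (use 1 in \<open>auto simp: flat_exp_def\<close>)
  next
    case 2
    have "((\<lambda>x. 0) has_real_derivative flat_exp (k + 2) x - real k * flat_exp (k + 1) x) (at x)"
      using 2 by (auto simp: flat_exp_def)
    then show ?thesis
      by (rule has_field_derivative_transform_within_open[where S = "{..<0}"])
        (use 2 in \<open>auto simp: flat_exp_def\<close>)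
  next
    case 3
    have "flat_exp k (0 + h) / h = flat_exp (Suc k) h" for h
      by (auto simp: flat_exp_def)
    moreover have "flat_exp k 0 = 0" "flat_exp (k + 2) 0 - real k * flat_exp (k + 1) 0 = 0"
      by (auto simp: flat_exp_def)
    ultimately show ?thesis
      using flat_exp_tendsto[of "Suc k"] 3 by (simp add: DERIV_def)
  qed
qed

lemma continuously_diff_flat_exp: "continuously_diff n (flat_exp k)"
proof (induction n arbitrary: k)
  case 0
  show ?case
    using flat_exp_deriv by (auto intro!: continuous_at_imp_continuous_on DERIV_isCont)
next
  case (Suc n)
  have "continuously_diff n (\<lambda>x. flat_exp (k + 2) x + - real k * flat_exp (k + 1) x)"
    by (intro continuously_diff_add continuously_diff_mult continuously_diff_const Suc)
  then show ?case
    by (subst continuously_diff_Suc_real[OF flat_exp_deriv]) simp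
qed

text \<open>
  Smooth functions that are positive exactly on \<open>(a,b)\<close> and tend there to 1 as \<open>n\<close> grows, since both
  exponents are of order \<open>1/n\<close>. They approximate the indicator of the interval by test functions.
\<close>

definition plateau :: "real \<Rightarrow> real \<Rightarrow> nat \<Rightarrow> real \<Rightarrow> real" where
  "plateau a b n x = flat_exp 0 (real (Suc n) * (x - a)) * flat_exp 0 (real (Suc n) * (b - x))"

lemma continuously_diff_plateau: "continuously_diff k (plateau a b n)"
proof -
  have "continuously_diff k (\<lambda>x. flat_exp 0 (real (Suc n) * x + (- real (Suc n) * a)) *
      flat_exp 0 (- real (Suc n) * x + real (Suc n) * b))"
    by (intro continuously_diff_mult continuously_diff_affine continuously_diff_flat_exp)
  then show ?thesis
    unfolding plateau_def[abs_def] by (simp add: algebra_simps)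
qed

lemma plateau_bounds: "0 \<le> plateau a b n x" "plateau a b n x \<le> 1"
  by (auto simp: plateau_def flat_exp_def intro!: mult_le_one)

lemma plateau_nonzero_iff: "plateau a b n x \<noteq> 0 \<longleftrightarrow> a < x \<and> x < b"
  by (auto simp: plateau_def flat_exp_def zero_less_mult_iff)

lemma plateau_tendsto: "(\<lambda>n. plateau a b n x) \<longlonglongrightarrow> indicator {a<..<b} x"
proof (cases "a < x \<and> x < b")
  case True
  have "(\<lambda>n. exp (- (1 / (real (Suc n) * d)))) \<longlonglongrightarrow> 1" if "d > 0" for d
  proof -
    have "(\<lambda>n. exp (- (inverse (real (Suc n)) * (1 / d)))) \<longlonglongrightarrow> exp (- (0 * (1 / d)))"
      by (intro tendsto_intros LIMSEQ_inverse_real_of_nat)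
    then show ?thesis by (simp add: field_simps)
  qed
  from tendsto_mult[OF this[of "x - a"] this[of "b - x"]] True
  show ?thesis
    by (simp add: plateau_def flat_exp_def zero_less_mult_iff)
next
  case False
  then have "plateau a b n x = 0" for n using plateau_nonzero_iff by blast
  then show ?thesis using False by (auto simp: indicator_def)
qed

lemma test_functionI:
  assumes "\<And>k. continuously_diff k f" and "\<And>x. x \<notin> {a..b} \<Longrightarrow> f x = 0" and "0 < a" "b < T"
  shows "test_function {0<..<T} (f :: real \<Rightarrow> real)"
proof -
  have "{x. f x \<noteq> 0} \<subseteq> {a..b}"
    using assms(2) by blast
  then have "closure {x. f x \<noteq> 0} \<subseteq> {a..b}"
    by (intro closure_minimal) auto
  then show ?thesis
    unfolding test_function_def using assms
    by (auto simp: compact_eq_bounded_closed intro: bounded_subset[of "{a..b}"])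
qed

lemma test_function_plateau:
  assumes "0 < a" "b < T"
  shows "test_function {0<..<T} (plateau a b n)"
  by (rule test_functionI[where a = a and b = b])
    (use assms continuously_diff_plateau plateau_nonzero_iff in \<open>auto intro: ccontr\<close>)

lemma test_functionE:
  fixes p :: "real \<Rightarrow> real"
  assumes "test_function {0<..<T} p"
  obtains a b where "0 < a" "a < b" "b < T" "\<And>x. x \<notin> {a..b} \<Longrightarrow> p x = 0" | "p = (\<lambda>_. 0)"
proof (cases "p = (\<lambda>_. 0)")
  case False
  let ?K = "closure {x. p x \<noteq> 0}"
  have K: "compact ?K" "?K \<subseteq> {0<..<T}" "?K \<noteq> {}"
    using assms False by (auto simp: test_function_def)
  obtain a b where a: "a \<in> ?K" "\<forall>t\<in>?K. a \<le> t" and b: "b \<in> ?K" "\<forall>t\<in>?K. t \<le> b"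
    using compact_attains_inf[OF K(1,3)] compact_attains_sup[OF K(1,3)] by blast
  have sub: "{x. p x \<noteq> 0} \<subseteq> ?K" by (rule closure_subset)
  have "0 < a" "b < T" "a \<le> b" using a b K(2) by auto
  have "p x = 0" if "x \<notin> {a / 2..b}" for x
  proof (rule ccontr)
    assume "p x \<noteq> 0"
    then have "x \<in> ?K" using sub by blast
    then have "a \<le> x" "x \<le> b" using a b by blast+
    then show False using that \<open>0 < a\<close> by auto
  qed
  then show ?thesis
    by (intro that(1)[of "a / 2" b]) (use \<open>0 < a\<close> \<open>b < T\<close> \<open>a \<le> b\<close> in auto)
qed (use that in auto)

lemma test_function_derivs:
  fixes p :: "real \<Rightarrow> real"
  assumes "test_function {0<..<T} p"
  shows "(p has_real_derivative deriv p x) (at x)" "continuous_on UNIV (deriv p)"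
    "continuously_diff k (deriv p)" "continuous_on UNIV p" "p 0 = 0" "p T = 0"
proof -
  have *: "continuously_diff (Suc k) p" for k using assms by (simp add: test_function_def)
  obtain f' where f': "\<And>x. (p has_real_derivative f' x) (at x)" 
    using *[of 0] by (metis continuously_diff_SucE)
  then have d: "deriv p = f'" by (auto intro: DERIV_imp_deriv)
  show "(p has_real_derivative deriv p x) (at x)" using f' d by simp
  have c: "continuously_diff k (deriv p)" for k
    using *[of k] continuously_diff_Suc_real[OF f'] d by blast
  from c[of k] show "continuously_diff k (deriv p)" .
  from c[of 0] show "continuous_on UNIV (deriv p)" by simp
  show "continuous_on UNIV p"
    using continuously_diff_Suc_imp[OF *[of 0]] by simp
  have "{x. p x \<noteq> 0} \<subseteq> {0<..<T}"
    using assms closure_subset[of "{x. p x \<noteq> 0}"] by (auto simp: test_function_def)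
  then show "p 0 = 0" "p T = 0" by auto
qed

section \<open>Integrals over the time interval\<close>

lemma integrable_time_measure_iff:
  fixes f :: "real \<Rightarrow> real"
  shows "integrable (time_measure T) f \<longleftrightarrow> f absolutely_integrable_on {0..T}"
  unfolding absolutely_integrable_on_Icc_iff_Ioo
  by (simp add: set_integrable_def integrable_restrict_space)

lemma integral_time_measure:
  fixes f :: "real \<Rightarrow> real"
  assumes "integrable (time_measure T) f"
  shows "integral\<^sup>L (time_measure T) f = integral {0..T} f"
  using lebesgue_integral_eq_integral[OF assms] by (simp add: integral_open_interval_real)

lemma integrable_on_initial_interval:
  fixes f :: "real \<Rightarrow> real"
  assumes "integrable (time_measure T) f" "t \<le> T"
  shows "f integrable_on {0..t}" "integrable (time_measure t) f"
proof -
  show "integrable (time_measure t) f"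
    using assms absolutely_integrable_on_subinterval[where f = f and S = "{0..T}" and a = 0 and b = t]
    by (auto simp: integrable_time_measure_iff)
  then show "f integrable_on {0..t}"
    by (auto simp: integrable_time_measure_iff absolutely_integrable_on_def)
qed

lemma integrable_time_measure_continuous:
  fixes f :: "real \<Rightarrow> real"
  assumes "continuous_on {0..T} f"
  shows "integrable (time_measure T) f"
  using assms unfolding integrable_time_measure_iff by (rule absolutely_integrable_continuous_real)

lemma integrable_time_measure_mult:
  fixes f :: "real \<Rightarrow> real"
  assumes "continuous_on {0..T} f" "integrable (time_measure T) g"
  shows "integrable (time_measure T) (\<lambda>t. f t * g t)"
proof -
  have "bounded (f ` {0..T})"
    using compact_continuous_image[OF assms(1)] by (simp add: compact_imp_bounded)
  moreover have "f \<in> borel_measurable (lebesgue_on {0..T})"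
    using assms(1) by (rule continuous_imp_measurable_on_sets_lebesgue) auto
  ultimately show ?thesis
    using assms(2) unfolding integrable_time_measure_iff
    by (intro absolutely_integrable_bounded_measurable_product_real) auto
qed

text \<open>
  The bridge between equality almost everywhere for the Lebesgue measure on \<open>(0,T)\<close> and the gauge
  integral over the closed interval: the two sets differ by the end points only.
\<close>

lemma integral_cong_time_measure_AE:
  fixes f :: "real \<Rightarrow> real"
  assumes "AE t in time_measure T. f t = g t" "t \<le> T"
  shows "integral {0..t} f = integral {0..t} g"
proof -
  have "AE x in lebesgue. x \<in> {0<..<T} \<longrightarrow> f x = g x"
    using assms(1) by (simp add: AE_restrict_space_iff)
  then have "{x. \<not> (x \<in> {0<..<T} \<longrightarrow> f x = g x)} \<in> null_sets lebesgue" (is "?N \<in> _")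
    by (simp add: completion.AE_iff_null_sets)
  then have "negligible ?N"
    by (simp only: negligible_iff_null_sets)
  then have "negligible (?N \<union> {0, T})"
    by (intro negligible_Un) auto
  moreover have "g x = f x" if "x \<in> {0..t} - (?N \<union> {0, T})" for x
    using that assms(2) by auto
  ultimately show ?thesis by (rule integral_spike)
qed

lemma indefinite_integral_continuous:
  fixes p :: "real \<Rightarrow> real"
  assumes "integrable (time_measure T) p"
  shows "continuous_on {0..T} (\<lambda>t. integral {0..t} p)"
  using integrable_on_initial_interval[OF assms order_refl] by (intro indefinite_integral_continuous_1)

lemma integral_indicator_lessThan:
  fixes p :: "real \<Rightarrow> real"
  assumes "integrable (time_measure T) p" "0 \<le> t" "t \<le> T"
  shows "(\<integral>r. indicator {..<t} r * p r \<partial>time_measure T) = integral {0..t} p"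
proof -
  have "(\<integral>r. indicator {..<t} r * p r \<partial>time_measure T) =
      (\<integral>r. indicator {0<..<T} r * (indicator {..<t} r * p r) \<partial>lebesgue)"
    by (simp add: integral_restrict_space)
  also have "\<dots> = (\<integral>r. indicator {0<..<t} r * p r \<partial>lebesgue)"
    using assms by (intro Bochner_Integration.integral_cong) (auto simp: indicator_def)
  also have "\<dots> = integral\<^sup>L (time_measure t) p"
    by (simp add: integral_restrict_space)
  also have "\<dots> = integral {0..t} p"
    using integrable_on_initial_interval[OF assms(1,3)] by (simp add: integral_time_measure)
  finally show ?thesis .
qed

text \<open>
  Integration by parts against a primitive of a function that is merely integrable. The function
  \<open>q'(t) p(r)\<close> is integrated over the triangle \<open>r < t\<close> in both orders: the integral over \<open>r\<close> produces the
  primitive of \<open>p\<close>, the integral over \<open>t\<close> produces \<open>q(T) - q(r)\<close>.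
\<close>

lemma integral_derivative_mult_primitive:
  fixes p :: "real \<Rightarrow> real"
  assumes p: "integrable (time_measure T) p" and T: "0 \<le> T"
    and q: "\<And>t. (q has_real_derivative q' t) (at t)" "continuous_on UNIV q'"
  shows "integral {0..T} (\<lambda>t. q' t * integral {0..t} p) =
    q T * integral {0..T} p - integral {0..T} (\<lambda>t. q t * p t)"
proof -
  let ?M = "time_measure T"
  interpret finite_measure ?M
    by (rule finite_measure_lebesgue_on) simp
  interpret pair_sigma_finite ?M ?M ..
  have [measurable]: "p \<in> borel_measurable ?M" using p by simp
  have [measurable]: "q' \<in> borel_measurable borel"
    using q(2) by (rule borel_measurable_continuous_onI)
  have [measurable]: "(\<lambda>x. x) \<in> borel_measurable ?M"
    using id_borel_measurable_lebesgue_on[of "{0<..<T}"] by (simp add: id_def)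
  have cq: "continuous_on S q" "continuous_on S q'" for S
    using q by (auto intro: continuous_on_subset continuous_at_imp_continuous_on DERIV_isCont)
  obtain K where "\<forall>y\<in>q' ` {0..T}. norm y \<le> K"
    using compact_imp_bounded[OF compact_continuous_image[OF cq(2) compact_Icc[of 0 T]]]
    unfolding bounded_iff by blast
  then have K: "\<bar>q' t\<bar> \<le> K" if "t \<in> {0..T}" for t using that by simp
  define F where "F t r = indicator {..<t} r * (q' t * p r)" for t r
  have F_meas: "(\<lambda>(t, r). F t r) \<in> borel_measurable (?M \<Otimes>\<^sub>M ?M)"
  proof -
    have "(\<lambda>(t, r). if r < t then q' t * p r else 0) \<in> borel_measurable (?M \<Otimes>\<^sub>M ?M)"
      by measurable
    then show ?thesis
      by (rule back_subst[where P = "\<lambda>f. f \<in> borel_measurable (?M \<Otimes>\<^sub>M ?M)"]) (auto simp: F_def indicator_def fun_eq_iff)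
  qed
  have F_int: "integrable ?M (F t)" if "t \<in> space ?M" for t
    unfolding F_def
    by (rule Bochner_Integration.integrable_bound[of ?M "\<lambda>r. q' t * p r"])
      (use p in \<open>auto simp: indicator_def\<close>)
  (* F is dominated by K |p r|, which is integrable over the square. *)
  have "integrable (?M \<Otimes>\<^sub>M ?M) (case_prod F)"
  proof (rule Fubini_integrable)
    show "case_prod F \<in> borel_measurable (?M \<Otimes>\<^sub>M ?M)" using F_meas .
    show "AE t in ?M. integrable ?M (\<lambda>r. case_prod F (t, r))" using F_int by auto
    have m: "(\<lambda>t. \<integral>r. norm (case_prod F (t, r)) \<partial>?M) \<in> borel_measurable ?M"
      using F_meas by measurable
    show "integrable ?M (\<lambda>t. \<integral>r. norm (case_prod F (t, r)) \<partial>?M)"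
    proof (rule integrable_const_bound[OF _ m])
      show "AE t in ?M. norm (\<integral>r. norm (case_prod F (t, r)) \<partial>?M) \<le> (\<integral>r. K * \<bar>p r\<bar> \<partial>?M)"
      proof (rule AE_I2)
        fix t assume t: "t \<in> space ?M"
        have "(\<integral>r. norm (F t r) \<partial>?M) \<le> (\<integral>r. K * \<bar>p r\<bar> \<partial>?M)"
        proof (rule integral_mono)
          fix r show "norm (F t r) \<le> K * \<bar>p r\<bar>"
            using K[of t] t mult_right_mono[of "\<bar>q' t\<bar>" K "\<bar>p r\<bar>"]
            by (auto simp: F_def indicator_def abs_mult intro: order_trans[OF abs_ge_zero])
        qed (use F_int[OF t] p in auto)
        then show "norm (\<integral>r. norm (case_prod F (t, r)) \<partial>?M) \<le> (\<integral>r. K * \<bar>p r\<bar> \<partial>?M)"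
          by simp
      qed
    qed
  qed
  from Fubini_integral[OF this]
  have swap: "(\<integral>r. (\<integral>t. F t r \<partial>?M) \<partial>?M) = (\<integral>t. (\<integral>r. F t r \<partial>?M) \<partial>?M)" .
  have inner1: "(\<integral>r. F t r \<partial>?M) = q' t * integral {0..t} p" if "t \<in> space ?M" for t
  proof -
    have "(\<integral>r. F t r \<partial>?M) = (\<integral>r. q' t * (indicator {..<t} r * p r) \<partial>?M)"
      by (simp add: F_def mult_ac)
    then show ?thesis
      using that integral_indicator_lessThan[OF p, of t] by simp
  qed
  have inner2: "(\<integral>t. F t r \<partial>?M) = q T * p r - q r * p r" if r: "r \<in> space ?M" for r
  proof -
    have ii: "integrable (time_measure T) q'" "integrable (time_measure r) q'"
      using cq by (auto intro: integrable_time_measure_continuous)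
    have FTC: "integral {0..t} q' = q t - q 0" if "0 \<le> t" for t
      using q(1) that
      by (intro integral_unique fundamental_theorem_of_calculus)
        (auto simp: has_real_derivative_iff_has_vector_derivative[symmetric]
          intro: has_field_derivative_at_within)
    have "(\<integral>t. F t r \<partial>?M) = (\<integral>t. p r * (q' t - indicator {..<r} t * q' t - indicator {r} t * q' t) \<partial>?M)"
      by (intro Bochner_Integration.integral_cong) (auto simp: F_def indicator_def)
    also have "\<dots> = (\<integral>t. p r * (q' t - indicator {..<r} t * q' t) \<partial>?M)"
    proof (rule integral_cong_AE)
      have "AE t in ?M. t \<noteq> r"
        by (auto simp: AE_restrict_space_iff intro!: AE_I'[of "{r}"])
      then show "AE t in ?M. p r * (q' t - indicator {..<r} t * q' t - indicator {r} t * q' t) =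
          p r * (q' t - indicator {..<r} t * q' t)"
        by eventually_elim auto
    qed measurable
    also have "\<dots> = p r * (integral {0..T} q' - integral {0..r} q')"
    proof -
      have "integrable ?M (\<lambda>t. indicator {..<r} t * q' t)"
        by (rule Bochner_Integration.integrable_bound[OF ii(1)]) (auto simp: indicator_def)
      then show ?thesis
        using r ii integral_indicator_lessThan[OF ii(1), of r] by (simp add: integral_time_measure)
    qed
    also have "\<dots> = q T * p r - q r * p r"
      using r by (simp add: FTC algebra_simps)
    finally show ?thesis .
  qed
  have i1: "integrable ?M (\<lambda>t. q' t * integral {0..t} p)"
    by (intro integrable_time_measure_continuous continuous_intros cq indefinite_integral_continuous p)
  have i2: "integrable ?M (\<lambda>t. q t * p t)"
    by (intro integrable_time_measure_mult cq p)
  have "integral {0..T} (\<lambda>t. q' t * integral {0..t} p) = (\<integral>t. (\<integral>r. F t r \<partial>?M) \<partial>?M)"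
    unfolding integral_time_measure[OF i1, symmetric]
    by (intro Bochner_Integration.integral_cong) (simp_all add: inner1)
  also have "\<dots> = (\<integral>r. q T * p r - q r * p r \<partial>?M)"
    unfolding swap[symmetric] by (intro Bochner_Integration.integral_cong) (simp_all add: inner2)
  also have "\<dots> = q T * integral {0..T} p - integral {0..T} (\<lambda>t. q t * p t)"
    using i2 p by (simp add: integral_time_measure)
  finally show ?thesis .
qed

lemma integral_by_parts_primitive:
  fixes p :: "real \<Rightarrow> real"
  assumes p: "integrable (time_measure T) p" and t: "0 \<le> t" "t \<le> T"
    and q: "\<And>t. (q has_real_derivative q' t) (at t)" "continuous_on UNIV q'"
    and F: "\<And>t. t \<in> {0..T} \<Longrightarrow> F t = c + integral {0..t} p"
  shows "q t * F t = q 0 * c + integral {0..t} (\<lambda>r. q' r * F r + q r * p r)"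
proof -
  have cq: "continuous_on S q" "continuous_on S q'" for S
    using q by (auto intro: continuous_on_subset continuous_at_imp_continuous_on DERIV_isCont)
  have pt: "integrable (time_measure t) p"
    using integrable_on_initial_interval[OF p t(2)] by simp
  have FTC: "integral {0..t} q' = q t - q 0"
    using q(1) t
    by (intro integral_unique fundamental_theorem_of_calculus)
      (auto simp: has_real_derivative_iff_has_vector_derivative[symmetric]
        intro: has_field_derivative_at_within)
  have i1: "(\<lambda>r. q' r * integral {0..r} p) integrable_on {0..t}"
    by (intro integrable_continuous_real continuous_intros cq indefinite_integral_continuous pt)
  have i2: "(\<lambda>r. q r * p r) integrable_on {0..t}"
    using integrable_on_initial_interval(1)[OF integrable_time_measure_mult[OF cq(1) pt] order_refl] .
  have i3: "(\<lambda>r. q' r * c) integrable_on {0..t}"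
    by (intro integrable_continuous_real continuous_intros cq)
  have "integral {0..t} (\<lambda>r. q' r * F r + q r * p r) =
      integral {0..t} (\<lambda>r. (q' r * c + q' r * integral {0..r} p) + q r * p r)"
    using F t by (intro integral_cong) (auto simp: algebra_simps)
  also have "\<dots> = integral {0..t} q' * c + integral {0..t} (\<lambda>r. q' r * integral {0..r} p) +
      integral {0..t} (\<lambda>r. q r * p r)"
    using i1 i2 i3 by (simp add: integral_add integrable_add)
  also have "\<dots> = (q t - q 0) * c + q t * integral {0..t} p"
    using integral_derivative_mult_primitive[OF pt t(1) q] by (simp add: FTC)
  finally show ?thesis
    using F[of t] t by (simp add: algebra_simps)
qed

section \<open>Weak derivatives of functions of time\<close>

text \<open>
  The open intervals generate the Borel sets and are stable under intersection, so the integral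
  vanishes over every Borel set.
\<close>

lemma AE_zero_if_integral_intervals_zero:
  fixes f :: "real \<Rightarrow> real"
  assumes f: "integrable lborel f"
    and zero: "\<And>a b. (\<integral>x. indicator {a<..<b} x * f x \<partial>lborel) = 0"
  shows "AE x in lborel. f x = 0"
proof (rule density_unique_real[OF f])
  show "integrable lborel (\<lambda>_. 0::real)" by simp
  have ind: "integrable lborel (\<lambda>x. indicator A x * f x)" if "A \<in> sets borel" for A
    using integrable_mult_indicator[of A lborel f] f that by simp
  have tot: "(\<integral>x. f x \<partial>lborel) = 0"
  proof -
    have "(\<lambda>n. \<integral>x. indicator {- real n<..<real n} x * f x \<partial>lborel) \<longlonglongrightarrow> (\<integral>x. f x \<partial>lborel)"
    proof (rule integral_dominated_convergence[where w = "\<lambda>x. \<bar>f x\<bar>"])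
      show "AE x in lborel. (\<lambda>n. indicator {- real n<..<real n} x * f x) \<longlonglongrightarrow> f x"
      proof (rule AE_I2)
        fix x :: real
        obtain N where N: "\<bar>x\<bar> < real N" using reals_Archimedean2 by blast
        have "eventually (\<lambda>n. indicator {- real n<..<real n} x * f x = f x) sequentially"
          using eventually_ge_at_top[of N] by eventually_elim (use N in \<open>auto simp: indicator_def\<close>)
        then show "(\<lambda>n. indicator {- real n<..<real n} x * f x) \<longlonglongrightarrow> f x"
          by (rule tendsto_eventually)
      qed
    qed (use f in \<open>auto simp: indicator_def\<close>)
    then show ?thesis
      using zero by (simp add: LIMSEQ_const_iff)
  qed
  have "(\<integral>x. indicator A x * f x \<partial>lborel) = 0" if A: "A \<in> sets borel" for A
  proof -
    let ?G = "range (\<lambda>(a, b). {a<..<b :: real})"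
    have "sets borel = sigma_sets UNIV ?G"
      by (subst borel_eq_box) (simp add: box_real[abs_def])
    with A have AG: "A \<in> sigma_sets UNIV ?G" by simp
    have "Int_stable ?G" by (auto simp: Int_stable_def box_Int_box simp flip: box_real)
    moreover have "?G \<subseteq> Pow UNIV" by simp
    ultimately show ?thesis using AG
    proof (induction rule: sigma_sets_induct_disjoint)
      case (basic A)
      then show ?case using zero by auto
    next
      case empty
      show ?case by simp
    next
      case (compl A)
      then have "A \<in> sets borel" using \<open>sets borel = _\<close> by simp
      have "(\<integral>x. indicator (UNIV - A) x * f x \<partial>lborel) = (\<integral>x. f x - indicator A x * f x \<partial>lborel)"
        by (intro Bochner_Integration.integral_cong) (auto simp: indicator_def)
      then show ?case
        using compl ind[OF \<open>A \<in> sets borel\<close>] f tot by simp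
    next
      case (union A)
      then have A: "A i \<in> sets borel" for i using \<open>sets borel = _\<close> by auto
      have "(LINT x:(\<Union>i. A i)|lborel. f x) = (\<Sum>i. (LINT x:(A i)|lborel. f x))"
      proof (rule lebesgue_integral_countable_add)
        show "A i \<inter> A j = {}" if "i \<noteq> j" for i j
          using union(1) that by (auto simp: disjoint_family_on_def)
        show "set_integrable lborel (\<Union> (range A)) f"
          using ind[of "\<Union> (range A)"] A by (simp add: set_integrable_def)
      qed (use A in auto)
      then show ?case
        using union(3) by (simp add: set_lebesgue_integral_def)
    qed
  qed
  then show "(LINT x:A|lborel. f x) = (LINT x:A|lborel. 0)" if "A \<in> sets lborel" for A
    using that by (simp add: set_lebesgue_integral_def)
qed

lemma interval_not_AE_avoided:
  fixes a b :: real
  assumes "a < b"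
  shows "\<not> (AE t in lebesgue. t \<notin> {a<..<b})"
proof
  assume "AE t in lebesgue. t \<notin> {a<..<b}"
  then have "{t. \<not> t \<notin> {a<..<b}} \<in> null_sets lebesgue"
    by (simp only: completion.AE_iff_null_sets) simp
  then have "negligible (box a b)"
    by (simp only: negligible_iff_null_sets box_real not_not Collect_mem_eq)
  then show False
    using negligible_interval(2)[of a b] assms by (simp add: box_real)
qed

lemma AE_time_measure_iff: "(AE t in time_measure T. P t) \<longleftrightarrow> (AE t in lebesgue. t \<in> {0<..<T} \<longrightarrow> P t)"
  by (simp add: AE_restrict_space_iff)

text \<open>
  The plateau functions are test functions that tend boundedly to the indicator of an interval, so
  \<open>p\<close> has integral 0 over every interval inside \<open>(0,T)\<close>.
\<close>

lemma fundamental_lemma_calculus_of_variations: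
  fixes p :: "real \<Rightarrow> real"
  assumes p: "integrable (time_measure T) p"
    and test: "\<And>\<psi>. test_function {0<..<T} \<psi> \<Longrightarrow> (\<integral>t. \<psi> t * p t \<partial>time_measure T) = 0"
  shows "AE t in time_measure T. p t = 0"
proof -
  let ?M = "time_measure T"
  have [measurable]: "p \<in> borel_measurable ?M" using p by simp
  have [measurable]: "(\<lambda>x. x) \<in> borel_measurable ?M"
    using id_borel_measurable_lebesgue_on[of "{0<..<T}"] by (simp add: id_def)
  have *: "(\<integral>t. indicator {a<..<b} t * p t \<partial>?M) = 0" if "0 < a" "b < T" for a b
  proof -
    have [measurable]: "plateau a b n \<in> borel_measurable borel" for n
      using continuously_diff_plateau[of 0 a b n] by (auto intro: borel_measurable_continuous_onI)
    have "(\<lambda>n. \<integral>t. plateau a b n t * p t \<partial>?M) \<longlonglongrightarrow> (\<integral>t. indicator {a<..<b} t * p t \<partial>?M)"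
    proof (rule integral_dominated_convergence[where w = "\<lambda>t. \<bar>p t\<bar>"])
      show "AE t in ?M. (\<lambda>n. plateau a b n t * p t) \<longlonglongrightarrow> indicator {a<..<b} t * p t"
        by (intro AE_I2 tendsto_intros plateau_tendsto)
      show "AE t in ?M. norm (plateau a b n t * p t) \<le> \<bar>p t\<bar>" for n
        using plateau_bounds[of a b n] by (auto simp: abs_mult intro!: mult_left_le_one_le)
    qed (use p in auto)
    then show ?thesis
      using test[OF test_function_plateau[OF that]] by (simp add: LIMSEQ_const_iff)
  qed
  have **: "(\<integral>t. indicator {a<..<b} t * p t \<partial>?M) = 0" for a b
  proof -
    (* Test functions need compact support, so the interval is first pulled away from 0 and T. *)
    define a' b' where "a' n = max a (inverse (real (Suc n)))" and "b' n = min b (T - inverse (real (Suc n)))" for n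
    have "(\<lambda>n. \<integral>t. indicator {a' n<..<b' n} t * p t \<partial>?M) \<longlonglongrightarrow> (\<integral>t. indicator {a<..<b} t * p t \<partial>?M)"
    proof (rule integral_dominated_convergence[where w = "\<lambda>t. \<bar>p t\<bar>"])
      show "AE t in ?M. (\<lambda>n. indicator {a' n<..<b' n} t * p t) \<longlonglongrightarrow> indicator {a<..<b} t * p t"
      proof (rule AE_I2)
        fix t assume t: "t \<in> space ?M"
        have "eventually (\<lambda>n. inverse (real (Suc n)) < t) sequentially"
          "eventually (\<lambda>n. inverse (real (Suc n)) < T - t) sequentially"
          using t by (intro order_tendstoD(2)[OF LIMSEQ_inverse_real_of_nat]; simp)+
        then have "eventually (\<lambda>n. indicator {a' n<..<b' n} t * p t = indicator {a<..<b} t * p t) sequentially"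
          by eventually_elim (auto simp: a'_def b'_def indicator_def)
        then show "(\<lambda>n. indicator {a' n<..<b' n} t * p t) \<longlonglongrightarrow> indicator {a<..<b} t * p t"
          by (rule tendsto_eventually)
      qed
    qed (use p in \<open>auto simp: indicator_def\<close>)
    moreover have "(\<integral>t. indicator {a' n<..<b' n} t * p t \<partial>?M) = 0" for n
      by (rule *) (auto simp: a'_def b'_def intro: less_le_trans[OF _ max.cobounded2] le_less_trans[OF min.cobounded2])
    ultimately show ?thesis by (simp add: LIMSEQ_const_iff)
  qed
  (* A Borel representative of p, extended by 0, brings the statement into the scope of lborel. *)
  have "integrable lebesgue (\<lambda>t. indicator {0<..<T} t * p t)"
    using p by (simp add: integrable_restrict_space)
  then obtain q where q[measurable]: "q \<in> borel_measurable lborel"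
    and qp: "AE t in lborel. indicator {0<..<T} t * p t = q t"
    using completion_ex_borel_measurable_real[of "\<lambda>t. indicator {0<..<T} t * p t" lborel] by auto
  have qp': "AE t in lebesgue. indicator {0<..<T} t * p t = q t"
    using qp by (rule AE_completion)
  have qm: "q \<in> borel_measurable lebesgue" using q by (rule measurable_completion)
  have pm: "(\<lambda>t. indicator {0<..<T} t * p t) \<in> borel_measurable lebesgue"
    using \<open>integrable lebesgue _\<close> by (rule borel_measurable_integrable)
  have "integrable lebesgue q"
    using integrable_cong_AE[OF pm qm qp'] \<open>integrable lebesgue _\<close> by blast
  then have "integrable lborel q" by (simp add: integrable_completion)
  then have "AE t in lborel. q t = 0"
  proof (rule AE_zero_if_integral_intervals_zero)
    fix a b :: real
    have "(\<integral>x. indicator {a<..<b} x * q x \<partial>lborel) = (\<integral>x. indicator {a<..<b} x * q x \<partial>lebesgue)"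
      by (simp add: integral_completion)
    also have "\<dots> = (\<integral>x. indicator {0<..<T} x * (indicator {a<..<b} x * p x) \<partial>lebesgue)"
    proof (rule integral_cong_AE)
      have "(\<lambda>x. indicator {a<..<b} x * (indicator {0<..<T} x * p x)) \<in> borel_measurable lebesgue"
        by (intro borel_measurable_times pm borel_measurable_indicator) auto
      then show "(\<lambda>x. indicator {0<..<T} x * (indicator {a<..<b} x * p x)) \<in> borel_measurable lebesgue"
        by (simp add: mult.left_commute)
      show "(\<lambda>x. indicator {a<..<b} x * q x) \<in> borel_measurable lebesgue"
        by (intro borel_measurable_times qm borel_measurable_indicator) auto
      show "AE x in lebesgue. indicator {a<..<b} x * q x =
          indicator {0<..<T} x * (indicator {a<..<b} x * p x)"
        using qp' by eventually_elim (auto simp: indicator_def)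
    qed
    also have "\<dots> = (\<integral>t. indicator {a<..<b} t * p t \<partial>?M)"
      by (simp add: integral_restrict_space)
    finally show "(\<integral>x. indicator {a<..<b} x * q x \<partial>lborel) = 0" using ** by simp
  qed
  then have "AE t in lebesgue. q t = 0" by (rule AE_completion)
  with qp' have "AE t in lebesgue. t \<in> {0<..<T} \<longrightarrow> p t = 0"
    by eventually_elim (auto simp: indicator_def)
  then show ?thesis by (simp add: AE_time_measure_iff)
qed

lemma integrable_test_function_mult:
  assumes "test_function {0<..<T} \<psi>" "integrable (time_measure T) p"
  shows "integrable (time_measure T) (\<lambda>t. \<psi> t * p t)" "integrable (time_measure T) (\<lambda>t. deriv \<psi> t * p t)"
  using test_function_derivs[OF assms(1)] assms(2)
  by (auto intro!: integrable_time_measure_mult intro: continuous_on_subset)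

lemma continuously_diff_antiderivative:
  fixes q :: "real \<Rightarrow> real"
  assumes "\<And>x. (Q has_real_derivative q x) (at x)" "\<And>k. continuously_diff k q"
  shows "continuously_diff k Q"
  using continuously_diff_Suc_real[OF assms(1), of k] assms(2) continuously_diff_Suc_imp by blast

text \<open>
  To the left of the support of \<open>q\<close> the primitive is still 0, and to the right it has returned to 0
  because the total integral vanishes.
\<close>

lemma test_function_antiderivative:
  fixes q :: "real \<Rightarrow> real"
  assumes q: "\<And>k. continuously_diff k q" "\<And>x. x \<notin> {a..b} \<Longrightarrow> q x = 0" and ab: "0 < a" "a \<le> b" "b < T"
    and zero: "integral {0..T} q = 0"
  defines "Q \<equiv> \<lambda>t. integral {0..t} q"
  shows "test_function {0<..<T} Q" "deriv Q = q"
proof -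
  have cq: "continuous_on S q" for S
    using q(1)[of 0] by (auto intro: continuous_on_subset)
  have out: "integral {c..d} q = 0" if "\<And>x. x \<in> {c<..<d} \<Longrightarrow> x \<notin> {a..b}" for c d
  proof -
    have "integral {c..d} q = integral {c<..<d} q" by (simp add: integral_open_interval_real)
    also have "\<dots> = integral {c<..<d} (\<lambda>_. 0)" by (rule integral_cong) (use that q(2) in auto)
    finally show ?thesis by simp
  qed
  have Q0: "Q t = 0" if "t \<le> a" for t
    unfolding Q_def by (rule out) (use that in auto)
  have Q1: "Q t = 0" if "b \<le> t" for t
  proof -
    define s where "s = max t T"
    have int: "q integrable_on {c..d}" for c d by (intro integrable_continuous_real cq)
    have "integral {0..T} q + integral {T..s} q = integral {0..s} q"
      by (rule Henstock_Kurzweil_Integration.integral_combine) (use ab int in \<open>auto simp: s_def\<close>)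
    moreover have "integral {0..t} q + integral {t..s} q = integral {0..s} q"
      by (rule Henstock_Kurzweil_Integration.integral_combine) (use ab that int in \<open>auto simp: s_def\<close>)
    moreover have "integral {T..s} q = 0" "integral {t..s} q = 0"
      by (rule out; use ab that in auto)+
    ultimately show ?thesis using zero by (simp add: Q_def)
  qed
  have der: "(Q has_real_derivative q t) (at t)" for t
  proof (cases "t < a")
    case True
    have "((\<lambda>_. 0) has_real_derivative q t) (at t)" using True q(2) by simp
    then show ?thesis
      by (rule has_field_derivative_transform_within_open[where S = "{..<a}"]) (use True Q0 in auto)
  next
    case False
    have "(Q has_real_derivative q t) (at t within {0..t + 1})"
      unfolding Q_def by (rule integral_has_real_derivative[OF cq]) (use False ab in auto)
    then show ?thesis
      using False ab at_within_interior[of t "{0..t + 1}"] by (simp add: interior_atLeastAtMost_real)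
  qed
  show "deriv Q = q" using der by (auto intro: DERIV_imp_deriv)
  show "test_function {0<..<T} Q"
    by (rule test_functionI[of Q a b])
      (use continuously_diff_antiderivative[OF der q(1)] Q0 Q1 ab in auto)
qed

text \<open>
  Fix a bump \<open>\<eta>\<close> with integral \<open>m\<close>. Subtracting from a test function the multiple of \<open>\<eta>\<close> with the same
  integral leaves a derivative of a test function, against which \<open>p\<close> integrates to 0. Hence \<open>p - c\<close>,
  with \<open>c = (\<integral>\<eta> p)/m\<close>, is orthogonal to all test functions.
\<close>

lemma du_Bois_Reymond:
  fixes p :: "real \<Rightarrow> real"
  assumes p: "integrable (time_measure T) p" and T: "0 < T"
    and test: "\<And>\<psi>. test_function {0<..<T} \<psi> \<Longrightarrow> (\<integral>t. deriv \<psi> t * p t \<partial>time_measure T) = 0"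
  obtains c where "AE t in time_measure T. p t = c"
proof -
  let ?M = "time_measure T"
  have fin: "finite_measure ?M" by (rule finite_measure_lebesgue_on) simp
  define \<eta> where "\<eta> = plateau (T / 3) (2 * T / 3) 0"
  have \<eta>: "test_function {0<..<T} \<eta>"
    unfolding \<eta>_def using T by (intro test_function_plateau) auto
  note int = integrable_test_function_mult(1)
  have one: "integrable ?M (\<lambda>_. 1 :: real)"
    using fin by (simp add: finite_measure.integrable_const)
  have iT: "integrable ?M \<psi>" if "test_function {0<..<T} \<psi>" for \<psi>
    using int[OF that one] by simp
  define m where "m = (\<integral>t. \<eta> t \<partial>?M)"
  have "m \<noteq> 0"
  proof
    assume "m = 0"
    then have "AE t in ?M. \<eta> t = 0"
      using integral_nonneg_eq_0_iff_AE[OF iT[OF \<eta>]] plateau_bounds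
      by (simp add: m_def \<eta>_def)
    then have "AE t in lebesgue. t \<notin> {T / 3<..<2 * T / 3}"
      unfolding AE_time_measure_iff
    proof eventually_elim
      case (elim t)
      then show ?case using T plateau_nonzero_iff[of "T / 3" "2 * T / 3" 0 t] by (auto simp: \<eta>_def)
    qed
    then show False
      using interval_not_AE_avoided[of "T / 3" "2 * T / 3"] T by simp
  qed
  define c where "c = (\<integral>t. \<eta> t * p t \<partial>?M) / m"
  have "AE t in ?M. p t - c = 0"
  proof (rule fundamental_lemma_calculus_of_variations)
    show "integrable ?M (\<lambda>t. p t - c)"
      using p one by (intro Bochner_Integration.integrable_diff) (auto intro: finite_measure.integrable_const[OF fin])
  next
    fix \<psi> :: "real \<Rightarrow> real" assume \<psi>: "test_function {0<..<T} \<psi>"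
    define q where "q t = \<psi> t + (- (integral\<^sup>L ?M \<psi> / m)) * \<eta> t" for t
    have iq: "integrable ?M q"
      unfolding q_def[abs_def] using iT[OF \<psi>] iT[OF \<eta>] by auto
    obtain a b where ab: "0 < a" "a \<le> b" "b < T" "\<And>x. x \<notin> {a..b} \<Longrightarrow> q x = 0"
    proof -
      have \<eta>0: "\<eta> x = 0" if "x \<notin> {T / 3..2 * T / 3}" for x
        using that plateau_nonzero_iff[of "T / 3" "2 * T / 3" 0 x] by (auto simp: \<eta>_def)
      from \<psi> show ?thesis
      proof (cases rule: test_functionE)
        case (1 a b)
        have "q x = 0" if "x \<notin> {min a (T / 3)..max b (2 * T / 3)}" for x
          using that 1(4)[of x] \<eta>0[of x] by (force simp: q_def)
        then show ?thesis
          by (intro that[of "min a (T / 3)" "max b (2 * T / 3)"]) (use 1 T in auto)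
      next
        case 2
        show ?thesis
          by (rule that[of "T / 3" "2 * T / 3"]) (use 2 T \<eta>0 in \<open>auto simp: q_def\<close>)
      qed
    qed
    have "continuously_diff k q" for k
      unfolding q_def[abs_def] using \<psi> \<eta>
      by (intro continuously_diff_add continuously_diff_mult continuously_diff_const)
        (auto simp: test_function_def)
    moreover have "integral {0..T} q = 0"
    proof -
      have "integral {0..T} q = integral\<^sup>L ?M q" using iq by (simp add: integral_time_measure)
      also have "\<dots> = 0"
        unfolding q_def[abs_def] using iT[OF \<psi>] iT[OF \<eta>] \<open>m \<noteq> 0\<close> by (simp add: m_def)
      finally show ?thesis .
    qed
    ultimately have "(\<integral>t. q t * p t \<partial>?M) = 0"
      using test_function_antiderivative[of q a b T] ab test by metis
    moreover have "(\<integral>t. q t * p t \<partial>?M) = (\<integral>t. \<psi> t * p t - (integral\<^sup>L ?M \<psi> / m) * (\<eta> t * p t) \<partial>?M)"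
      by (intro Bochner_Integration.integral_cong) (auto simp: q_def algebra_simps)
    ultimately have "(\<integral>t. \<psi> t * p t \<partial>?M) = integral\<^sup>L ?M \<psi> * c"
      using int[OF \<psi> p] int[OF \<eta> p] by (simp add: c_def)
    then show "(\<integral>t. \<psi> t * (p t - c) \<partial>?M) = 0"
      using int[OF \<psi> p] iT[OF \<psi>] by (simp add: right_diff_distrib)
  qed
  then show ?thesis by (intro that[of c]) simp
qed

text \<open>
  The boundary terms vanish because \<open>\<psi>\<close> does at both ends.
\<close>

lemma weak_derivative_of_primitive:
  fixes p :: "real \<Rightarrow> real"
  assumes p: "integrable (time_measure T) p" and T: "0 \<le> T"
    and F: "\<And>t. t \<in> {0..T} \<Longrightarrow> F t = c + integral {0..t} p"
    and \<psi>: "test_function {0<..<T} \<psi>"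
  shows "(\<integral>t. deriv \<psi> t * F t \<partial>time_measure T) = - (\<integral>t. \<psi> t * p t \<partial>time_measure T)"
proof -
  note d = test_function_derivs[OF \<psi>]
  have "continuous_on {0..T} (\<lambda>t. c + integral {0..t} p)"
    by (intro continuous_intros indefinite_integral_continuous p)
  then have cF: "continuous_on {0..T} F"
    by (rule continuous_on_eq) (use F in simp)
  have i1: "integrable (time_measure T) (\<lambda>t. deriv \<psi> t * F t)"
    by (intro integrable_time_measure_continuous continuous_intros cF continuous_on_subset[OF d(2)]) auto
  have i2: "integrable (time_measure T) (\<lambda>t. \<psi> t * p t)"
    by (rule integrable_test_function_mult[OF \<psi> p])
  have "\<psi> T * F T = \<psi> 0 * c + integral {0..T} (\<lambda>r. deriv \<psi> r * F r + \<psi> r * p r)"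
    by (rule integral_by_parts_primitive[OF p T order_refl d(1,2) F])
  then have "integral {0..T} (\<lambda>r. deriv \<psi> r * F r + \<psi> r * p r) = 0"
    using d by simp
  then have "(\<integral>t. deriv \<psi> t * F t + \<psi> t * p t \<partial>time_measure T) = 0"
    using integral_time_measure[OF Bochner_Integration.integrable_add[OF i1 i2]] by simp
  then show ?thesis using i1 i2 by simp
qed

text \<open>
  The primitive of \<open>v\<close> has the same weak derivative as \<open>u\<close>; the difference is constant by the lemma of
  du Bois-Reymond.
\<close>

lemma weak_derivative_imp_primitive:
  fixes u v :: "real \<Rightarrow> real"
  assumes T: "0 < T" and u: "integrable (time_measure T) u" and v: "integrable (time_measure T) v"
    and weak: "\<And>\<psi>. test_function {0<..<T} \<psi> \<Longrightarrow>
      (\<integral>t. deriv \<psi> t * u t \<partial>time_measure T) = - (\<integral>t. \<psi> t * v t \<partial>time_measure T)"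
  obtains c where "AE t in time_measure T. u t = c + integral {0..t} v"
proof -
  have i: "integrable (time_measure T) (\<lambda>t. integral {0..t} v)"
    by (intro integrable_time_measure_continuous indefinite_integral_continuous v)
  then have "integrable (time_measure T) (\<lambda>t. u t - integral {0..t} v)"
    using u by simp
  moreover have "(\<integral>t. deriv \<psi> t * (u t - integral {0..t} v) \<partial>time_measure T) = 0"
    if \<psi>: "test_function {0<..<T} \<psi>" for \<psi>
    using weak[OF \<psi>] integrable_test_function_mult(2)[OF \<psi> u] integrable_test_function_mult(2)[OF \<psi> i]
      weak_derivative_of_primitive[OF v less_imp_le[OF T] _ \<psi>, of "\<lambda>t. integral {0..t} v" 0]
    by (simp add: right_diff_distrib)
  ultimately obtain c where "AE t in time_measure T. u t - integral {0..t} v = c"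
    using du_Bois_Reymond[OF _ T] by blast
  then have "AE t in time_measure T. u t = c + integral {0..t} v"
    by eventually_elim simp
  then show ?thesis by (rule that)
qed

lemma continuous_eq_at_0_if_AE_eq:
  fixes F G :: "real \<Rightarrow> real"
  assumes T: "0 < T" and c: "continuous_on {0..T} F" "continuous_on {0..T} G"
    and ae: "AE t in time_measure T. F t = G t"
  shows "F 0 = G 0"
proof (rule ccontr)
  assume ne: "F 0 \<noteq> G 0"
  have "continuous_on {0..T} (\<lambda>t. F t - G t)" by (intro continuous_intros c)
  then have "((\<lambda>t. F t - G t) \<longlongrightarrow> F 0 - G 0) (at 0 within {0..T})"
    using T by (simp add: continuous_on_def)
  then have "eventually (\<lambda>t. F t - G t \<noteq> 0) (at 0 within {0..T})"
    by (rule tendsto_imp_eventually_ne) (use ne in simp)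
  then obtain \<delta> where \<delta>: "\<delta> > 0" "\<And>t. t \<in> {0..T} \<Longrightarrow> t \<noteq> 0 \<Longrightarrow> \<bar>t\<bar> < \<delta> \<Longrightarrow> F t \<noteq> G t"
    by (auto simp: eventually_at dist_real_def)
  have "AE t in lebesgue. t \<notin> {0<..<min \<delta> T}"
    using ae unfolding AE_time_measure_iff by eventually_elim (use \<delta>(2) in fastforce)
  then show False
    using interval_not_AE_avoided[of 0 "min \<delta> T"] T \<delta>(1) by simp
qed

text \<open>
  By the previous lemmas \<open>d\<close> and \<open>e\<close> agree almost everywhere with primitives \<open>c + D\<close> and \<open>c' + E\<close>, where
  the continuous representatives force \<open>c = c' = 0\<close>. Then \<open>D\<close> and \<open>E\<close> are differentiable in the classical
  sense, with \<open>D' = E\<close> and \<open>E' = -\<kappa> D\<close>, and the energy \<open>\<kappa> D\<^sup>2 + E\<^sup>2\<close> is constant.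
\<close>

lemma weak_oscillator_unique:
  fixes d e :: "real \<Rightarrow> real"
  assumes T: "0 < T" and \<kappa>: "0 < \<kappa>"
    and d: "integrable (time_measure T) d" and e: "integrable (time_measure T) e"
    and d': "\<And>\<psi>. test_function {0<..<T} \<psi> \<Longrightarrow>
      (\<integral>t. deriv \<psi> t * d t \<partial>time_measure T) = - (\<integral>t. \<psi> t * e t \<partial>time_measure T)"
    and e': "\<And>\<psi>. test_function {0<..<T} \<psi> \<Longrightarrow>
      (\<integral>t. deriv \<psi> t * e t \<partial>time_measure T) = - (\<integral>t. \<psi> t * (- \<kappa> * d t) \<partial>time_measure T)"
    and D0: "continuous_on {0..T} D0" "AE t in time_measure T. d t = D0 t" "D0 0 = 0"
    and E0: "continuous_on {0..T} E0" "AE t in time_measure T. e t = E0 t" "E0 0 = 0"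
  shows "AE t in time_measure T. d t = 0" "AE t in time_measure T. e t = 0"
proof -
  let ?M = "time_measure T"
  have kd: "integrable ?M (\<lambda>t. - \<kappa> * d t)" using d by simp
  obtain c where c: "AE t in ?M. d t = c + integral {0..t} e"
    by (rule weak_derivative_imp_primitive[OF T d e d'])
  obtain c' where c': "AE t in ?M. e t = c' + integral {0..t} (\<lambda>t. - \<kappa> * d t)"
    by (rule weak_derivative_imp_primitive[OF T e kd e'])
  define D where "D t = integral {0..t} e" for t
  define E where "E t = integral {0..t} (\<lambda>t. - \<kappa> * d t)" for t
  have contD: "continuous_on {0..T} D" and contE: "continuous_on {0..T} E"
    unfolding D_def E_def by (intro indefinite_integral_continuous e kd)+
  have "c + D 0 = D0 0"
  proof (rule continuous_eq_at_0_if_AE_eq[OF T _ D0(1)])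
    show "continuous_on {0..T} (\<lambda>t. c + D t)" by (intro continuous_intros contD)
    from c D0(2) show "AE t in ?M. c + D t = D0 t"
      unfolding D_def by eventually_elim simp
  qed
  then have dD: "AE t in ?M. d t = D t" using c D0(3) by (simp add: D_def)
  have "c' + E 0 = E0 0"
  proof (rule continuous_eq_at_0_if_AE_eq[OF T _ E0(1)])
    show "continuous_on {0..T} (\<lambda>t. c' + E t)" by (intro continuous_intros contE)
    from c' E0(2) show "AE t in ?M. c' + E t = E0 t"
      unfolding E_def by eventually_elim simp
  qed
  then have "c' = 0" using E0(3) by (simp add: E_def)
  then have eE: "AE t in ?M. e t = E t" using c' unfolding E_def by simp
  have "D t = integral {0..t} E" if "t \<le> T" for t
    unfolding D_def by (rule integral_cong_time_measure_AE[OF eE that])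
  then have D': "(D has_real_derivative E t) (at t within {0..T})" if "t \<in> {0..T}" for t
    using integral_has_real_derivative[OF contE that] that
    by (auto intro: has_field_derivative_transform_within[where d = 1])
  have "E t = integral {0..t} (\<lambda>t. - \<kappa> * D t)" if "t \<le> T" for t
    unfolding E_def using dD by (intro integral_cong_time_measure_AE[OF _ that]) auto
  moreover have "continuous_on {0..T} (\<lambda>t. - \<kappa> * D t)" by (intro continuous_intros contD)
  ultimately have E': "(E has_real_derivative - \<kappa> * D t) (at t within {0..T})" if "t \<in> {0..T}" for t
    using integral_has_real_derivative[of 0 T "\<lambda>t. - \<kappa> * D t" t] that
    by (auto intro: has_field_derivative_transform_within[where d = 1])
  define H where "H t = \<kappa> * (D t)\<^sup>2 + (E t)\<^sup>2" for t
  have "(H has_real_derivative 0) (at t within {0..T})" if "t \<in> {0..T}" for t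
    unfolding H_def by (rule derivative_eq_intros D'[OF that] E'[OF that] refl | simp)+
  then have "\<exists>k. \<forall>t\<in>{0..T}. H t = k"
    by (intro has_field_derivative_zero_constant) auto
  then have "H t = H 0" if "t \<in> {0..T}" for t using that T by auto
  moreover have "H 0 = 0" by (simp add: H_def D_def E_def)
  ultimately have H: "\<kappa> * (D t)\<^sup>2 + (E t)\<^sup>2 = 0" if "t \<in> {0..T}" for t using that by (simp add: H_def)
  have "D t = 0 \<and> E t = 0" if "t \<in> {0..T}" for t
    using H[OF that] \<kappa> by (simp add: add_nonneg_eq_0_iff)
  then have z: "AE t in ?M. D t = 0 \<and> E t = 0" by (intro AE_I2) auto
  from dD z show "AE t in ?M. d t = 0" by eventually_elim simp
  from eE z show "AE t in ?M. e t = 0" by eventually_elim simp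
qed

section \<open>The forced harmonic oscillator\<close>

text \<open>
  The form in which both components of the oscillator are verified: each is a combination of two
  primitives with smooth coefficients.
\<close>

lemma integral_by_parts_primitive_sum:
  fixes p1 p2 :: "real \<Rightarrow> real"
  assumes p: "integrable (time_measure T) p1" "integrable (time_measure T) p2"
    and q1: "\<And>t. (q1 has_real_derivative q1' t) (at t)" "continuous_on UNIV q1'"
    and q2: "\<And>t. (q2 has_real_derivative q2' t) (at t)" "continuous_on UNIV q2'"
    and F: "\<And>t. t \<in> {0..T} \<Longrightarrow> F1 t = c1 + integral {0..t} p1"
      "\<And>t. t \<in> {0..T} \<Longrightarrow> F2 t = c2 + integral {0..t} p2"
    and t: "t \<in> {0..T}"
  shows "q1 t * F1 t + q2 t * F2 t = q1 0 * c1 + q2 0 * c2 +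
    integral {0..t} (\<lambda>r. (q1' r * F1 r + q2' r * F2 r) + (q1 r * p1 r + q2 r * p2 r))"
proof -
  have int: "(\<lambda>r. q' r * F r + q r * p r) integrable_on {0..t}"
    if p: "integrable (time_measure T) p" and q: "\<And>t. (q has_real_derivative q' t) (at t)" "continuous_on UNIV q'"
      and F: "\<And>t. t \<in> {0..T} \<Longrightarrow> F t = c + integral {0..t} p" for p q q' F :: "real \<Rightarrow> real" and c
  proof -
    have "continuous_on {0..T} F"
      by (rule continuous_on_eq[where f = "\<lambda>t. c + integral {0..t} p"])
        (use F in \<open>auto intro!: continuous_intros indefinite_integral_continuous p\<close>)
    then have "integrable (time_measure T) (\<lambda>r. q' r * F r)"
      by (intro integrable_time_measure_continuous continuous_intros)
        (use q(2) in \<open>auto intro: continuous_on_subset\<close>)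
    moreover have "integrable (time_measure T) (\<lambda>r. q r * p r)"
      using q(1) by (intro integrable_time_measure_mult p continuous_at_imp_continuous_on) (auto intro: DERIV_isCont)
    ultimately have "integrable (time_measure T) (\<lambda>r. q' r * F r + q r * p r)"
      by simp
    then show ?thesis using integrable_on_initial_interval(1) t by auto
  qed
  have t': "0 \<le> t" "t \<le> T" using t by auto
  note i = int[OF p(1) q1 F(1)] int[OF p(2) q2 F(2)]
  show ?thesis
    using integral_by_parts_primitive[OF p(1) t' q1 F(1)] integral_by_parts_primitive[OF p(2) t' q2 F(2)]
      integral_add[OF i] by (simp add: algebra_simps)
qed

text \<open>
  Variation of constants. In \<open>U = cos(\<omega>t) a + sin(\<omega>t)/\<omega> b\<close> the amplitudes \<open>a, b\<close> are primitives of
  \<open>- sin(\<omega>t)/\<omega> f\<close> and \<open>cos(\<omega>t) f\<close>, chosen so that their derivatives cancel in \<open>U'\<close> and add up to \<open>f\<close> in \<open>V'\<close>.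
  The bounds hold because \<open>\<omega> a\<close> and \<open>b\<close> move by at most the \<open>L1\<close> norm of \<open>f\<close>, whatever \<open>\<omega>\<close> is.
\<close>

lemma oscillator_solution:
  fixes f :: "real \<Rightarrow> real"
  assumes f: "integrable (time_measure T) f" and T: "0 \<le> T" and \<omega>: "0 < \<omega>"
  obtains U V where
    "continuous_on {0..T} U" "continuous_on {0..T} V"
    "\<And>t. t \<in> {0..T} \<Longrightarrow> U t = g + integral {0..t} V"
    "\<And>t. t \<in> {0..T} \<Longrightarrow> V t = h + integral {0..t} (\<lambda>r. f r - \<omega>\<^sup>2 * U r)"
    "\<And>t. t \<in> {0..T} \<Longrightarrow> \<bar>\<omega> * U t\<bar> \<le> \<omega> * \<bar>g\<bar> + \<bar>h\<bar> + 2 * integral {0..T} (\<lambda>r. \<bar>f r\<bar>)"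
    "\<And>t. t \<in> {0..T} \<Longrightarrow> \<bar>V t\<bar> \<le> \<omega> * \<bar>g\<bar> + \<bar>h\<bar> + 2 * integral {0..T} (\<lambda>r. \<bar>f r\<bar>)"
proof -
  define p where "p r = - (sin (\<omega> * r) / \<omega>) * f r" for r
  define q where "q r = cos (\<omega> * r) * f r" for r
  define a where "a t = g + integral {0..t} p" for t
  define b where "b t = h + integral {0..t} q" for t
  define U where "U t = cos (\<omega> * t) * a t + sin (\<omega> * t) / \<omega> * b t" for t
  define V where "V t = - \<omega> * sin (\<omega> * t) * a t + cos (\<omega> * t) * b t" for t
  have ip: "integrable (time_measure T) p" "integrable (time_measure T) q"
    unfolding p_def q_def using \<omega> by (intro integrable_time_measure_mult f continuous_intros; simp)+
  have ca: "continuous_on {0..T} a" "continuous_on {0..T} b"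
    unfolding a_def b_def by (intro continuous_intros indefinite_integral_continuous ip)+
  have F: "integral {0..t} p' \<le> K * integral {0..T} (\<lambda>r. \<bar>f r\<bar>)" if "integrable (time_measure T) p'" 
    "\<And>r. p' r \<le> K * \<bar>f r\<bar>" "0 \<le> K" "t \<in> {0..T}" for p' K t
  proof -
    have fa: "integrable (time_measure T) (\<lambda>r. K * \<bar>f r\<bar>)" using f by simp
    have "integral {0..t} p' \<le> integral {0..t} (\<lambda>r. K * \<bar>f r\<bar>)"
      by (intro integral_le integrable_on_initial_interval(1)[OF that(1)]
          integrable_on_initial_interval(1)[OF fa]) (use that in auto)
    also have "\<dots> \<le> integral {0..T} (\<lambda>r. K * \<bar>f r\<bar>)"
      by (intro integral_subset_le integrable_on_initial_interval(1)[OF fa])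
        (use that in auto)
    finally show ?thesis by simp
  qed
  define G where "G = integral {0..T} (\<lambda>r. \<bar>f r\<bar>)"
  have ipabs: "\<bar>integral {0..t} p'\<bar> \<le> K * G"
    if "integrable (time_measure T) p'" "\<And>r. \<bar>p' r\<bar> \<le> K * \<bar>f r\<bar>" "0 \<le> K" "t \<in> {0..T}" for p' K t
    using F[of p' K t] F[of "\<lambda>r. - p' r" K t] that
    by (auto simp: abs_le_iff G_def)
  have b1: "\<bar>b t\<bar> \<le> \<bar>h\<bar> + G" if t: "t \<in> {0..T}" for t
  proof -
    have "\<bar>integral {0..t} q\<bar> \<le> 1 * G"
      by (rule ipabs[OF ip(2) _ _ t]) (auto simp: q_def abs_mult intro!: mult_left_le_one_le)
    then show ?thesis by (simp add: b_def)
  qed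
  have a1: "\<omega> * \<bar>a t\<bar> \<le> \<omega> * \<bar>g\<bar> + G" if t: "t \<in> {0..T}" for t
  proof -
    have "\<bar>integral {0..t} p\<bar> \<le> (1 / \<omega>) * G"
    proof (rule ipabs[OF ip(1) _ _ t])
      fix r
      have "\<bar>sin (\<omega> * r)\<bar> * \<bar>f r\<bar> \<le> \<bar>f r\<bar>" by (intro mult_left_le_one_le) auto
      then show "\<bar>p r\<bar> \<le> 1 / \<omega> * \<bar>f r\<bar>"
        using \<omega> by (simp add: p_def abs_mult divide_simps)
    qed (use \<omega> in simp)
    then have "\<omega> * \<bar>integral {0..t} p\<bar> \<le> G" using \<omega> by (simp add: field_simps)
    moreover have "\<omega> * \<bar>a t\<bar> \<le> \<omega> * (\<bar>g\<bar> + \<bar>integral {0..t} p\<bar>)"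
      unfolding a_def using \<omega> by (intro mult_left_mono) auto
    ultimately show ?thesis by (simp add: distrib_left)
  qed
  (* The rotation by the angle \<omega> t costs a factor of at most 1 in each summand. *)
  have rot: "\<bar>x * (\<omega> * a t)\<bar> + \<bar>y * b t\<bar> \<le> \<omega> * \<bar>g\<bar> + \<bar>h\<bar> + 2 * G"
    if "\<bar>x\<bar> \<le> 1" "\<bar>y\<bar> \<le> 1" "t \<in> {0..T}" for x y t
  proof -
    have "\<bar>x * (\<omega> * a t)\<bar> \<le> \<omega> * \<bar>a t\<bar>" "\<bar>y * b t\<bar> \<le> \<bar>b t\<bar>"
      using that \<omega> by (auto simp: abs_mult intro!: mult_left_le_one_le)
    then show ?thesis using a1[OF that(3)] b1[OF that(3)] by linarith
  qed
  show ?thesis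
  proof (rule that[of U V])
    show "continuous_on {0..T} U" "continuous_on {0..T} V"
      unfolding U_def V_def using \<omega> by (intro continuous_intros ca; simp)+
    fix t assume t: "t \<in> {0..T}"
    have "cos (\<omega> * t) * a t + sin (\<omega> * t) / \<omega> * b t = cos (\<omega> * 0) * g + sin (\<omega> * 0) / \<omega> * h +
      integral {0..t} (\<lambda>r. (- \<omega> * sin (\<omega> * r) * a r + cos (\<omega> * r) * b r) +
        (cos (\<omega> * r) * p r + sin (\<omega> * r) / \<omega> * q r))"
      by (rule integral_by_parts_primitive_sum[OF ip _ _ _ _ a_def b_def t])
        (use \<omega> in \<open>auto intro!: derivative_eq_intros continuous_intros\<close>)
    moreover have "cos (\<omega> * r) * p r + sin (\<omega> * r) / \<omega> * q r = 0" for r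
      by (simp add: p_def q_def)
    ultimately show "U t = g + integral {0..t} V"
      by (simp add: U_def V_def[abs_def])
    have "- \<omega> * sin (\<omega> * t) * a t + cos (\<omega> * t) * b t =
      - \<omega> * sin (\<omega> * 0) * g + cos (\<omega> * 0) * h +
      integral {0..t} (\<lambda>r. (- \<omega>\<^sup>2 * cos (\<omega> * r) * a r + - \<omega> * sin (\<omega> * r) * b r) +
        (- \<omega> * sin (\<omega> * r) * p r + cos (\<omega> * r) * q r))"
      by (rule integral_by_parts_primitive_sum[OF ip _ _ _ _ a_def b_def t])
        (use \<omega> in \<open>auto intro!: derivative_eq_intros continuous_intros simp: power2_eq_square\<close>)
    moreover have "- \<omega> * sin (\<omega> * r) * p r + cos (\<omega> * r) * q r = f r" for r
    proof -
      have "- \<omega> * sin (\<omega> * r) * p r + cos (\<omega> * r) * q r = ((sin (\<omega> * r))\<^sup>2 + (cos (\<omega> * r))\<^sup>2) * f r"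
        using \<omega> unfolding p_def q_def by (simp add: power2_eq_square algebra_simps del: sin_cos_squared_add sin_cos_squared_add2 sin_cos_squared_add3)
      then show ?thesis by simp
    qed
    moreover have "- \<omega>\<^sup>2 * cos (\<omega> * r) * a r + - \<omega> * sin (\<omega> * r) * b r = - (\<omega>\<^sup>2 * U r)" for r
      using \<omega> by (simp add: U_def power2_eq_square algebra_simps)
    ultimately show "V t = h + integral {0..t} (\<lambda>r. f r - \<omega>\<^sup>2 * U r)"
      by (simp add: V_def)
    have "\<omega> * U t = cos (\<omega> * t) * (\<omega> * a t) + sin (\<omega> * t) * b t"
      using \<omega> by (simp add: U_def algebra_simps)
    then show "\<bar>\<omega> * U t\<bar> \<le> \<omega> * \<bar>g\<bar> + \<bar>h\<bar> + 2 * integral {0..T} (\<lambda>r. \<bar>f r\<bar>)"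
      using rot[OF abs_cos_le_one abs_sin_le_one t, of "\<omega> * t" "\<omega> * t"] unfolding G_def by linarith
    have "V t = - (sin (\<omega> * t) * (\<omega> * a t)) + cos (\<omega> * t) * b t"
      by (simp add: V_def)
    then show "\<bar>V t\<bar> \<le> \<omega> * \<bar>g\<bar> + \<bar>h\<bar> + 2 * integral {0..T} (\<lambda>r. \<bar>f r\<bar>)"
      using rot[OF abs_sin_le_one abs_cos_le_one t, of "\<omega> * t" "\<omega> * t"] unfolding G_def by linarith
  qed
qed

section \<open>Square-integrable functions\<close>

lemma L2_elems_iff:
  "w \<in> elems (L2_space S) \<longleftrightarrow> w \<in> borel_measurable (lebesgue_on S) \<and> integrable (lebesgue_on S) (\<lambda>x. (w x)\<^sup>2)"
  by (simp add: L2_space_def)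

lemma L2_integrable_mult:
  assumes "v \<in> elems (L2_space S)" "w \<in> elems (L2_space S)"
  shows "integrable (lebesgue_on S) (\<lambda>x. v x * w x)"
proof (rule Bochner_Integration.integrable_bound)
  show "integrable (lebesgue_on S) (\<lambda>x. (v x)\<^sup>2 + (w x)\<^sup>2)"
    using assms by (auto simp: L2_elems_iff)
  show "(\<lambda>x. v x * w x) \<in> borel_measurable (lebesgue_on S)"
    using assms by (auto simp: L2_elems_iff)
  show "AE x in lebesgue_on S. norm (v x * w x) \<le> norm ((v x)\<^sup>2 + (w x)\<^sup>2)"
  proof (rule AE_I2)
    fix x
    have "2 * (\<bar>v x\<bar> * \<bar>w x\<bar>) \<le> (v x)\<^sup>2 + (w x)\<^sup>2"
      using sum_squares_bound[of "\<bar>v x\<bar>" "\<bar>w x\<bar>"] by simp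
    moreover have "0 \<le> \<bar>v x\<bar> * \<bar>w x\<bar>" by simp
    ultimately show "norm (v x * w x) \<le> norm ((v x)\<^sup>2 + (w x)\<^sup>2)"
      unfolding real_norm_def abs_mult by linarith
  qed
qed

lemma L2_lincomb:
  assumes "v \<in> elems (L2_space S)" "w \<in> elems (L2_space S)"
  shows "(\<lambda>x. a * v x + b * w x) \<in> elems (L2_space S)"
proof -
  have "(\<lambda>x. (a * v x + b * w x)\<^sup>2) = (\<lambda>x. a\<^sup>2 * (v x)\<^sup>2 + 2 * a * b * (v x * w x) + b\<^sup>2 * (w x)\<^sup>2)"
    by (auto simp: power2_eq_square algebra_simps)
  then show ?thesis
    using assms L2_integrable_mult[OF assms] by (auto simp: L2_elems_iff)
qed

lemma L2_diff: "v \<in> elems (L2_space S) \<Longrightarrow> w \<in> elems (L2_space S) \<Longrightarrow> (\<lambda>x. v x - w x) \<in> elems (L2_space S)"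
  using L2_lincomb[of v S w 1 "-1"] by simp

lemma L2_inner_commute: "L2_inner S v w = L2_inner S w v"
  by (simp add: L2_inner_def mult.commute)

lemma L2_inner_lincomb_left:
  assumes "v \<in> elems (L2_space S)" "w \<in> elems (L2_space S)" "u \<in> elems (L2_space S)"
  shows "L2_inner S (\<lambda>x. a * v x + b * w x) u = a * L2_inner S v u + b * L2_inner S w u"
proof -
  have "L2_inner S (\<lambda>x. a * v x + b * w x) u = (\<integral>x. a * (v x * u x) + b * (w x * u x) \<partial>lebesgue_on S)"
    unfolding L2_inner_def by (simp add: algebra_simps)
  then show ?thesis
    using L2_integrable_mult[OF assms(1,3)] L2_integrable_mult[OF assms(2,3)] by (simp add: L2_inner_def)
qed

lemma L2_inner_lincomb_right:
  assumes "v \<in> elems (L2_space S)" "w \<in> elems (L2_space S)" "u \<in> elems (L2_space S)"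
  shows "L2_inner S u (\<lambda>x. a * v x + b * w x) = a * L2_inner S u v + b * L2_inner S u w"
  using L2_inner_lincomb_left[OF assms] by (simp add: L2_inner_commute)

lemma L2_inner_self_nonneg: "0 \<le> L2_inner S w w"
  by (simp add: L2_inner_def)

lemma L2_nrm_eq: "nrm (L2_space S) w = sqrt (L2_inner S w w)"
  by (simp add: L2_space_def L2_inner_def power2_eq_square)

lemma L2_nrm_nonneg: "0 \<le> nrm (L2_space S) w"
  by (simp add: L2_nrm_eq L2_inner_self_nonneg)

lemma L2_nrm_square: "(nrm (L2_space S) w)\<^sup>2 = L2_inner S w w"
  by (simp add: L2_nrm_eq L2_inner_self_nonneg)

lemma L2_inner_lincomb_self:
  assumes "v \<in> elems (L2_space S)" "w \<in> elems (L2_space S)"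
  shows "L2_inner S (\<lambda>x. a * v x + b * w x) (\<lambda>x. a * v x + b * w x) =
    a\<^sup>2 * L2_inner S v v + 2 * a * b * L2_inner S v w + b\<^sup>2 * L2_inner S w w"
  using L2_inner_lincomb_left[OF assms L2_lincomb[OF assms], of a b a b]
    L2_inner_lincomb_right[OF assms assms(1), of a b] L2_inner_lincomb_right[OF assms assms(2), of a b]
    L2_inner_commute[of S w v]
  by (simp add: power2_eq_square algebra_simps)

lemma L2_nrm_eq_0_iff:
  assumes "w \<in> elems (L2_space S)"
  shows "nrm (L2_space S) w = 0 \<longleftrightarrow> (AE x in lebesgue_on S. w x = 0)"
  using assms integral_nonneg_eq_0_iff_AE[of "lebesgue_on S" "\<lambda>x. (w x)\<^sup>2"]
  by (simp add: L2_space_def)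

text \<open>
  The nonnegative square norm of \<open>\<langle>w,w\<rangle> v - \<langle>v,w\<rangle> w\<close> equals
  \<open>\<langle>w,w\<rangle> (\<langle>v,v\<rangle> \<langle>w,w\<rangle> - \<langle>v,w\<rangle>\<^sup>2)\<close>.
\<close>

lemma L2_Cauchy_Schwarz:
  assumes "v \<in> elems (L2_space S)" "w \<in> elems (L2_space S)"
  shows "\<bar>L2_inner S v w\<bar> \<le> nrm (L2_space S) v * nrm (L2_space S) w"
proof (cases "nrm (L2_space S) w = 0")
  case True
  then have "AE x in lebesgue_on S. v x * w x = 0"
    using L2_nrm_eq_0_iff[OF assms(2)] by auto
  then have "L2_inner S v w = 0" unfolding L2_inner_def by (rule integral_eq_zero_AE)
  with True show ?thesis by simp
next
  case False
  let ?I = "L2_inner S v w" and ?V = "L2_inner S v v" and ?W = "L2_inner S w w"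
  have W: "0 < ?W"
    using False L2_inner_self_nonneg[of S w] by (auto simp: L2_nrm_eq less_le)
  have "0 \<le> ?W\<^sup>2 * ?V + 2 * ?W * (- ?I) * ?I + (- ?I)\<^sup>2 * ?W"
    unfolding L2_inner_lincomb_self[OF assms, symmetric] by (rule L2_inner_self_nonneg)
  also have "\<dots> = ?W * (?V * ?W - ?I\<^sup>2)" by (simp add: power2_eq_square algebra_simps)
  finally have "?I\<^sup>2 \<le> ?V * ?W" using W by (simp add: zero_le_mult_iff)
  then have "sqrt (?I\<^sup>2) \<le> sqrt (?V * ?W)" by (rule real_sqrt_le_mono)
  then show ?thesis by (simp add: L2_nrm_eq real_sqrt_mult)
qed

lemma L2_triangle:
  assumes "v \<in> elems (L2_space S)" "w \<in> elems (L2_space S)"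
  shows "nrm (L2_space S) (\<lambda>x. v x + w x) \<le> nrm (L2_space S) v + nrm (L2_space S) w"
proof (rule power2_le_imp_le)
  have "(nrm (L2_space S) (\<lambda>x. v x + w x))\<^sup>2 = (nrm (L2_space S) v)\<^sup>2 + 2 * L2_inner S v w + (nrm (L2_space S) w)\<^sup>2"
    using L2_inner_lincomb_self[OF assms, of 1 1] by (simp add: L2_nrm_square)
  also have "\<dots> \<le> (nrm (L2_space S) v + nrm (L2_space S) w)\<^sup>2"
    using L2_Cauchy_Schwarz[OF assms] by (simp add: power2_sum)
  finally show "(nrm (L2_space S) (\<lambda>x. v x + w x))\<^sup>2 \<le> (nrm (L2_space S) v + nrm (L2_space S) w)\<^sup>2" .
qed (simp add: L2_nrm_nonneg)

lemma L2_nrm_minus_commute: "nrm (L2_space S) (\<lambda>x. v x - w x) = nrm (L2_space S) (\<lambda>x. w x - v x)"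
  by (simp add: L2_space_def power2_commute)

lemma L2_nrm_diff_le:
  assumes "v \<in> elems (L2_space S)" "w \<in> elems (L2_space S)"
  shows "\<bar>nrm (L2_space S) v - nrm (L2_space S) w\<bar> \<le> nrm (L2_space S) (\<lambda>x. v x - w x)"
  using L2_triangle[OF L2_diff[OF assms] assms(2)] L2_triangle[OF L2_diff[OF assms(2,1)] assms(1)]
    L2_nrm_minus_commute[of S v w] by simp

lemma L2_nrm_tendsto:
  assumes "\<And>n. v n \<in> elems (L2_space S)" "w \<in> elems (L2_space S)"
    and "(\<lambda>n. nrm (L2_space S) (\<lambda>x. v n x - w x)) \<longlonglongrightarrow> 0"
  shows "(\<lambda>n. nrm (L2_space S) (v n)) \<longlonglongrightarrow> nrm (L2_space S) w"
proof (rule LIM_zero_cancel, rule Lim_null_comparison[OF _ assms(3)])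
  show "\<forall>\<^sub>F n in sequentially. norm (nrm (L2_space S) (v n) - nrm (L2_space S) w)
      \<le> nrm (L2_space S) (\<lambda>x. v n x - w x)"
    using L2_nrm_diff_le[OF assms(1,2)] by simp
qed

lemma L2_inner_tendsto:
  assumes "\<And>n. v n \<in> elems (L2_space S)" "w \<in> elems (L2_space S)" "u \<in> elems (L2_space S)"
    and "(\<lambda>n. nrm (L2_space S) (\<lambda>x. v n x - w x)) \<longlonglongrightarrow> 0"
  shows "(\<lambda>n. L2_inner S (v n) u) \<longlonglongrightarrow> L2_inner S w u"
proof (rule LIM_zero_cancel, rule Lim_null_comparison)
  show "(\<lambda>n. nrm (L2_space S) (\<lambda>x. v n x - w x) * nrm (L2_space S) u) \<longlonglongrightarrow> 0"
    using tendsto_mult_left_zero[OF assms(4)] .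
  show "\<forall>\<^sub>F n in sequentially. norm (L2_inner S (v n) u - L2_inner S w u)
      \<le> nrm (L2_space S) (\<lambda>x. v n x - w x) * nrm (L2_space S) u"
  proof (rule always_eventually, rule allI)
    fix n
    have "L2_inner S (v n) u - L2_inner S w u = L2_inner S (\<lambda>x. v n x - w x) u"
      using L2_inner_lincomb_left[OF assms(1,2,3), of 1 n "-1"] by simp
    then show "norm (L2_inner S (v n) u - L2_inner S w u) \<le> nrm (L2_space S) (\<lambda>x. v n x - w x) * nrm (L2_space S) u"
      using L2_Cauchy_Schwarz[OF L2_diff[OF assms(1,2)] assms(3)] by simp
  qed
qed

lemma L2_nn_integral:
  assumes "w \<in> elems (L2_space S)"
  shows "(\<integral>\<^sup>+x. ennreal ((w x)\<^sup>2) \<partial>lebesgue_on S) = ennreal ((nrm (L2_space S) w)\<^sup>2)"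
proof -
  have "(nrm (L2_space S) w)\<^sup>2 = (\<integral>x. (w x)\<^sup>2 \<partial>lebesgue_on S)"
    unfolding L2_nrm_square by (simp add: L2_inner_def power2_eq_square)
  then show ?thesis
    using assms by (subst nn_integral_eq_integral) (auto simp: L2_elems_iff)
qed

lemma L2_elemsI_nn_integral:
  assumes "w \<in> borel_measurable (lebesgue_on S)" "(\<integral>\<^sup>+x. ennreal ((w x)\<^sup>2) \<partial>lebesgue_on S) \<le> ennreal (B\<^sup>2)" "0 \<le> B"
  shows "w \<in> elems (L2_space S)" "nrm (L2_space S) w \<le> B"
proof -
  have "integrable (lebesgue_on S) (\<lambda>x. (w x)\<^sup>2)"
    using assms by (intro integrableI_bounded) (auto intro: le_less_trans)
  then show w: "w \<in> elems (L2_space S)" using assms by (simp add: L2_elems_iff)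
  show "nrm (L2_space S) w \<le> B"
    using assms L2_nn_integral[OF w] by (auto intro: power2_le_imp_le)
qed

text \<open>
  On a set of finite measure the increments are summable in \<open>L1\<close>, so the sequence converges almost
  everywhere. The lemma of Fatou turns the geometric bound on the distance of two members into the same
  bound on the distance to the pointwise limit.
\<close>

lemma L2_complete_geometric:
  assumes S: "S \<in> lmeasurable" and s: "\<And>n::nat. s n \<in> elems (L2_space S)"
    and d: "\<And>n. nrm (L2_space S) (\<lambda>x. s (Suc n) x - s n x) \<le> (1 / 2) ^ n"
  obtains w where "w \<in> elems (L2_space S)" "(\<lambda>n. nrm (L2_space S) (\<lambda>x. s n x - w x)) \<longlonglongrightarrow> 0"
proof -
  let ?M = "lebesgue_on S"
  interpret finite_measure ?M using S by (rule finite_measure_lebesgue_on)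
  have [measurable]: "s n \<in> borel_measurable ?M" for n using s by (simp add: L2_elems_iff)
  have one: "(\<lambda>_. 1) \<in> elems (L2_space S)" by (simp add: L2_elems_iff)
  define m where "m = nrm (L2_space S) (\<lambda>_. 1)"
  define D where "D n x = s (Suc n) x - s n x" for n x
  have D: "D n \<in> elems (L2_space S)" for n unfolding D_def by (intro L2_diff s)
  have [measurable]: "D n \<in> borel_measurable ?M" for n using D by (simp add: L2_elems_iff)
  have absD: "(\<lambda>x. \<bar>D n x\<bar>) \<in> elems (L2_space S)" "nrm (L2_space S) (\<lambda>x. \<bar>D n x\<bar>) = nrm (L2_space S) (D n)" for n
    using D[of n] by (auto simp: L2_space_def)
  have "(\<integral>\<^sup>+x. ennreal \<bar>D n x\<bar> \<partial>?M) \<le> ennreal (m * (1 / 2) ^ n)" for n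
  proof -
    have "integrable ?M (\<lambda>x. \<bar>D n x\<bar>)" using L2_integrable_mult[OF absD(1) one] by simp
    then have "(\<integral>\<^sup>+x. ennreal \<bar>D n x\<bar> \<partial>?M) = ennreal (\<integral>x. \<bar>D n x\<bar> \<partial>?M)"
      by (intro nn_integral_eq_integral) auto
    also have "(\<integral>x. \<bar>D n x\<bar> \<partial>?M) = L2_inner S (\<lambda>x. \<bar>D n x\<bar>) (\<lambda>_. 1)" by (simp add: L2_inner_def)
    also have "L2_inner S (\<lambda>x. \<bar>D n x\<bar>) (\<lambda>_. 1) \<le> (1 / 2) ^ n * m"
      using L2_Cauchy_Schwarz[OF absD(1) one, of n] absD(2)[of n] d[of n] L2_nrm_nonneg[of S "\<lambda>_. 1"]
        mult_right_mono[OF d[of n], of m]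
      by (simp add: m_def D_def[abs_def])
    finally show ?thesis by (simp add: mult.commute ennreal_leI)
  qed
  then have "(\<Sum>n. \<integral>\<^sup>+x. ennreal \<bar>D n x\<bar> \<partial>?M) \<le> (\<Sum>n. ennreal (m * (1 / 2) ^ n))"
    by (intro suminf_le) auto
  also have "\<dots> = ennreal (\<Sum>n. m * (1 / 2) ^ n)"
    by (intro suminf_ennreal2) (auto simp: m_def L2_nrm_nonneg intro!: summable_mult)
  also have "\<dots> < \<infinity>" by simp
  finally have "(\<integral>\<^sup>+x. (\<Sum>n. ennreal \<bar>D n x\<bar>) \<partial>?M) < \<infinity>"
    by (subst nn_integral_suminf) auto
  then have "AE x in ?M. (\<Sum>n. ennreal \<bar>D n x\<bar>) \<noteq> \<infinity>"
    by (intro nn_integral_PInf_AE) auto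
  then have conv: "AE x in ?M. convergent (\<lambda>n. s n x)"
  proof eventually_elim
    case (elim x)
    then have "summable (\<lambda>n. \<bar>D n x\<bar>)" by (intro summable_suminf_not_top) auto
    then have "summable (\<lambda>n. D n x)" by (rule summable_rabs_cancel)
    then have "convergent (\<lambda>n. \<Sum>i<n. D i x)" by (simp add: summable_iff_convergent)
    moreover have "(\<Sum>i<n. D i x) = s n x - s 0 x" for n
      unfolding D_def by (rule sum_lessThan_telescope)
    ultimately have "convergent (\<lambda>n. (s n x - s 0 x) + s 0 x)"
      by (intro convergent_add) (auto intro: convergent_const)
    then show ?case by simp
  qed
  define w where "w x = lim (\<lambda>n. s n x)" for x
  have [measurable]: "w \<in> borel_measurable ?M" unfolding w_def by measurable
  have lim: "AE x in ?M. (\<lambda>n. s n x) \<longlonglongrightarrow> w x"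
    using conv by eventually_elim (simp add: w_def convergent_LIMSEQ_iff)
  have far: "nrm (L2_space S) (\<lambda>x. s (n + k) x - s n x) \<le> 2 * (1 / 2) ^ n - 2 * (1 / 2) ^ (n + k)" for n k
  proof (induction k)
    case 0
    show ?case by (simp add: L2_space_def)
  next
    case (Suc k)
    have "nrm (L2_space S) (\<lambda>x. (s (Suc (n + k)) x - s (n + k) x) + (s (n + k) x - s n x))
        \<le> (1 / 2) ^ (n + k) + (2 * (1 / 2) ^ n - 2 * (1 / 2) ^ (n + k))"
      using L2_triangle[OF L2_diff[OF s s] L2_diff[OF s s], of "Suc (n + k)" "n + k" "n + k" n] d[of "n + k"] Suc
      by linarith
    then show ?case by simp
  qed
  have wn: "(\<lambda>x. s n x - w x) \<in> elems (L2_space S)" "nrm (L2_space S) (\<lambda>x. s n x - w x) \<le> 2 * (1 / 2) ^ n" for n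
  proof -
    have "(\<integral>\<^sup>+x. ennreal ((s n x - w x)\<^sup>2) \<partial>?M)
        = (\<integral>\<^sup>+x. liminf (\<lambda>k. ennreal ((s n x - s (n + k) x)\<^sup>2)) \<partial>?M)"
    proof (rule nn_integral_cong_AE)
      show "AE x in ?M. ennreal ((s n x - w x)\<^sup>2) = liminf (\<lambda>k. ennreal ((s n x - s (n + k) x)\<^sup>2))"
        using lim
      proof eventually_elim
        case (elim x)
        then have "(\<lambda>k. s (n + k) x) \<longlonglongrightarrow> w x"
          using LIMSEQ_ignore_initial_segment[of "\<lambda>k. s k x" "w x" n] by (simp add: add.commute)
        then have "(\<lambda>k. ennreal ((s n x - s (n + k) x)\<^sup>2)) \<longlonglongrightarrow> ennreal ((s n x - w x)\<^sup>2)"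
          by (intro tendsto_intros)
        from lim_imp_Liminf[OF _ this] show ?case by simp
      qed
    qed
    also have "\<dots> \<le> liminf (\<lambda>k. \<integral>\<^sup>+x. ennreal ((s n x - s (n + k) x)\<^sup>2) \<partial>?M)"
      by (intro nn_integral_liminf) auto
    also have "\<dots> \<le> ennreal ((2 * (1 / 2) ^ n)\<^sup>2)"
    proof (rule Liminf_le)
      show "\<forall>\<^sub>F k in sequentially. (\<integral>\<^sup>+x. ennreal ((s n x - s (n + k) x)\<^sup>2) \<partial>?M) \<le> ennreal ((2 * (1 / 2) ^ n)\<^sup>2)"
      proof (rule always_eventually, rule allI)
        fix k
        have "nrm (L2_space S) (\<lambda>x. s n x - s (n + k) x) \<le> 2 * (1 / 2) ^ n"
          using far[of n k] zero_le_power[of "1/2::real" "n + k"] unfolding L2_nrm_minus_commute[of S "s n"] by linarith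
        then show "(\<integral>\<^sup>+x. ennreal ((s n x - s (n + k) x)\<^sup>2) \<partial>?M) \<le> ennreal ((2 * (1 / 2) ^ n)\<^sup>2)"
          unfolding L2_nn_integral[OF L2_diff[OF s s]] by (intro ennreal_leI power_mono L2_nrm_nonneg)
      qed
    qed simp
    finally have le: "(\<integral>\<^sup>+x. ennreal ((s n x - w x)\<^sup>2) \<partial>?M) \<le> ennreal ((2 * (1 / 2) ^ n)\<^sup>2)" .
    show "(\<lambda>x. s n x - w x) \<in> elems (L2_space S)" "nrm (L2_space S) (\<lambda>x. s n x - w x) \<le> 2 * (1 / 2) ^ n"
      by (rule L2_elemsI_nn_integral[OF _ le]; simp)+
  qed
  show ?thesis
  proof (rule that[of w])
    show "w \<in> elems (L2_space S)" using L2_diff[OF s wn(1), of 0 0] by simp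
    show "(\<lambda>n. nrm (L2_space S) (\<lambda>x. s n x - w x)) \<longlonglongrightarrow> 0"
    proof (rule Lim_null_comparison)
      show "\<forall>\<^sub>F n in sequentially. norm (nrm (L2_space S) (\<lambda>x. s n x - w x)) \<le> 2 * (1 / 2) ^ n"
        using wn(2) by (simp add: L2_nrm_nonneg)
      show "(\<lambda>n. 2 * (1 / 2 :: real) ^ n) \<longlonglongrightarrow> 0"
        by (intro tendsto_mult_right_zero LIMSEQ_power_zero) simp
    qed
  qed
qed

locale orthonormal_system =
  fixes S :: "'a::euclidean_space set" and \<phi> :: "nat \<Rightarrow> 'a \<Rightarrow> real"
  assumes elem: "\<phi> k \<in> elems (L2_space S)"
    and orthonormal: "L2_inner S (\<phi> j) (\<phi> k) = (if j = k then 1 else 0)"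
begin

lemma comb_L2: "finite I \<Longrightarrow> (\<lambda>x. \<Sum>k\<in>I. c k * \<phi> k x) \<in> elems (L2_space S)"
proof (induction I rule: finite_induct)
  case empty
  then show ?case by (simp add: L2_elems_iff)
next
  case (insert i I)
  then show ?case using L2_lincomb[OF elem insert(3), of "c i" i 1] by simp
qed

lemma L2_inner_comb:
  assumes "finite I" "u \<in> elems (L2_space S)"
  shows "L2_inner S (\<lambda>x. \<Sum>k\<in>I. c k * \<phi> k x) u = (\<Sum>k\<in>I. c k * L2_inner S (\<phi> k) u)"
  using assms(1)
proof (induction I rule: finite_induct)
  case empty
  then show ?case by (simp add: L2_inner_def)
next
  case (insert i I)
  then show ?case
    using L2_inner_lincomb_left[OF elem comb_L2[OF insert(1)] assms(2), of "c i" i 1 c] by simp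
qed

lemma L2_inner_comb_basis:
  "finite I \<Longrightarrow> L2_inner S (\<lambda>x. \<Sum>k\<in>I. c k * \<phi> k x) (\<phi> j) = (if j \<in> I then c j else 0)"
  by (simp add: L2_inner_comb elem orthonormal if_distrib cong: if_cong)

lemma L2_nrm_comb:
  assumes "finite I"
  shows "(nrm (L2_space S) (\<lambda>x. \<Sum>k\<in>I. c k * \<phi> k x))\<^sup>2 = (\<Sum>k\<in>I. (c k)\<^sup>2)"
proof -
  have "(nrm (L2_space S) (\<lambda>x. \<Sum>k\<in>I. c k * \<phi> k x))\<^sup>2 =
      (\<Sum>k\<in>I. c k * L2_inner S (\<phi> k) (\<lambda>x. \<Sum>k\<in>I. c k * \<phi> k x))"
    unfolding L2_nrm_square by (rule L2_inner_comb[OF assms comb_L2[OF assms]])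
  also have "\<dots> = (\<Sum>k\<in>I. (c k)\<^sup>2)"
    unfolding L2_inner_commute[of S "\<phi> _"] L2_inner_comb_basis[OF assms]
    by (intro sum.cong) (auto simp: power2_eq_square)
  finally show ?thesis .
qed

text \<open>
  The partial sums along indices \<open>N j\<close> beyond which the tail of \<open>\<Sum>c\<^sub>k\<^sup>2\<close> is at most \<open>4\<^sup>-\<^sup>j\<close> have increments
  of norm at most \<open>2\<^sup>-\<^sup>j\<close>.
\<close>

lemma Riesz_Fischer:
  assumes S: "S \<in> lmeasurable" and c: "summable (\<lambda>k. (c k)\<^sup>2)"
  obtains w where "w \<in> elems (L2_space S)" "\<And>k. L2_inner S w (\<phi> k) = c k"
proof -
  define t where "t n = (\<Sum>k. (c (k + n))\<^sup>2)" for n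
  have "(\<lambda>n. (\<Sum>k. (c k)\<^sup>2) - (\<Sum>k<n. (c k)\<^sup>2)) \<longlonglongrightarrow> (\<Sum>k. (c k)\<^sup>2) - (\<Sum>k. (c k)\<^sup>2)"
    by (intro tendsto_intros summable_LIMSEQ c)
  then have t_lim: "t \<longlonglongrightarrow> 0"
    by (simp add: t_def[abs_def] suminf_minus_initial_segment[OF c])
  have tail: "(\<Sum>k\<in>{m..<n}. (c k)\<^sup>2) \<le> t m" for m n
  proof (cases "m \<le> n")
    case True
    have "(\<Sum>k\<in>{m..<n}. (c k)\<^sup>2) = (\<Sum>k\<in>{0..<n - m}. (c (k + m))\<^sup>2)"
      using sum.shift_bounds_nat_ivl[of "\<lambda>k. (c k)\<^sup>2" 0 m "n - m"] True by simp
    also have "\<dots> \<le> t m"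
      unfolding t_def using c by (intro sum_le_suminf) (auto simp: summable_iff_shift[of "\<lambda>k. (c k)\<^sup>2"])
    finally show ?thesis .
  next
    case False
    then show ?thesis
      unfolding t_def using c by (auto intro!: suminf_nonneg simp: summable_iff_shift[of "\<lambda>k. (c k)\<^sup>2"])
  qed
  have "\<exists>n. \<forall>m\<ge>n. t m \<le> (1 / 4) ^ j" for j
  proof -
    have "eventually (\<lambda>n. t n < (1 / 4) ^ j) sequentially"
      by (rule order_tendstoD(2)[OF t_lim]) simp
    then show ?thesis unfolding eventually_sequentially by (meson less_imp_le)
  qed
  then obtain n where n: "\<And>j m. m \<ge> n j \<Longrightarrow> t m \<le> (1 / 4) ^ j" by metis
  (* The sum makes N increasing, the summand j makes it unbounded. *)
  define N where "N j = (\<Sum>i\<le>j. n i) + j" for j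
  have N: "N j \<ge> n j" "N j \<ge> j" "N j \<le> N (Suc j)" for j
    using member_le_sum[of j "{..j}" n] by (auto simp: N_def)
  define s where "s j = (\<lambda>x. \<Sum>k<N j. c k * \<phi> k x)" for j
  have s: "s j \<in> elems (L2_space S)" for j unfolding s_def by (rule comb_L2) simp
  have d: "nrm (L2_space S) (\<lambda>x. s (Suc j) x - s j x) \<le> (1 / 2) ^ j" for j
  proof (rule power2_le_imp_le)
    have "s (Suc j) x - s j x = (\<Sum>k\<in>{N j..<N (Suc j)}. c k * \<phi> k x)" for x
      using sum_diff[of "{..<N (Suc j)}" "{..<N j}" "\<lambda>k. c k * \<phi> k x"] N(3)[of j]
      by (simp add: s_def lessThan_minus_lessThan)
    then have "(nrm (L2_space S) (\<lambda>x. s (Suc j) x - s j x))\<^sup>2 \<le> t (N j)"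
      using tail by (simp add: L2_nrm_comb)
    also have "\<dots> \<le> (1 / 4) ^ j" using n N(1) by blast
    also have "\<dots> = ((1 / 2) ^ j)\<^sup>2"
    proof -
      have "((1 / 2 :: real) ^ j)\<^sup>2 = ((1 / 2)\<^sup>2) ^ j" by (metis power_mult mult.commute)
      then show ?thesis by (simp add: power2_eq_square)
    qed
    finally show "(nrm (L2_space S) (\<lambda>x. s (Suc j) x - s j x))\<^sup>2 \<le> ((1 / 2) ^ j)\<^sup>2" .
  qed simp
  obtain w where w: "w \<in> elems (L2_space S)" "(\<lambda>j. nrm (L2_space S) (\<lambda>x. s j x - w x)) \<longlonglongrightarrow> 0"
    by (rule L2_complete_geometric[where s = s, OF S s d])
  have "L2_inner S w (\<phi> k) = c k" for k
  proof (rule LIMSEQ_unique)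
    show "(\<lambda>j. L2_inner S (s j) (\<phi> k)) \<longlonglongrightarrow> L2_inner S w (\<phi> k)"
      by (rule L2_inner_tendsto[OF s w(1) elem w(2)])
    have "eventually (\<lambda>j. L2_inner S (s j) (\<phi> k) = c k) sequentially"
      using eventually_gt_at_top[of k]
    proof eventually_elim
      case (elim j)
      then have "k < N j" using N(2)[of j] by linarith
      then show ?case by (simp add: s_def L2_inner_comb_basis)
    qed
    then show "(\<lambda>j. L2_inner S (s j) (\<phi> k)) \<longlonglongrightarrow> c k" by (rule tendsto_eventually)
  qed
  with w(1) show ?thesis by (rule that)
qed

end

lemma orthonormal_basis_system:
  assumes "orthonormal_basis S \<phi>"
  shows "orthonormal_system S \<phi>"
  using assms by unfold_locales (auto simp: orthonormal_basis_def)

lemma Parseval: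
  assumes "orthonormal_basis S \<phi>" and w: "w \<in> elems (L2_space S)"
  shows "(\<lambda>k. (L2_inner S w (\<phi> k))\<^sup>2) sums (nrm (L2_space S) w)\<^sup>2"
proof -
  interpret orthonormal_system S \<phi> using assms(1) by (rule orthonormal_basis_system)
  let ?P = "\<lambda>n x. \<Sum>k<n. L2_inner S w (\<phi> k) * \<phi> k x"
  have "(\<lambda>n. nrm (L2_space S) (\<lambda>x. w x - ?P n x)) \<longlonglongrightarrow> 0"
    using assms unfolding orthonormal_basis_def by blast
  then have "(\<lambda>n. nrm (L2_space S) (\<lambda>x. ?P n x - w x)) \<longlonglongrightarrow> 0"
    using L2_nrm_minus_commute[of S w] by simp
  then have "(\<lambda>n. nrm (L2_space S) (?P n)) \<longlonglongrightarrow> nrm (L2_space S) w"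
    by (intro L2_nrm_tendsto comb_L2 w) simp_all
  then have "(\<lambda>n. (nrm (L2_space S) (?P n))\<^sup>2) \<longlonglongrightarrow> (nrm (L2_space S) w)\<^sup>2"
    by (rule tendsto_power)
  then show ?thesis by (simp add: sums_def L2_nrm_comb)
qed

section \<open>The Poincare inequality and the lowest eigenvalue\<close>

text \<open>
  By translation invariance the integral of every difference quotient of \<open>q\<close> vanishes. The quotients
  are bounded by the maximum of \<open>D\<close> on a fixed ball, by the mean value theorem, and converge to \<open>D\<close>.
\<close>

lemma integral_directional_derivative_eq_0:
  fixes q :: "'a::euclidean_space \<Rightarrow> real"
  assumes der: "\<And>x t. ((\<lambda>t. q (x + t *\<^sub>R e)) has_real_derivative D (x + t *\<^sub>R e)) (at t)"
    and cont: "continuous_on UNIV q" "continuous_on UNIV D"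
    and K: "compact K" "\<And>x. x \<notin> K \<Longrightarrow> q x = 0" "\<And>x. x \<notin> K \<Longrightarrow> D x = 0"
  shows "(\<integral>x. D x \<partial>lborel) = 0"
proof -
  have [measurable]: "q \<in> borel_measurable borel" "D \<in> borel_measurable borel"
    using cont by (auto intro: borel_measurable_continuous_onI)
  have "continuous_on K D" using cont(2) by (rule continuous_on_subset) simp
  from compact_imp_bounded[OF compact_continuous_image[OF this K(1)]]
  obtain B where "\<forall>y\<in>D ` K. norm y \<le> B" unfolding bounded_iff by blast
  then have B: "\<bar>D x\<bar> \<le> max B 0" for x using K(3)[of x] by (cases "x \<in> K") fastforce+
  obtain r where r: "\<And>x. x \<in> K \<Longrightarrow> norm x \<le> r"
    using compact_imp_bounded[OF K(1)] by (auto simp: bounded_iff)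
  define R where "R = r + norm e"
  have q_int: "integrable lborel q"
  proof -
    have "integrable lborel (\<lambda>x. indicator K x *\<^sub>R q x)"
      using borel_integrable_compact[OF K(1), of q] cont(1) continuous_on_subset
      by (auto simp: set_integrable_def indicator_scaleR_eq_if)
    moreover have "(\<lambda>x. indicator K x *\<^sub>R q x) = q" using K(2) by (force simp: indicator_def)
    ultimately show ?thesis by simp
  qed
  define h where "h n = inverse (real (Suc n))" for n
  have h: "0 < h n" "h n \<le> 1" for n by (auto simp: h_def inverse_le_1_iff)
  define Q where "Q n x = (q (x + h n *\<^sub>R e) - q x) / h n" for n x
  have shift: "integrable lborel (\<lambda>x. q (x + a))" "(\<integral>x. q (x + a) \<partial>lborel) = (\<integral>x. q x \<partial>lborel)" for a
  proof -
    have "integrable (distr lborel borel ((+) a)) q" using q_int by (simp add: lborel_distr_plus)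
    then show "integrable lborel (\<lambda>x. q (x + a))" by (simp add: integrable_distr_eq add.commute)
    have "(\<integral>x. q x \<partial>lborel) = (\<integral>x. q x \<partial>distr lborel borel ((+) a))" by (simp add: lborel_distr_plus)
    also have "\<dots> = (\<integral>x. q (x + a) \<partial>lborel)" by (simp add: integral_distr add.commute)
    finally show "(\<integral>x. q (x + a) \<partial>lborel) = (\<integral>x. q x \<partial>lborel)" by simp
  qed
  have Q0: "(\<integral>x. Q n x \<partial>lborel) = 0" for n
    unfolding Q_def using shift q_int by simp
  have mvt: "\<exists>t. 0 < t \<and> t < h n \<and> Q n x = D (x + t *\<^sub>R e)" for n x
  proof -
    have "\<exists>z>0. z < h n \<and> q (x + h n *\<^sub>R e) - q (x + 0 *\<^sub>R e) = (h n - 0) * D (x + z *\<^sub>R e)"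
      by (rule MVT2) (use h der in auto)
    then show ?thesis using h(1)[of n] by (auto simp: Q_def)
  qed
  have "(\<lambda>n. \<integral>x. Q n x \<partial>lborel) \<longlonglongrightarrow> (\<integral>x. D x \<partial>lborel)"
  proof (rule integral_dominated_convergence[where w = "\<lambda>x. max B 0 * indicator (cball 0 R) x"])
    show "integrable lborel (\<lambda>x::'a. max B 0 * indicator (cball 0 R) x)"
      using emeasure_bounded_finite[of "cball (0::'a) R"] by (intro integrable_mult_right integrable_real_indicator) auto
    show "AE x in lborel. (\<lambda>n. Q n x) \<longlonglongrightarrow> D x"
    proof (rule AE_I2)
      fix x
      have "(\<lambda>n. h n) \<longlonglongrightarrow> 0" unfolding h_def by (rule LIMSEQ_inverse_real_of_nat)
      moreover have "eventually (\<lambda>n. h n \<noteq> 0) sequentially" using h(1) by (auto simp: less_imp_neq[symmetric])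
      ultimately have "filterlim h (at 0) sequentially" by (simp add: filterlim_at)
      moreover have "((\<lambda>t. (q (x + (0 + t) *\<^sub>R e) - q (x + 0 *\<^sub>R e)) / t) \<longlongrightarrow> D (x + 0 *\<^sub>R e)) (at 0)"
        using der[of x 0] unfolding DERIV_def .
      ultimately show "(\<lambda>n. Q n x) \<longlonglongrightarrow> D x"
        unfolding Q_def using filterlim_compose by fastforce
    qed
    show "AE x in lborel. norm (Q n x) \<le> max B 0 * indicator (cball 0 R) x" for n
    proof (rule AE_I2)
      fix x
      obtain t where t: "0 < t" "t < h n" "Q n x = D (x + t *\<^sub>R e)" using mvt by blast
      show "norm (Q n x) \<le> max B 0 * indicator (cball 0 R) x"
      proof (cases "x + t *\<^sub>R e \<in> K")
        case True
        have "norm x \<le> norm (x + t *\<^sub>R e) + norm (t *\<^sub>R e)"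
          using norm_triangle_ineq4[of "x + t *\<^sub>R e" "t *\<^sub>R e"] by simp
        also have "\<dots> \<le> r + 1 * norm e"
          using r[OF True] t h(2)[of n] mult_right_mono[of t 1 "norm e"] by auto
        finally show ?thesis using B t(3) by (simp add: R_def)
      qed (use t(3) K(3) in \<open>auto simp: zero_le_mult_iff\<close>)
    qed
  qed (auto simp: Q_def)
  then show ?thesis using Q0 by (simp add: LIMSEQ_const_iff)
qed

lemma test_function_C1:
  fixes p :: "real^'n::finite \<Rightarrow> real"
  assumes "test_function S p"
  shows "continuous_on UNIV p" "continuous_on UNIV (partial_deriv i p)"
    "(p has_derivative frechet_derivative p (at x)) (at x)"
    "compact (closure {x. p x \<noteq> 0})" "x \<notin> closure {x. p x \<noteq> 0} \<Longrightarrow> partial_deriv i p x = 0"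
    "x \<notin> S \<Longrightarrow> p x = 0" "x \<notin> S \<Longrightarrow> partial_deriv i p x = 0"
proof -
  have c: "continuously_diff (Suc 0) p" "continuously_diff 0 p"
    and supp: "compact (closure {x. p x \<noteq> 0})" "closure {x. p x \<noteq> 0} \<subseteq> S"
    using assms unfolding test_function_def by blast+
  show "continuous_on UNIV p" using c(2) by simp
  have "axis i (1::real) \<in> Basis" by (simp add: axis_in_Basis_iff)
  then show "continuous_on UNIV (partial_deriv i p)"
    using c(1) by (simp add: partial_deriv_def[abs_def])
  show "(p has_derivative frechet_derivative p (at x)) (at x)"
    using c(1) by (simp add: differentiable_on_def frechet_derivative_works)
  show "compact (closure {x. p x \<noteq> 0})" by fact
  show z: "partial_deriv i p x = 0" if "x \<notin> closure {x. p x \<noteq> 0}" for x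
  proof -
    have "(p has_derivative (\<lambda>_. 0)) (at x)"
      by (rule has_derivative_transform_within_open[where f = "\<lambda>_. 0" and s = "- closure {x. p x \<noteq> 0}"])
        (use that closure_subset[of "{x. p x \<noteq> 0}"] in auto)
    then have "frechet_derivative p (at x) = (\<lambda>_. 0)" by (simp add: frechet_derivative_at[symmetric])
    then show ?thesis by (simp add: partial_deriv_def)
  qed
  show "p x = 0" if "x \<notin> S" using that supp(2) closure_subset[of "{x. p x \<noteq> 0}"] by blast
  show "partial_deriv i p x = 0" if "x \<notin> S" using z that supp(2) by blast
qed

text \<open>
  The integral of the \<open>i\<close>-th derivative of \<open>x\<^sub>i p\<^sup>2\<close> vanishes, that is
  \<open>\<integral> p\<^sup>2 + 2 x\<^sub>i p \<partial>\<^sub>i p = 0\<close>. Here \<open>- 2 x\<^sub>i p \<partial>\<^sub>i p \<le> p\<^sup>2/2 + 2 R\<^sup>2 (\<partial>\<^sub>i p)\<^sup>2\<close>, and the first term is absorbed.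
\<close>

lemma test_function_Poincare:
  fixes p :: "real^'n::finite \<Rightarrow> real"
  assumes p: "test_function \<Omega> p" and R: "\<And>x. x \<in> \<Omega> \<Longrightarrow> \<bar>x $ i\<bar> \<le> R"
  shows "integrable lborel (\<lambda>x. (p x)\<^sup>2)" "integrable lborel (\<lambda>x. (partial_deriv i p x)\<^sup>2)"
    "(\<integral>x. (p x)\<^sup>2 \<partial>lborel) \<le> 4 * R\<^sup>2 * (\<integral>x. (partial_deriv i p x)\<^sup>2 \<partial>lborel)"
proof -
  let ?e = "axis i 1 :: real^'n"
  define K where "K = closure {x. p x \<noteq> 0}"
  note C = test_function_C1[OF p, folded K_def]
  have p0: "p x = 0" if "x \<notin> K" for x
    using that closure_subset[of "{x. p x \<noteq> 0}"] unfolding K_def by blast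
  have int: "integrable lborel f" if f: "continuous_on UNIV f" "\<And>x. x \<notin> K \<Longrightarrow> f x = 0" for f :: "real^'n \<Rightarrow> real"
  proof -
    have "integrable lborel (\<lambda>x. indicator K x *\<^sub>R f x)"
      using borel_integrable_compact[OF C(4), of f] f(1) continuous_on_subset
      by (auto simp: set_integrable_def indicator_scaleR_eq_if)
    moreover have "(\<lambda>x. indicator K x *\<^sub>R f x) = f" using f(2) by (force simp: indicator_def)
    ultimately show ?thesis by simp
  qed
  show i1: "integrable lborel (\<lambda>x. (p x)\<^sup>2)"
    by (rule int) (simp_all add: C(1) p0 continuous_on_power)
  show i2: "integrable lborel (\<lambda>x. (partial_deriv i p x)\<^sup>2)"
    by (rule int) (simp_all add: C(2,5) continuous_on_power)
  define D where "D x = (p x)\<^sup>2 + 2 * x $ i * p x * partial_deriv i p x" for x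
  have contD: "continuous_on UNIV D"
    unfolding D_def[abs_def] by (intro continuous_intros C(1,2))
  have D0: "D x = 0" if "x \<notin> K" for x
    using that by (simp add: D_def p0)
  have "(\<integral>x. D x \<partial>lborel) = 0"
  proof (rule integral_directional_derivative_eq_0[where e = ?e and q = "\<lambda>x. x $ i * (p x)\<^sup>2" and K = K])
    fix x :: "real^'n" and t :: real
    have "((\<lambda>t. p (x + t *\<^sub>R ?e)) has_derivative (\<lambda>s. frechet_derivative p (at (x + t *\<^sub>R ?e)) (s *\<^sub>R ?e))) (at t)"
      by (rule has_derivative_compose[where g = p, OF _ C(3)]) (auto intro!: derivative_eq_intros)
    moreover have "frechet_derivative p (at y) (s *\<^sub>R ?e) = partial_deriv i p y * s" for y s
      using linear_scale[OF has_derivative_linear[OF C(3)]] by (simp add: partial_deriv_def)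
    ultimately have dp: "((\<lambda>t. p (x + t *\<^sub>R ?e)) has_real_derivative partial_deriv i p (x + t *\<^sub>R ?e)) (at t)"
      by (simp add: has_field_derivative_def)
    show "((\<lambda>t. (x + t *\<^sub>R ?e) $ i * (p (x + t *\<^sub>R ?e))\<^sup>2) has_real_derivative D (x + t *\<^sub>R ?e)) (at t)"
      by (rule derivative_eq_intros dp refl | simp)+
        (simp add: D_def power2_eq_square algebra_simps)
  qed (intro continuous_intros C(1,4) contD | simp add: p0 D0)+
  moreover have "(\<integral>x. (p x)\<^sup>2 / 2 - 2 * R\<^sup>2 * (partial_deriv i p x)\<^sup>2 \<partial>lborel) \<le> (\<integral>x. D x \<partial>lborel)"
  proof (rule integral_mono)
    show "integrable lborel D"
      by (rule int) (simp_all add: contD D0)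
    fix x
    show "(p x)\<^sup>2 / 2 - 2 * R\<^sup>2 * (partial_deriv i p x)\<^sup>2 \<le> D x"
    proof (cases "x \<in> \<Omega>")
      case True
      let ?d = "partial_deriv i p x"
      have "0 \<le> (p x + 2 * x $ i * ?d)\<^sup>2 / 2" by simp
      moreover have "(x $ i)\<^sup>2 * ?d\<^sup>2 \<le> R\<^sup>2 * ?d\<^sup>2"
        using R[OF True] abs_le_square_iff[of "x $ i" R] by (intro mult_right_mono) auto
      ultimately show ?thesis by (simp add: D_def power2_eq_square algebra_simps)
    next
      case False
      then show ?thesis using C(6)[OF False] C(7)[OF False, of i] by (simp add: D_def)
    qed
  qed (use i1 i2 in auto)
  ultimately show "(\<integral>x. (p x)\<^sup>2 \<partial>lborel) \<le> 4 * R\<^sup>2 * (\<integral>x. (partial_deriv i p x)\<^sup>2 \<partial>lborel)"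
    using i1 i2 by simp
qed

lemma lborel_integral_eq_lebesgue_on:
  fixes f :: "'a::euclidean_space \<Rightarrow> real"
  assumes "open S" "integrable lborel f" "\<And>x. x \<notin> S \<Longrightarrow> f x = 0"
  shows "integrable (lebesgue_on S) f" "integral\<^sup>L (lebesgue_on S) f = integral\<^sup>L lborel f"
proof -
  have eq: "(\<lambda>x. indicator S x *\<^sub>R f x) = f" using assms(3) by (force simp: indicator_def)
  have S: "S \<inter> space lebesgue \<in> sets lebesgue" using assms(1) by simp
  have m: "f \<in> borel_measurable lborel" using assms(2) by (rule borel_measurable_integrable)
  show "integrable (lebesgue_on S) f"
    unfolding integrable_restrict_space[OF S] eq using assms(2) m by (simp add: integrable_completion)
  show "integral\<^sup>L (lebesgue_on S) f = integral\<^sup>L lborel f"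
    unfolding integral_restrict_space[OF S] eq using m by (simp add: integral_completion)
qed

text \<open>
  Passage to the limit along test functions that approximate \<open>w\<close> together with the derivative.
\<close>

lemma H10_Poincare:
  fixes \<Omega> :: "(real^'n::finite) set"
  assumes \<Omega>: "open \<Omega>" and R: "\<And>x. x \<in> \<Omega> \<Longrightarrow> \<bar>x $ i\<bar> \<le> R" "0 \<le> R" and w: "w \<in> H10 \<Omega>"
  shows "nrm (L2_space \<Omega>) w \<le> 2 * R * nrm (L2_space \<Omega>) (\<lambda>x. weak_grad \<Omega> w x $ i)"
proof -
  let ?G = "\<lambda>x. weak_grad \<Omega> w x $ i"
  obtain p where p: "\<And>n. test_function \<Omega> (p n)"
    "(\<lambda>n::nat. nrm (L2_space \<Omega>) (\<lambda>x. p n x - w x)) \<longlonglongrightarrow> 0"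
    "(\<lambda>n. nrm (L2_space \<Omega>) (\<lambda>x. partial_deriv i (p n) x - ?G x)) \<longlonglongrightarrow> 0"
    using w unfolding H10_def by blast
  have wL2: "w \<in> elems (L2_space \<Omega>)"
    using w unfolding H10_def H1_def by blast
  have "\<exists>G. has_weak_grad \<Omega> w G"
    using w unfolding H10_def H1_def by blast
  then have "has_weak_grad \<Omega> w (weak_grad \<Omega> w)" unfolding weak_grad_def by (rule someI_ex)
  then have GL2: "?G \<in> elems (L2_space \<Omega>)" by (simp add: has_weak_grad_def)
  have P: "p n \<in> elems (L2_space \<Omega>)" "partial_deriv i (p n) \<in> elems (L2_space \<Omega>)"
    "nrm (L2_space \<Omega>) (p n) \<le> 2 * R * nrm (L2_space \<Omega>) (partial_deriv i (p n))" for n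
  proof -
    note C = test_function_C1[OF p(1)[of n]]
    note Q = test_function_Poincare[OF p(1)[of n] R(1)]
    have z: "(p n x)\<^sup>2 = 0" "(partial_deriv i (p n) x)\<^sup>2 = 0" if "x \<notin> \<Omega>" for x
      using C(6)[OF that] C(7)[OF that, of i] by simp_all
    note I = lborel_integral_eq_lebesgue_on[OF \<Omega> Q(1) z(1)] lborel_integral_eq_lebesgue_on[OF \<Omega> Q(2) z(2)]
    have meas: "f \<in> borel_measurable (lebesgue_on \<Omega>)" if "continuous_on UNIV f" for f :: "real^'n \<Rightarrow> real"
      using borel_measurable_continuous_onI[OF that]
      by (intro measurable_restrict_space1 measurable_completion) simp
    show "p n \<in> elems (L2_space \<Omega>)"
      using meas[OF C(1)] I(1) unfolding L2_elems_iff by blast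
    show "partial_deriv i (p n) \<in> elems (L2_space \<Omega>)"
      using meas[OF C(2)] I(3) unfolding L2_elems_iff by blast
    have "nrm (L2_space \<Omega>) (p n) \<le> sqrt ((2 * R)\<^sup>2 * (\<integral>x. (partial_deriv i (p n) x)\<^sup>2 \<partial>lborel))"
      using Q(3) by (simp add: L2_space_def I(2) power_mult_distrib)
    then show "nrm (L2_space \<Omega>) (p n) \<le> 2 * R * nrm (L2_space \<Omega>) (partial_deriv i (p n))"
      using R(2) by (simp add: real_sqrt_mult L2_space_def I(4))
  qed
  show ?thesis
  proof (rule LIMSEQ_le)
    show "(\<lambda>n. nrm (L2_space \<Omega>) (p n)) \<longlonglongrightarrow> nrm (L2_space \<Omega>) w"
      by (rule L2_nrm_tendsto[OF P(1) wL2 p(2)])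
    show "(\<lambda>n. 2 * R * nrm (L2_space \<Omega>) (partial_deriv i (p n))) \<longlonglongrightarrow> 2 * R * nrm (L2_space \<Omega>) ?G"
      by (intro tendsto_intros L2_nrm_tendsto P GL2 p(3))
    show "\<exists>N. \<forall>n\<ge>N. nrm (L2_space \<Omega>) (p n) \<le> 2 * R * nrm (L2_space \<Omega>) (partial_deriv i (p n))"
      using P(3) by blast
  qed
qed

text \<open>
  Testing the eigenvalue equation with the normalised eigenfunction itself expresses the eigenvalue as
  the energy. Since \<open>A\<close> is elliptic and \<open>c\<close> nonnegative, this is at least \<open>\<alpha>\<close> times the square norm of one partial derivative, and
  the Poincare inequality bounds the latter below by \<open>1/(4 R\<^sup>2)\<close>.
\<close>

lemma eigenvalues_bounded_below:
  fixes \<Omega> :: "(real^'n::finite) set"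
  assumes \<Omega>: "open \<Omega>" "bounded \<Omega>" and A: "admissible_coeffs \<Omega> A c" and eig: "eigensystem \<Omega> A c lam \<phi>"
  obtains \<mu> where "0 < \<mu>" "\<And>k. \<mu> \<le> lam k"
proof -
  obtain \<alpha> where \<alpha>: "0 < \<alpha>" "\<And>x \<xi>. x \<in> \<Omega> \<Longrightarrow> \<alpha> * (\<xi> \<bullet> \<xi>) \<le> \<xi> \<bullet> (A x *v \<xi>)"
    and c: "AE x in lebesgue_on \<Omega>. 0 \<le> c x"
    using A unfolding admissible_coeffs_def by blast
  obtain R where R: "0 < R" "\<And>x. x \<in> \<Omega> \<Longrightarrow> norm x \<le> R" using \<Omega>(2) by (auto simp: bounded_pos)
  fix i :: 'n
  have "\<alpha> / (4 * R\<^sup>2) \<le> lam k" for k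
  proof -
    have lam: "0 < lam k" and ep: "eigenpair \<Omega> A c (lam k) (\<phi> k)" and on: "L2_inner \<Omega> (\<phi> k) (\<phi> k) = 1"
      using eig by (auto simp: eigensystem_def orthonormal_basis_def)
    have H: "\<phi> k \<in> H10 \<Omega>" using ep by (simp add: eigenpair_def)
    let ?g = "weak_grad \<Omega> (\<phi> k)"
    let ?E = "\<lambda>x. (A x *v ?g x) \<bullet> ?g x + c x * \<phi> k x * \<phi> k x"
    have "\<exists>G. has_weak_grad \<Omega> (\<phi> k) G" using H unfolding H10_def H1_def by blast
    then have "has_weak_grad \<Omega> (\<phi> k) ?g" unfolding weak_grad_def by (rule someI_ex)
    then have GL2: "(\<lambda>x. ?g x $ i) \<in> elems (L2_space \<Omega>)" by (simp add: has_weak_grad_def)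
    have E: "integral\<^sup>L (lebesgue_on \<Omega>) ?E = lam k" using ep H on by (simp add: eigenpair_def)
    (* The integral of a function that is not integrable is 0 by convention, while lam k > 0. *)
    have Eint: "integrable (lebesgue_on \<Omega>) ?E"
      using E lam not_integrable_integral_eq[of "lebesgue_on \<Omega>" ?E] by auto
    have "\<alpha> * (nrm (L2_space \<Omega>) (\<lambda>x. ?g x $ i))\<^sup>2 = (\<integral>x. \<alpha> * (?g x $ i)\<^sup>2 \<partial>lebesgue_on \<Omega>)"
      unfolding L2_nrm_square by (simp add: L2_inner_def power2_eq_square)
    also have "\<dots> \<le> integral\<^sup>L (lebesgue_on \<Omega>) ?E"
    proof (rule integral_mono_AE[OF _ Eint])
      show "integrable (lebesgue_on \<Omega>) (\<lambda>x. \<alpha> * (?g x $ i)\<^sup>2)" using GL2 by (simp add: L2_elems_iff)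
      have "AE x in lebesgue_on \<Omega>. x \<in> \<Omega>" by (rule AE_I2) simp
      with c show "AE x in lebesgue_on \<Omega>. \<alpha> * (?g x $ i)\<^sup>2 \<le> ?E x"
      proof eventually_elim
        case (elim x)
        have "(?g x $ i)\<^sup>2 \<le> ?g x \<bullet> ?g x"
          using component_le_norm_cart[of "?g x" i] unfolding power2_norm_eq_inner[symmetric]
          by (simp add: abs_le_square_iff[symmetric])
        then have "\<alpha> * (?g x $ i)\<^sup>2 \<le> \<alpha> * (?g x \<bullet> ?g x)" using \<alpha>(1) by simp
        also have "\<dots> \<le> (A x *v ?g x) \<bullet> ?g x" using \<alpha>(2)[OF elim(2)] by (simp add: inner_commute)
        finally show ?case using elim(1) by (simp add: mult.assoc add_increasing2)
      qed
    qed
    finally have g: "\<alpha> * (nrm (L2_space \<Omega>) (\<lambda>x. ?g x $ i))\<^sup>2 \<le> lam k" using E by simp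
    have "1 \<le> 2 * R * nrm (L2_space \<Omega>) (\<lambda>x. ?g x $ i)"
    proof -
      have "\<bar>x $ i\<bar> \<le> R" if "x \<in> \<Omega>" for x
        using component_le_norm_cart[of x i] R(2)[OF that] by linarith
      from H10_Poincare[OF \<Omega>(1) this less_imp_le[OF R(1)] H]
      show ?thesis using on by (simp add: L2_nrm_eq)
    qed
    then have "1\<^sup>2 \<le> (2 * R * nrm (L2_space \<Omega>) (\<lambda>x. ?g x $ i))\<^sup>2" by (intro power_mono) auto
    then have "\<alpha> * 1 \<le> \<alpha> * (4 * R\<^sup>2 * (nrm (L2_space \<Omega>) (\<lambda>x. ?g x $ i))\<^sup>2)"
      using \<alpha>(1) by (simp add: power_mult_distrib)
    also have "\<dots> = 4 * R\<^sup>2 * (\<alpha> * (nrm (L2_space \<Omega>) (\<lambda>x. ?g x $ i))\<^sup>2)" by simp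
    also have "\<dots> \<le> 4 * R\<^sup>2 * lam k" using g by (intro mult_left_mono) auto
    finally show ?thesis using R(1) by (simp add: divide_simps mult.commute)
  qed
  then show ?thesis using that[of "\<alpha> / (4 * R\<^sup>2)"] \<alpha>(1) R(1) by simp
qed

section \<open>Weighted sequence spaces and their duals\<close>

text \<open>
  A seminormed space that, up to elements of norm 0, is the weighted sequence space of all \<open>c\<close>
  with \<open>\<Sum> wt k * c\<^sub>k\<^sup>2 < \<infinity>\<close>; \<open>coef k\<close> are the coordinates and \<open>e k\<close> the unit vectors. The last assumption
  is completeness in the form of the theorem of Riesz and Fischer.
\<close>

locale coord_space =
  fixes X :: "'a fspace" and coef :: "nat \<Rightarrow> ('a \<Rightarrow> real) \<Rightarrow> real"
    and wt :: "nat \<Rightarrow> real" and e :: "nat \<Rightarrow> 'a \<Rightarrow> real"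
  assumes wt_pos: "0 < wt k"
    and lincomb: "v \<in> elems X \<Longrightarrow> w \<in> elems X \<Longrightarrow> (\<lambda>x. a * v x + b * w x) \<in> elems X"
    and coef_lincomb: "v \<in> elems X \<Longrightarrow> w \<in> elems X \<Longrightarrow>
      coef k (\<lambda>x. a * v x + b * w x) = a * coef k v + b * coef k w"
    and summable_coef: "v \<in> elems X \<Longrightarrow> summable (\<lambda>k. wt k * (coef k v)\<^sup>2)"
    and nrm_eq: "v \<in> elems X \<Longrightarrow> nrm X v = sqrt (\<Sum>k. wt k * (coef k v)\<^sup>2)"
    and basis_elem: "e k \<in> elems X"
    and coef_basis: "coef j (e k) = (if j = k then 1 else 0)"
    and complete: "summable (\<lambda>k. wt k * (c k)\<^sup>2) \<Longrightarrow> \<exists>v\<in>elems X. \<forall>k. coef k v = c k"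
begin

lemma wt_nonneg: "0 \<le> wt k"
  using wt_pos less_imp_le by blast

lemma term_nonneg: "0 \<le> wt k * x\<^sup>2"
  using wt_nonneg by simp

lemma zero_elem: "(\<lambda>_. 0) \<in> elems X" and coef_zero: "coef k (\<lambda>_. 0) = 0"
  using lincomb[OF basis_elem basis_elem, of 0 0 0 0] coef_lincomb[OF basis_elem basis_elem, of k 0 0 0 0]
  by simp_all

lemma scale_elem: "v \<in> elems X \<Longrightarrow> (\<lambda>x. a * v x) \<in> elems X"
  and coef_scale: "v \<in> elems X \<Longrightarrow> coef k (\<lambda>x. a * v x) = a * coef k v"
  using lincomb[of v v a 0] coef_lincomb[of v v k a 0] by simp_all

lemma diff_elem: "v \<in> elems X \<Longrightarrow> w \<in> elems X \<Longrightarrow> (\<lambda>x. v x - w x) \<in> elems X"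
  and coef_diff: "v \<in> elems X \<Longrightarrow> w \<in> elems X \<Longrightarrow> coef k (\<lambda>x. v x - w x) = coef k v - coef k w"
  using lincomb[of v w 1 "-1"] coef_lincomb[of v w k 1 "-1"] by simp_all

lemma sum_elem:
  assumes "finite I" "\<And>i. i \<in> I \<Longrightarrow> v i \<in> elems X"
  shows "(\<lambda>x. \<Sum>i\<in>I. c i * v i x) \<in> elems X"
    and "coef k (\<lambda>x. \<Sum>i\<in>I. c i * v i x) = (\<Sum>i\<in>I. c i * coef k (v i))"
proof -
  have "(\<lambda>x. \<Sum>i\<in>I. c i * v i x) \<in> elems X \<and>
      coef k (\<lambda>x. \<Sum>i\<in>I. c i * v i x) = (\<Sum>i\<in>I. c i * coef k (v i))"
    using assms
  proof (induction I)
    case (insert i I)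
    then show ?case
      using lincomb[of "v i" "\<lambda>x. \<Sum>i\<in>I. c i * v i x" "c i" 1]
        coef_lincomb[of "v i" "\<lambda>x. \<Sum>i\<in>I. c i * v i x" k "c i" 1] by simp
  qed (simp add: zero_elem coef_zero)
  then show "(\<lambda>x. \<Sum>i\<in>I. c i * v i x) \<in> elems X"
    "coef k (\<lambda>x. \<Sum>i\<in>I. c i * v i x) = (\<Sum>i\<in>I. c i * coef k (v i))" by blast+
qed

lemma comb_elem: "(\<lambda>x. \<Sum>i<n. c i * e i x) \<in> elems X"
  and coef_comb: "coef k (\<lambda>x. \<Sum>i<n. c i * e i x) = (if k < n then c k else 0)"
proof -
  show "(\<lambda>x. \<Sum>i<n. c i * e i x) \<in> elems X" by (rule sum_elem) (auto simp: basis_elem)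
  have "coef k (\<lambda>x. \<Sum>i<n. c i * e i x) = (\<Sum>i<n. c i * coef k (e i))"
    by (rule sum_elem) (auto simp: basis_elem)
  also have "\<dots> = (\<Sum>i<n. if k = i then c i else 0)"
    by (intro sum.cong) (auto simp: coef_basis)
  finally show "coef k (\<lambda>x. \<Sum>i<n. c i * e i x) = (if k < n then c k else 0)" by simp
qed

lemma sqsum_nonneg: "v \<in> elems X \<Longrightarrow> 0 \<le> (\<Sum>k. wt k * (coef k v)\<^sup>2)"
  using summable_coef by (intro suminf_nonneg) (auto simp: term_nonneg)

lemma nrm_nonneg: "v \<in> elems X \<Longrightarrow> 0 \<le> nrm X v"
  by (simp add: nrm_eq sqsum_nonneg)

lemma nrm_square: "v \<in> elems X \<Longrightarrow> (nrm X v)\<^sup>2 = (\<Sum>k. wt k * (coef k v)\<^sup>2)"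
  by (simp add: nrm_eq sqsum_nonneg)

lemma nrm_square_sums: "v \<in> elems X \<Longrightarrow> (\<lambda>k. wt k * (coef k v)\<^sup>2) sums (nrm X v)\<^sup>2"
  using summable_coef by (simp add: nrm_square summable_sums)

lemma coef_square_le: "v \<in> elems X \<Longrightarrow> wt k * (coef k v)\<^sup>2 \<le> (nrm X v)\<^sup>2"
  unfolding nrm_square using sum_le_suminf[OF summable_coef, of v "{k}"] by (simp add: term_nonneg)

lemma coef_le: assumes "v \<in> elems X" shows "\<bar>coef k v\<bar> \<le> nrm X v / sqrt (wt k)"
proof (rule power2_le_imp_le)
  show "\<bar>coef k v\<bar>\<^sup>2 \<le> (nrm X v / sqrt (wt k))\<^sup>2"
    using coef_square_le[OF assms, of k] wt_pos[of k] by (simp add: power_divide field_simps)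
qed (simp add: nrm_nonneg assms wt_nonneg)

lemma nrm_zero_iff: "v \<in> elems X \<Longrightarrow> nrm X v = 0 \<longleftrightarrow> (\<forall>k. coef k v = 0)"
  using nrm_eq[of v] coef_le[of v] by fastforce

lemma nrm_scale: "v \<in> elems X \<Longrightarrow> nrm X (\<lambda>x. a * v x) = \<bar>a\<bar> * nrm X v"
  using suminf_mult[OF summable_coef, of v "a\<^sup>2"]
  by (simp add: nrm_eq scale_elem coef_scale power_mult_distrib mult.left_commute real_sqrt_mult)

lemma nrm_comb: "nrm X (\<lambda>x. \<Sum>i<n. c i * e i x) = sqrt (\<Sum>k<n. wt k * (c k)\<^sup>2)"
proof -
  have "(\<lambda>k. wt k * (coef k (\<lambda>x. \<Sum>i<n. c i * e i x))\<^sup>2) sums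
      (\<Sum>k<n. wt k * (coef k (\<lambda>x. \<Sum>i<n. c i * e i x))\<^sup>2)"
    unfolding coef_comb by (rule sums_finite) auto
  also have "(\<Sum>k<n. wt k * (coef k (\<lambda>x. \<Sum>i<n. c i * e i x))\<^sup>2) = (\<Sum>k<n. wt k * (c k)\<^sup>2)"
    unfolding coef_comb by (rule sum.cong) auto
  finally show ?thesis
    unfolding nrm_eq[OF comb_elem] by (simp only: sums_iff)
qed

lemma truncation_tendsto:
  assumes v: "v \<in> elems X"
  shows "(\<lambda>n. nrm X (\<lambda>x. v x - (\<Sum>i<n. coef i v * e i x))) \<longlonglongrightarrow> 0"
proof -
  let ?r = "\<lambda>n x. v x - (\<Sum>i<n. coef i v * e i x)"
  have r: "?r n \<in> elems X" "coef k (?r n) = (if k < n then 0 else coef k v)" for n k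
    using diff_elem[OF v comb_elem] coef_diff[OF v comb_elem] coef_comb by auto
  have "(nrm X (?r n))\<^sup>2 = (\<Sum>k. wt k * (coef k v)\<^sup>2) - (\<Sum>k<n. wt k * (coef k v)\<^sup>2)" for n
  proof -
    have "(nrm X (?r n))\<^sup>2 = (\<Sum>k. wt (k + n) * (coef (k + n) (?r n))\<^sup>2) + (\<Sum>k<n. wt k * (coef k (?r n))\<^sup>2)"
      unfolding nrm_square[OF r(1)] by (rule suminf_split_initial_segment[OF summable_coef[OF r(1)]])
    also have "\<dots> = (\<Sum>k. wt (k + n) * (coef (k + n) v)\<^sup>2)" by (simp add: r(2))
    also have "\<dots> = (\<Sum>k. wt k * (coef k v)\<^sup>2) - (\<Sum>k<n. wt k * (coef k v)\<^sup>2)"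
      by (rule suminf_minus_initial_segment[OF summable_coef[OF v]])
    finally show ?thesis .
  qed
  moreover have "(\<lambda>n. (\<Sum>k. wt k * (coef k v)\<^sup>2) - (\<Sum>k<n. wt k * (coef k v)\<^sup>2)) \<longlonglongrightarrow>
      (\<Sum>k. wt k * (coef k v)\<^sup>2) - (\<Sum>k. wt k * (coef k v)\<^sup>2)"
    by (intro tendsto_intros summable_LIMSEQ summable_coef v)
  ultimately have "(\<lambda>n. (nrm X (?r n))\<^sup>2) \<longlonglongrightarrow> 0" by simp
  then have "(\<lambda>n. sqrt ((nrm X (?r n))\<^sup>2)) \<longlonglongrightarrow> sqrt 0" by (rule tendsto_real_sqrt)
  then show ?thesis using nrm_nonneg[OF r(1)] by simp
qed

lemma weighted_Cauchy_Schwarz: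
  assumes c: "summable (\<lambda>k. (c k)\<^sup>2 / wt k)" and d: "summable (\<lambda>k. wt k * (d k)\<^sup>2)"
  shows "summable (\<lambda>k. \<bar>c k * d k\<bar>)"
    "(\<Sum>k. \<bar>c k * d k\<bar>) \<le> sqrt (\<Sum>k. (c k)\<^sup>2 / wt k) * sqrt (\<Sum>k. wt k * (d k)\<^sup>2)"
proof -
  let ?B = "sqrt (\<Sum>k. (c k)\<^sup>2 / wt k) * sqrt (\<Sum>k. wt k * (d k)\<^sup>2)"
  have le: "(\<Sum>k<n. \<bar>c k * d k\<bar>) \<le> ?B" for n
  proof -
    have "(\<Sum>k<n. \<bar>c k * d k\<bar>) = (\<Sum>k<n. \<bar>c k / sqrt (wt k)\<bar> * \<bar>sqrt (wt k) * d k\<bar>)"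
      using wt_pos less_imp_neq[OF wt_pos] by (intro sum.cong) (auto simp: abs_mult)
    also have "\<dots> \<le> L2_set (\<lambda>k. c k / sqrt (wt k)) {..<n} * L2_set (\<lambda>k. sqrt (wt k) * d k) {..<n}"
      by (rule L2_set_mult_ineq)
    also have "\<dots> = sqrt (\<Sum>k<n. (c k)\<^sup>2 / wt k) * sqrt (\<Sum>k<n. wt k * (d k)\<^sup>2)"
      by (simp add: L2_set_def power_divide power_mult_distrib wt_nonneg)
    also have "\<dots> \<le> ?B"
      by (intro mult_mono real_sqrt_le_mono sum_le_suminf c d real_sqrt_ge_zero sum_nonneg)
        (auto simp: wt_nonneg suminf_nonneg c)
    finally show ?thesis .
  qed
  show s: "summable (\<lambda>k. \<bar>c k * d k\<bar>)"
    by (rule summableI_nonneg_bounded[OF _ le]) simp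
  show "(\<Sum>k. \<bar>c k * d k\<bar>) \<le> ?B"
    by (rule suminf_le_const[OF s le])
qed

lemma dual_elems_iff:
  "F \<in> elems (dual_space X) \<longleftrightarrow>
    (\<forall>v\<in>elems X. \<forall>w\<in>elems X. \<forall>a b. F (\<lambda>x. a * v x + b * w x) = a * F v + b * F w) \<and>
    (\<exists>B. \<forall>v\<in>elems X. \<bar>F v\<bar> \<le> B * nrm X v)"
  by (simp add: dual_space_def)

lemma dual_lin: "F \<in> elems (dual_space X) \<Longrightarrow> v \<in> elems X \<Longrightarrow> w \<in> elems X \<Longrightarrow>
    F (\<lambda>x. a * v x + b * w x) = a * F v + b * F w"
  by (simp add: dual_elems_iff)

lemma dual_comb:
  assumes F: "F \<in> elems (dual_space X)"
  shows "F (\<lambda>x. \<Sum>i<n. c i * e i x) = (\<Sum>i<n. c i * F (e i))"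
proof (induction n)
  case 0
  then show ?case using dual_lin[OF F basis_elem basis_elem, of 0 0 0 0] by simp
next
  case (Suc n)
  then show ?case using dual_lin[OF F comb_elem basis_elem, of 1 c n "c n" n] by simp
qed

text \<open>
  Let \<open>Q\<close> be the \<open>n\<close>-th partial sum and \<open>v\<close> the combination of the first \<open>n\<close> unit vectors with coefficients
  \<open>F(e\<^sub>k)/wt\<^sub>k\<close>. Then \<open>F v = Q\<close> and \<open>v\<close> has norm \<open>sqrt Q\<close>, so boundedness of \<open>F\<close> bounds \<open>sqrt Q\<close>.
\<close>

lemma dual_summable:
  assumes F: "F \<in> elems (dual_space X)"
  shows "summable (\<lambda>k. (F (e k))\<^sup>2 / wt k)"
proof -
  obtain B where "\<forall>v\<in>elems X. \<bar>F v\<bar> \<le> B * nrm X v"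
    using F unfolding dual_elems_iff by blast
  then have B: "\<bar>F v\<bar> \<le> B * nrm X v" if "v \<in> elems X" for v using that by blast
  have "(\<Sum>k<n. (F (e k))\<^sup>2 / wt k) \<le> B\<^sup>2" for n
  proof -
    let ?Q = "\<Sum>k<n. (F (e k))\<^sup>2 / wt k"
    let ?v = "\<lambda>x. \<Sum>i<n. (F (e i) / wt i) * e i x"
    have Q0: "0 \<le> ?Q" using wt_nonneg by (intro sum_nonneg) auto
    have "(\<Sum>k<n. wt k * (F (e k) / wt k)\<^sup>2) = ?Q"
      using wt_pos less_imp_neq[OF wt_pos]
      by (intro sum.cong) (auto simp: power2_eq_square field_simps)
    then have "nrm X ?v = sqrt ?Q" by (simp only: nrm_comb)
    moreover have "F ?v = ?Q"
      unfolding dual_comb[OF F] by (simp add: power2_eq_square)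
    ultimately have *: "?Q \<le> B * sqrt ?Q" using B[OF comb_elem, of "\<lambda>i. F (e i) / wt i" n] Q0 by simp
    show ?thesis
    proof (cases "?Q = 0")
      case False
      then have "0 < sqrt ?Q" using Q0 by simp
      moreover have "sqrt ?Q * sqrt ?Q \<le> B * sqrt ?Q" using * Q0 by simp
      ultimately have "sqrt ?Q \<le> B" by (simp only: mult_le_cancel_right_pos)
      then have "(sqrt ?Q)\<^sup>2 \<le> B\<^sup>2" using Q0 by (intro power_mono) auto
      then show ?thesis using Q0 by simp
    qed simp
  qed
  then show ?thesis
    using wt_nonneg by (intro summableI_nonneg_bounded[where x = "B\<^sup>2"]) auto
qed

lemma dual_sums:
  assumes F: "F \<in> elems (dual_space X)" and v: "v \<in> elems X"
  shows "(\<lambda>k. F (e k) * coef k v) sums F v"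
proof -
  obtain B where "\<forall>v\<in>elems X. \<bar>F v\<bar> \<le> B * nrm X v"
    using F unfolding dual_elems_iff by blast
  then have B: "\<bar>F v\<bar> \<le> B * nrm X v" if "v \<in> elems X" for v using that by blast
  have "(\<lambda>n. F v - (\<Sum>k<n. F (e k) * coef k v)) \<longlonglongrightarrow> 0"
  proof (rule Lim_null_comparison)
    show "\<forall>\<^sub>F n in sequentially. norm (F v - (\<Sum>k<n. F (e k) * coef k v)) \<le>
        B * nrm X (\<lambda>x. v x - (\<Sum>i<n. coef i v * e i x))"
    proof (rule always_eventually, rule allI)
      fix n
      have "F v - (\<Sum>k<n. F (e k) * coef k v) = F (\<lambda>x. v x - (\<Sum>i<n. coef i v * e i x))"
        using dual_lin[OF F v comb_elem, of 1 "-1" "\<lambda>i. coef i v" n] by (simp add: dual_comb[OF F] mult.commute)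
      then show "norm (F v - (\<Sum>k<n. F (e k) * coef k v)) \<le> B * nrm X (\<lambda>x. v x - (\<Sum>i<n. coef i v * e i x))"
        using B[OF diff_elem[OF v comb_elem], of "\<lambda>i. coef i v" n] by simp
    qed
    show "(\<lambda>n. B * nrm X (\<lambda>x. v x - (\<Sum>i<n. coef i v * e i x))) \<longlonglongrightarrow> 0"
      by (intro tendsto_mult_right_zero truncation_tendsto v)
  qed
  then have "(\<lambda>n. F v - (F v - (\<Sum>k<n. F (e k) * coef k v))) \<longlonglongrightarrow> F v - 0"
    by (intro tendsto_intros)
  then show ?thesis by (simp add: sums_def)
qed

lemma dual_le:
  assumes F: "F \<in> elems (dual_space X)" and v: "v \<in> elems X"
  shows "\<bar>F v\<bar> \<le> sqrt (\<Sum>k. (F (e k))\<^sup>2 / wt k) * nrm X v"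
proof -
  note cs = weighted_Cauchy_Schwarz[OF dual_summable[OF F] summable_coef[OF v]]
  have "\<bar>F v\<bar> \<le> (\<Sum>k. \<bar>F (e k) * coef k v\<bar>)"
    using summable_rabs[OF cs(1)] dual_sums[OF F v] by (simp add: sums_iff)
  with cs(2) show ?thesis by (simp add: nrm_eq[OF v])
qed

text \<open>
  The upper bound is the inequality of Cauchy and Schwarz; the normalised truncations of the vector
  that represents \<open>F\<close> show that the supremum is not smaller.
\<close>

lemma dual_nrm:
  assumes F: "F \<in> elems (dual_space X)"
  shows "nrm (dual_space X) F = sqrt (\<Sum>k. (F (e k))\<^sup>2 / wt k)"
proof -
  let ?q = "\<lambda>k. (F (e k))\<^sup>2 / wt k"
  let ?A = "{\<bar>F v\<bar> |v. v \<in> elems X \<and> nrm X v \<le> 1}"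
  have q0: "0 \<le> ?q k" for k using wt_nonneg by simp
  have up: "a \<le> sqrt (suminf ?q)" if "a \<in> ?A" for a
  proof -
    obtain v where v: "v \<in> elems X" "nrm X v \<le> 1" "a = \<bar>F v\<bar>" using \<open>a \<in> ?A\<close> by blast
    have "a \<le> sqrt (suminf ?q) * nrm X v" using dual_le[OF F v(1)] v(3) by simp
    also have "\<dots> \<le> sqrt (suminf ?q) * 1"
      using v(2) suminf_nonneg[OF dual_summable[OF F]] q0 by (intro mult_left_mono) auto
    finally show ?thesis by simp
  qed
  have "\<bar>F (\<lambda>_. 0)\<bar> \<in> ?A"
    using zero_elem nrm_zero_iff[OF zero_elem] coef_zero by (intro CollectI exI[of _ "\<lambda>_. 0"]) auto
  then have ne: "?A \<noteq> {}" and S0: "0 \<le> Sup ?A"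
    using up by (auto intro!: cSup_upper2[where x = "\<bar>F (\<lambda>_. 0)\<bar>"] bdd_aboveI)
  have low: "(\<Sum>k<n. ?q k) \<le> (Sup ?A)\<^sup>2" for n
  proof -
    let ?Q = "\<Sum>k<n. ?q k"
    have Q0: "0 \<le> ?Q" using q0 by (intro sum_nonneg) auto
    show ?thesis
    proof (cases "?Q = 0")
      case False
      then have pos: "0 < sqrt ?Q" using Q0 by simp
      let ?v = "\<lambda>x. \<Sum>i<n. (F (e i) / wt i / sqrt ?Q) * e i x"
      have "(\<Sum>k<n. wt k * (F (e k) / wt k / sqrt ?Q)\<^sup>2) = (\<Sum>k<n. ?q k / ?Q)"
        using wt_pos less_imp_neq[OF wt_pos] Q0
        by (intro sum.cong) (auto simp: power_divide power2_eq_square field_simps)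
      also have "\<dots> = 1" unfolding sum_divide_distrib[symmetric] using False by simp
      finally have "nrm X ?v = 1" by (simp only: nrm_comb real_sqrt_one)
      moreover have "F ?v = sqrt ?Q"
      proof -
        have "F ?v = (\<Sum>i<n. ?q i / sqrt ?Q)" unfolding dual_comb[OF F] by (simp add: power2_eq_square)
        also have "\<dots> = ?Q / sqrt ?Q" by (simp add: sum_divide_distrib)
        finally show ?thesis using Q0 by (simp add: real_div_sqrt)
      qed
      ultimately have "sqrt ?Q \<in> ?A"
        using comb_elem[of "\<lambda>i. F (e i) / wt i / sqrt ?Q" n] Q0
        by (intro CollectI exI[of _ ?v] conjI) (simp_all only: abs_of_nonneg real_sqrt_ge_zero order_refl)
      then have "sqrt ?Q \<le> Sup ?A" using up by (intro cSup_upper bdd_aboveI)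
      then have "(sqrt ?Q)\<^sup>2 \<le> (Sup ?A)\<^sup>2" using Q0 by (intro power_mono) auto
      then show ?thesis using Q0 by simp
    qed simp
  qed
  have "suminf ?q \<le> (Sup ?A)\<^sup>2" by (rule suminf_le_const[OF dual_summable[OF F] low])
  then have "sqrt (suminf ?q) \<le> Sup ?A" using S0 real_le_lsqrt suminf_nonneg[OF dual_summable[OF F]] q0 by blast
  moreover have "Sup ?A \<le> sqrt (suminf ?q)" by (rule cSup_least[OF ne up])
  ultimately show ?thesis by (simp add: dual_space_def)
qed

text \<open>
  The coordinates of a functional are its values on the unit vectors; the unit vectors of the dual are
  the coordinate functionals.
\<close>

lemma dual_coord_space: "coord_space (dual_space X) (\<lambda>k F. F (e k)) (\<lambda>k. 1 / wt k) coef"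
proof
  show "0 < 1 / wt k" for k using wt_pos by simp
  show "summable (\<lambda>k. 1 / wt k * (F (e k))\<^sup>2)" if "F \<in> elems (dual_space X)" for F
    using dual_summable[OF that] by simp
  show "nrm (dual_space X) F = sqrt (\<Sum>k. 1 / wt k * (F (e k))\<^sup>2)" if "F \<in> elems (dual_space X)" for F
    using dual_nrm[OF that] by simp
  show "coef k \<in> elems (dual_space X)" for k
  proof -
    have "\<forall>v\<in>elems X. \<bar>coef k v\<bar> \<le> 1 / sqrt (wt k) * nrm X v" using coef_le by simp
    then show ?thesis using coef_lincomb unfolding dual_elems_iff by blast
  qed
  show "coef k (e j) = (if j = k then 1 else 0)" for j k by (auto simp: coef_basis)
  show "(\<lambda>x. a * F x + b * G x) \<in> elems (dual_space X)"
    if F: "F \<in> elems (dual_space X)" and G: "G \<in> elems (dual_space X)" for F G a b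
  proof -
    obtain B C where B: "\<forall>v\<in>elems X. \<bar>F v\<bar> \<le> B * nrm X v" and C: "\<forall>v\<in>elems X. \<bar>G v\<bar> \<le> C * nrm X v"
      using F G unfolding dual_elems_iff by blast
    have "\<bar>a * F v + b * G v\<bar> \<le> (\<bar>a\<bar> * B + \<bar>b\<bar> * C) * nrm X v" if "v \<in> elems X" for v
    proof -
      have "\<bar>a * F v + b * G v\<bar> \<le> \<bar>a\<bar> * \<bar>F v\<bar> + \<bar>b\<bar> * \<bar>G v\<bar>" using abs_triangle_ineq[of "a * F v" "b * G v"] by (simp add: abs_mult)
      also have "\<dots> \<le> \<bar>a\<bar> * (B * nrm X v) + \<bar>b\<bar> * (C * nrm X v)"
        using B C that by (intro add_mono mult_left_mono) auto
      finally show ?thesis by (simp add: algebra_simps)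
    qed
    then have "\<exists>K. \<forall>v\<in>elems X. \<bar>a * F v + b * G v\<bar> \<le> K * nrm X v" by blast
    then show ?thesis
      using dual_lin[OF F] dual_lin[OF G] unfolding dual_elems_iff by (simp add: algebra_simps)
  qed
  show "a * F (e k) + b * G (e k) = a * F (e k) + b * G (e k)" for F G k a b by (rule refl)
  show "\<exists>F\<in>elems (dual_space X). \<forall>k. F (e k) = c k" if c: "summable (\<lambda>k. 1 / wt k * (c k)\<^sup>2)" for c
  proof
    define F where "F v = (\<Sum>k. c k * coef k v)" for v
    have c': "summable (\<lambda>k. (c k)\<^sup>2 / wt k)" using c by simp
    note cs = weighted_Cauchy_Schwarz[OF c' summable_coef]
    have s: "summable (\<lambda>k. c k * coef k v)" if "v \<in> elems X" for v
      using summable_rabs_cancel[OF cs(1)[OF that]] .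
    have "F (\<lambda>x. a * v x + b * w x) = a * F v + b * F w" if v: "v \<in> elems X" and w: "w \<in> elems X" for v w a b
    proof -
      have "F (\<lambda>x. a * v x + b * w x) = (\<Sum>k. a * (c k * coef k v) + b * (c k * coef k w))"
        unfolding F_def coef_lincomb[OF v w] by (simp add: algebra_simps)
      also have "\<dots> = a * F v + b * F w"
        unfolding F_def suminf_mult[OF s[OF v], symmetric] suminf_mult[OF s[OF w], symmetric]
        by (intro suminf_add[symmetric] summable_mult s v w)
      finally show ?thesis .
    qed
    moreover have "\<bar>F v\<bar> \<le> sqrt (\<Sum>k. (c k)\<^sup>2 / wt k) * nrm X v" if v: "v \<in> elems X" for v
      using summable_rabs[OF cs(1)[OF v]] cs(2)[OF v] by (simp add: F_def nrm_eq[OF v])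
    ultimately show "F \<in> elems (dual_space X)" unfolding dual_elems_iff by blast
    show "\<forall>k. F (e k) = c k"
    proof
      fix k
      have "(\<lambda>j. c j * coef j (e k)) sums (\<Sum>j\<in>{k}. c j * coef j (e k))"
        by (rule sums_finite) (auto simp: coef_basis)
      then show "F (e k) = c k" by (simp add: F_def sums_iff coef_basis)
    qed
  qed
qed

end

lemma L2_coord_space:
  assumes S: "S \<in> lmeasurable" and onb: "orthonormal_basis S \<phi>"
  shows "coord_space (L2_space S) (\<lambda>k w. L2_inner S w (\<phi> k)) (\<lambda>_. 1) \<phi>"
proof -
  interpret orthonormal_system S \<phi> using onb by (rule orthonormal_basis_system)
  show ?thesis
  proof
    show "(\<lambda>x. a * v x + b * w x) \<in> elems (L2_space S)"
      if "v \<in> elems (L2_space S)" "w \<in> elems (L2_space S)" for v w a b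
      using that by (rule L2_lincomb)
    show "L2_inner S (\<lambda>x. a * v x + b * w x) (\<phi> k) = a * L2_inner S v (\<phi> k) + b * L2_inner S w (\<phi> k)"
      if "v \<in> elems (L2_space S)" "w \<in> elems (L2_space S)" for v w k a b
      using that elem by (rule L2_inner_lincomb_left)
    fix v assume v: "v \<in> elems (L2_space S)"
    note P = Parseval[OF onb v]
    show "summable (\<lambda>k. 1 * (L2_inner S v (\<phi> k))\<^sup>2)" using P by (simp add: sums_iff)
    show "nrm (L2_space S) v = sqrt (\<Sum>k. 1 * (L2_inner S v (\<phi> k))\<^sup>2)"
      using P L2_nrm_nonneg[of S v] by (simp add: sums_iff)
  next
    show "\<exists>v\<in>elems (L2_space S). \<forall>k. L2_inner S v (\<phi> k) = c k" if "summable (\<lambda>k. 1 * (c k)\<^sup>2)" for c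
      using Riesz_Fischer[OF S, of c] that by auto
  qed (simp_all add: elem orthonormal)
qed

lemma spectral_elems_iff:
  "w \<in> elems (spectral_space S lam \<phi> r) \<longleftrightarrow> w \<in> elems (L2_space S) \<and>
    summable (\<lambda>k. lam k powr r * (L2_inner S w (\<phi> k))\<^sup>2)"
  by (simp add: spectral_space_def)

text \<open>
  The lower bound on the eigenvalues enters through completeness: a sequence that is square summable with
  the weights \<open>lam k powr r\<close> must be square summable to be the coefficient sequence of an \<open>L2\<close> function.
\<close>

lemma spectral_coord_space:
  assumes L2: "coord_space (L2_space S) (\<lambda>k w. L2_inner S w (\<phi> k)) (\<lambda>_. 1) \<phi>"
    and \<mu>: "0 < \<mu>" "\<And>k. \<mu> \<le> lam k" and r: "0 \<le> r"
  shows "coord_space (spectral_space S lam \<phi> r) (\<lambda>k w. L2_inner S w (\<phi> k)) (\<lambda>k. lam k powr r) \<phi>"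
proof -
  interpret L2: coord_space "L2_space S" "\<lambda>k w. L2_inner S w (\<phi> k)" "\<lambda>_. 1" \<phi> by (rule L2)
  have pos: "0 < lam k powr r" for k using \<mu>(1) \<mu>(2)[of k] by simp
  show ?thesis
  proof
    show "0 < lam k powr r" for k by (rule pos)
    fix v w a b assume "v \<in> elems (spectral_space S lam \<phi> r)" "w \<in> elems (spectral_space S lam \<phi> r)"
    then have v: "v \<in> elems (L2_space S)" "summable (\<lambda>k. lam k powr r * (L2_inner S v (\<phi> k))\<^sup>2)"
      and w: "w \<in> elems (L2_space S)" "summable (\<lambda>k. lam k powr r * (L2_inner S w (\<phi> k))\<^sup>2)"
      by (simp_all add: spectral_elems_iff)
    show lin: "L2_inner S (\<lambda>x. a * v x + b * w x) (\<phi> k) = a * L2_inner S v (\<phi> k) + b * L2_inner S w (\<phi> k)" for k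
      by (rule L2.coef_lincomb[OF v(1) w(1)])
    have "summable (\<lambda>k. lam k powr r * (a * L2_inner S v (\<phi> k) + b * L2_inner S w (\<phi> k))\<^sup>2)"
    proof (rule summable_comparison_test'[where N = 0])
      show "summable (\<lambda>k. 2 * a\<^sup>2 * (lam k powr r * (L2_inner S v (\<phi> k))\<^sup>2) + 2 * b\<^sup>2 * (lam k powr r * (L2_inner S w (\<phi> k))\<^sup>2))"
        by (intro summable_add summable_mult v w)
      fix k
      have "(x + y)\<^sup>2 \<le> 2 * x\<^sup>2 + 2 * y\<^sup>2" for x y :: real
        using zero_le_power2[of "x - y"] by (simp add: power2_eq_square algebra_simps)
      from mult_left_mono[OF this, of "lam k powr r" "a * L2_inner S v (\<phi> k)" "b * L2_inner S w (\<phi> k)"]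
      show "norm (lam k powr r * (a * L2_inner S v (\<phi> k) + b * L2_inner S w (\<phi> k))\<^sup>2) \<le>
          2 * a\<^sup>2 * (lam k powr r * (L2_inner S v (\<phi> k))\<^sup>2) + 2 * b\<^sup>2 * (lam k powr r * (L2_inner S w (\<phi> k))\<^sup>2)"
        by (simp add: abs_mult power_mult_distrib algebra_simps)
    qed
    then show "(\<lambda>x. a * v x + b * w x) \<in> elems (spectral_space S lam \<phi> r)"
      using L2.lincomb[OF v(1) w(1)] by (simp add: spectral_elems_iff lin)
  next
    fix v assume v: "v \<in> elems (spectral_space S lam \<phi> r)"
    then show "summable (\<lambda>k. lam k powr r * (L2_inner S v (\<phi> k))\<^sup>2)" by (simp add: spectral_elems_iff)
    show "nrm (spectral_space S lam \<phi> r) v = sqrt (\<Sum>k. lam k powr r * (L2_inner S v (\<phi> k))\<^sup>2)"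
      by (simp add: spectral_space_def)
  next
    fix k
    have "(\<lambda>j. lam j powr r * (L2_inner S (\<phi> k) (\<phi> j))\<^sup>2) sums (\<Sum>j\<in>{k}. lam j powr r * (L2_inner S (\<phi> k) (\<phi> j))\<^sup>2)"
      by (rule sums_finite) (simp_all add: L2.coef_basis)
    then show "\<phi> k \<in> elems (spectral_space S lam \<phi> r)"
      by (simp add: spectral_elems_iff L2.basis_elem sums_iff)
    show "L2_inner S (\<phi> k) (\<phi> j) = (if j = k then 1 else 0)" for j by (rule L2.coef_basis)
  next
    fix c assume c: "summable (\<lambda>k. lam k powr r * (c k)\<^sup>2)"
    have "summable (\<lambda>k. 1 * (c k)\<^sup>2)"
    proof (rule summable_comparison_test'[where N = 0])
      show "summable (\<lambda>k. 1 / \<mu> powr r * (lam k powr r * (c k)\<^sup>2))" by (rule summable_mult[OF c])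
      fix k
      have "\<mu> powr r \<le> lam k powr r" using \<mu>(1) \<mu>(2)[of k] r by (intro powr_mono2) auto
      then have "\<mu> powr r * (c k)\<^sup>2 \<le> lam k powr r * (c k)\<^sup>2" by (intro mult_right_mono) auto
      then show "norm (1 * (c k)\<^sup>2) \<le> 1 / \<mu> powr r * (lam k powr r * (c k)\<^sup>2)"
        using \<mu>(1) by (simp add: field_simps)
    qed
    from L2.complete[OF this] obtain v where "v \<in> elems (L2_space S)" "\<forall>k. L2_inner S v (\<phi> k) = c k" by blast
    then show "\<exists>v\<in>elems (spectral_space S lam \<phi> r). \<forall>k. L2_inner S v (\<phi> k) = c k"
      using c by (intro bexI[of _ v]) (simp_all add: spectral_elems_iff)
  qed
qed

section \<open>Bochner spaces in coordinates\<close>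

lemma finite_measure_time: "finite_measure (time_measure T)"
  by (rule finite_measure_lebesgue_on) simp

text \<open>
  The measure is complete. This allows properties that hold for almost every time only, such as
  membership in a function space, in measurability proofs.
\<close>

lemma time_measure_measurable_AE:
  fixes f g :: "real \<Rightarrow> real"
  assumes f: "f \<in> borel_measurable (time_measure T)" and ae: "AE t in time_measure T. f t = g t"
  shows "g \<in> borel_measurable (time_measure T)"
proof -
  have I: "{0<..<T} \<inter> space lebesgue \<in> sets lebesgue" by simp
  have "(\<lambda>t. indicator {0<..<T} t *\<^sub>R f t) \<in> borel_measurable lebesgue"
    using f unfolding borel_measurable_restrict_space_iff[OF I] .
  moreover have "AE t in lebesgue. indicator {0<..<T} t *\<^sub>R f t = indicator {0<..<T} t *\<^sub>R g t"
    using ae unfolding AE_time_measure_iff by eventually_elim (auto simp: indicator_def)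
  ultimately have "(\<lambda>t. indicator {0<..<T} t *\<^sub>R g t) \<in> borel_measurable lebesgue"
    by (rule borel_measurable_AE)
  then show ?thesis unfolding borel_measurable_restrict_space_iff[OF I] .
qed

lemma time_measure_square_integrable:
  fixes f :: "real \<Rightarrow> real"
  assumes "f \<in> borel_measurable (time_measure T)" "integrable (time_measure T) (\<lambda>t. (f t)\<^sup>2)"
  shows "integrable (time_measure T) f"
  using finite_measure.square_integrable_imp_integrable[OF finite_measure_time assms] .

lemma time_measure_Jensen:
  fixes f :: "real \<Rightarrow> real"
  assumes f: "f \<in> borel_measurable (time_measure T)" "integrable (time_measure T) (\<lambda>t. (f t)\<^sup>2)" and T: "0 \<le> T"
  shows "(\<integral>t. f t \<partial>time_measure T)\<^sup>2 \<le> T * (\<integral>t. (f t)\<^sup>2 \<partial>time_measure T)"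
proof -
  let ?S = "{0<..<T}"
  have one: "(\<lambda>_. 1) \<in> elems (L2_space ?S)"
    using finite_measure.integrable_const[OF finite_measure_time] by (simp add: L2_elems_iff)
  have fe: "f \<in> elems (L2_space ?S)" using f by (simp add: L2_elems_iff)
  have "\<bar>L2_inner ?S f (\<lambda>_. 1)\<bar>\<^sup>2 \<le> (nrm (L2_space ?S) f * nrm (L2_space ?S) (\<lambda>_. 1))\<^sup>2"
    by (intro power_mono L2_Cauchy_Schwarz fe one) simp
  moreover have "(nrm (L2_space ?S) (\<lambda>_. 1))\<^sup>2 = T"
    unfolding L2_nrm_square L2_inner_def using T by (simp add: measure_restrict_space)
  moreover have "(nrm (L2_space ?S) f)\<^sup>2 = (\<integral>t. (f t)\<^sup>2 \<partial>time_measure T)"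
    unfolding L2_nrm_square L2_inner_def by (simp add: power2_eq_square)
  ultimately show ?thesis by (simp add: power_mult_distrib L2_inner_def mult.commute)
qed

lemma suminf_tendsto_zero_dominated:
  fixes a :: "nat \<Rightarrow> 'b \<Rightarrow> real"
  assumes lim: "\<And>k. (a k \<longlongrightarrow> 0) F" and bound: "\<forall>\<^sub>F n in F. \<forall>k. \<bar>a k n\<bar> \<le> M k" and M: "summable M"
  shows "((\<lambda>n. \<Sum>k. a k n) \<longlongrightarrow> 0) F"
proof (cases "F = bot")
  case False
  have "\<forall>\<^sub>F (k, n) in at_top \<times>\<^sub>F F. norm (a k n) \<le> M k"
    unfolding eventually_prod_filter
    by (rule exI[of _ "\<lambda>_. True"], rule exI[of _ "\<lambda>n. \<forall>k. \<bar>a k n\<bar> \<le> M k"]) (use bound in simp)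
  from tannerys_theorem[where a = a and b = "\<lambda>_. 0", OF lim this M False]
  show ?thesis by simp
qed simp

lemma simple_in_imp_simple_function:
  assumes "simple_in T X S"
  shows "simple_function (time_measure T) S"
proof -
  have "S -` {y} \<inter> {0<..<T} = {t \<in> {0<..<T}. S t = y}" for y by auto
  then show ?thesis using assms by (simp add: simple_in_def simple_function_def)
qed

lemma simple_inI:
  assumes "simple_function (time_measure T) S" "\<And>t. t \<in> {0<..<T} \<Longrightarrow> S t \<in> elems X"
  shows "simple_in T X S"
proof -
  have *: "{t \<in> {0<..<T}. S t = y} = S -` {y} \<inter> space (time_measure T)" for y by auto
  have "S -` {y} \<inter> space (time_measure T) \<in> sets (time_measure T)" for y
    using simple_functionD(2)[OF assms(1), of "{y}"] .
  then show ?thesis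
    using assms unfolding simple_in_def * by (auto simp: simple_function_def)
qed

lemma integral_simple_in:
  assumes S: "simple_in T X S"
  shows "integrable (time_measure T) (\<lambda>t. h (S t) :: real)"
    "(\<integral>t. h (S t) \<partial>time_measure T) =
      (\<Sum>y\<in>S ` {0<..<T}. measure (time_measure T) {t \<in> {0<..<T}. S t = y} * h y)"
proof -
  let ?M = "time_measure T"
  interpret finite_measure ?M by (rule finite_measure_time)
  have fin: "finite (S ` {0<..<T})" and sets: "{t \<in> {0<..<T}. S t = y} \<in> sets ?M" for y
    using S by (auto simp: simple_in_def)
  define g where "g t = (\<Sum>y\<in>S ` {0<..<T}. indicator {t \<in> {0<..<T}. S t = y} t * h y)" for t
  have eq: "h (S t) = g t" if "t \<in> space ?M" for t
  proof -
    have "g t = (\<Sum>y\<in>S ` {0<..<T}. if y = S t then h y else 0)"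
      unfolding g_def using that by (intro sum.cong) (auto simp: indicator_def)
    then show ?thesis using fin that by simp
  qed
  have ind: "integrable ?M (indicator {t \<in> {0<..<T}. S t = y} :: real \<Rightarrow> real)" for y
    using sets by (simp add: less_top[symmetric])
  have g: "integrable ?M g"
    unfolding g_def by (intro Bochner_Integration.integrable_sum integrable_mult_left ind)
  show "integrable ?M (\<lambda>t. h (S t))"
    using g eq by (subst Bochner_Integration.integrable_cong[OF refl]) auto
  have "(\<integral>t. h (S t) \<partial>?M) = (\<integral>t. g t \<partial>?M)"
    by (intro Bochner_Integration.integral_cong eq refl)
  also have "\<dots> = (\<Sum>y\<in>S ` {0<..<T}. measure ?M {t \<in> {0<..<T}. S t = y} * h y)"
    unfolding g_def
  proof (subst Bochner_Integration.integral_sum)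
    show "integrable ?M (\<lambda>t. indicator {t \<in> {0<..<T}. S t = y} t * h y)" for y
      by (intro integrable_mult_left ind)
    have "{t \<in> {0<..<T}. S t = y} \<inter> space ?M = {t \<in> {0<..<T}. S t = y}" for y by auto
    then have "(\<integral>t. indicator {t \<in> {0<..<T}. S t = y} t * h y \<partial>?M) =
        measure ?M {t \<in> {0<..<T}. S t = y} * h y" for y
      by (simp only: integral_mult_left_zero Bochner_Integration.integral_indicator)
    then show "(\<Sum>y\<in>S ` {0<..<T}. \<integral>t. indicator {t \<in> {0<..<T}. S t = y} t * h y \<partial>?M) =
        (\<Sum>y\<in>S ` {0<..<T}. measure ?M {t \<in> {0<..<T}. S t = y} * h y)"
      by (intro sum.cong refl)
  qed
  finally show "(\<integral>t. h (S t) \<partial>?M) =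
      (\<Sum>y\<in>S ` {0<..<T}. measure ?M {t \<in> {0<..<T}. S t = y} * h y)" .
qed

context coord_space
begin

lemma simple_integral_elem:
  assumes S: "simple_in T X S"
  shows "simple_integral_in T S \<in> elems X"
    "coef k (simple_integral_in T S) = (\<integral>t. coef k (S t) \<partial>time_measure T)"
proof -
  have fin: "finite (S ` {0<..<T})" and sub: "\<And>y. y \<in> S ` {0<..<T} \<Longrightarrow> y \<in> elems X"
    using S by (auto simp: simple_in_def)
  show "simple_integral_in T S \<in> elems X"
    unfolding simple_integral_in_def by (rule sum_elem(1)[OF fin sub])
  show "coef k (simple_integral_in T S) = (\<integral>t. coef k (S t) \<partial>time_measure T)"
    unfolding simple_integral_in_def integral_simple_in(2)[OF S] by (rule sum_elem(2)[OF fin sub])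
qed

lemma measurable_coef:
  assumes "strongly_measurable T X u"
  shows "(\<lambda>t. coef k (u t)) \<in> borel_measurable (time_measure T)"
proof -
  let ?M = "time_measure T"
  obtain S where u: "AE t in ?M. u t \<in> elems X" and S: "\<And>n::nat. simple_in T X (S n)"
    and lim: "AE t in ?M. (\<lambda>n. nrm X (\<lambda>x. u t x - S n t x)) \<longlonglongrightarrow> 0"
    using assms unfolding strongly_measurable_def by blast
  have [measurable]: "(\<lambda>t. coef k (S n t)) \<in> borel_measurable ?M" for n
    using borel_measurable_simple_function[OF simple_function_compose1[OF simple_in_imp_simple_function[OF S]]] .
  have "(\<lambda>t. lim (\<lambda>n. coef k (S n t))) \<in> borel_measurable ?M" by measurable
  moreover have "AE t in ?M. t \<in> {0<..<T}" by (rule AE_I2) simp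
  then have "AE t in ?M. lim (\<lambda>n. coef k (S n t)) = coef k (u t)"
    using u lim
  proof eventually_elim
    case (elim t)
    then have St: "S n t \<in> elems X" for n using S[of n] by (auto simp: simple_in_def)
    have "(\<lambda>n. coef k (S n t) - coef k (u t)) \<longlonglongrightarrow> 0"
    proof (rule Lim_null_comparison)
      show "\<forall>\<^sub>F n in sequentially. norm (coef k (S n t) - coef k (u t))
          \<le> nrm X (\<lambda>x. u t x - S n t x) / sqrt (wt k)"
        using coef_le[OF diff_elem[OF elim(2) St], of k] coef_diff[OF elim(2) St, of k] by (simp add: abs_minus_commute)
      show "(\<lambda>n. nrm X (\<lambda>x. u t x - S n t x) / sqrt (wt k)) \<longlonglongrightarrow> 0"
        using elim(3) by (rule tendsto_divide_zero)
    qed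
    then have "(\<lambda>n. coef k (S n t)) \<longlonglongrightarrow> coef k (u t)" by (rule LIM_zero_cancel)
    then show ?case by (rule limI)
  qed
  ultimately show ?thesis by (rule time_measure_measurable_AE)
qed

lemma measurable_nrm:
  assumes "AE t in time_measure T. u t \<in> elems X"
    and [measurable]: "\<And>k. (\<lambda>t. coef k (u t)) \<in> borel_measurable (time_measure T)"
  shows "(\<lambda>t. nrm X (u t)) \<in> borel_measurable (time_measure T)"
proof (rule time_measure_measurable_AE)
  show "(\<lambda>t. sqrt (\<Sum>k. wt k * (coef k (u t))\<^sup>2)) \<in> borel_measurable (time_measure T)" by measurable
  show "AE t in time_measure T. sqrt (\<Sum>k. wt k * (coef k (u t))\<^sup>2) = nrm X (u t)"
    using assms(1) by eventually_elim (simp add: nrm_eq)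
qed

text \<open>
  Each coordinate of \<open>u\<close> is a pointwise limit of simple functions bounded by twice its modulus; truncating
  to the first \<open>n\<close> coordinates gives simple functions with values in the space. The error is at most
  \<open>1 + 2 = 3\<close> times the coordinate in each coordinate, so the series of weighted squares converges to 0 by
  dominated convergence.
\<close>

lemma simple_approximation:
  assumes u: "AE t in time_measure T. u t \<in> elems X"
    and meas: "\<And>k. (\<lambda>t. coef k (u t)) \<in> borel_measurable (time_measure T)"
  obtains S where "\<forall>n::nat. simple_in T X (S n)"
    "AE t in time_measure T. (\<lambda>n. nrm X (\<lambda>x. u t x - S n t x)) \<longlonglongrightarrow> 0"
    "\<forall>n. AE t in time_measure T. nrm X (\<lambda>x. u t x - S n t x) \<le> 3 * nrm X (u t)"
proof -
  let ?M = "time_measure T"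
  have "\<forall>k. \<exists>F. (\<forall>n. simple_function ?M (F n)) \<and> (\<forall>t\<in>space ?M. (\<lambda>n. F n t) \<longlonglongrightarrow> coef k (u t)) \<and>
      (\<forall>n. \<forall>t\<in>space ?M. dist (F n t) 0 \<le> 2 * dist (coef k (u t)) 0)"
    by (rule allI, rule borel_measurable_implies_sequence_metric[OF meas])
  from choice[OF this] obtain F where Fall: "\<forall>k. (\<forall>n. simple_function ?M (F k n)) \<and>
      (\<forall>t\<in>space ?M. (\<lambda>n. F k n t) \<longlonglongrightarrow> coef k (u t)) \<and>
      (\<forall>n. \<forall>t\<in>space ?M. dist (F k n t) 0 \<le> 2 * dist (coef k (u t)) 0)" ..
  note F = Fall[THEN spec, THEN conjunct1, THEN spec]
    Fall[THEN spec, THEN conjunct2, THEN conjunct1, THEN bspec]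
    Fall[THEN spec, THEN conjunct2, THEN conjunct2, THEN spec, THEN bspec, unfolded dist_real_def diff_zero]
  define S where "S n t = (\<lambda>x. \<Sum>i<n. F i n t * e i x)" for n t
  have simple: "simple_function ?M (\<lambda>t x. \<Sum>i<m. F i n t * e i x)" for m n
  proof (induction m)
    case (Suc m)
    show ?case
      using simple_function_compose2[OF Suc F(1)[of m n], of "\<lambda>G r x. G x + r * e m x"] by simp
  qed simp
  have S: "simple_in T X (S n)" for n
    unfolding S_def[abs_def] by (rule simple_inI[OF simple comb_elem])
  have step: "nrm X (\<lambda>x. u t x - S n t x) \<le> 3 * nrm X (u t) \<and> (\<lambda>n. nrm X (\<lambda>x. u t x - S n t x)) \<longlonglongrightarrow> 0"
    if ut: "u t \<in> elems X" and t: "t \<in> space ?M" for n t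
  proof -
    let ?D = "\<lambda>n x. u t x - S n t x"
    have D: "?D n \<in> elems X" "coef k (?D n) = coef k (u t) - (if k < n then F k n t else 0)" for n k
      unfolding S_def by (rule diff_elem[OF ut comb_elem], simp only: coef_diff[OF ut comb_elem] coef_comb)
    have sq: "(nrm X (?D n))\<^sup>2 = (\<Sum>k. wt k * (coef k (?D n))\<^sup>2)" for n
      using nrm_square[OF D(1)] .
    have le: "wt k * (coef k (?D n))\<^sup>2 \<le> 9 * (wt k * (coef k (u t))\<^sup>2)" for n k
    proof -
      have "\<bar>coef k (?D n)\<bar> \<le> 3 * \<bar>coef k (u t)\<bar>"
        using F(3)[OF t, of k n] by (auto simp: D(2))
      then have "\<bar>coef k (?D n)\<bar>\<^sup>2 \<le> (3 * \<bar>coef k (u t)\<bar>)\<^sup>2" by (intro power_mono) auto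
      then have "wt k * (coef k (?D n))\<^sup>2 \<le> wt k * (9 * (coef k (u t))\<^sup>2)"
        using wt_nonneg by (intro mult_left_mono) (simp_all add: power_mult_distrib)
      then show ?thesis by simp
    qed
    have "(nrm X (?D n))\<^sup>2 \<le> (\<Sum>k. 9 * (wt k * (coef k (u t))\<^sup>2))"
      unfolding sq by (intro suminf_le le summable_coef D(1) summable_mult ut)
    also have "\<dots> = (3 * nrm X (u t))\<^sup>2"
      by (simp add: suminf_mult summable_coef ut nrm_square power_mult_distrib)
    finally have 1: "nrm X (?D n) \<le> 3 * nrm X (u t)"
      by (rule power2_le_imp_le) (use nrm_nonneg[OF ut] in simp)
    have "(\<lambda>n. \<Sum>k. wt k * (coef k (?D n))\<^sup>2) \<longlonglongrightarrow> 0"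
    proof (rule suminf_tendsto_zero_dominated[where a = "\<lambda>k n. wt k * (coef k (?D n))\<^sup>2"
          and M = "\<lambda>k. 9 * (wt k * (coef k (u t))\<^sup>2)"])
      fix k
      have "(\<lambda>n. wt k * (coef k (u t) - F k n t)\<^sup>2) \<longlonglongrightarrow> wt k * (coef k (u t) - coef k (u t))\<^sup>2"
        by (rule tendsto_mult_left, rule tendsto_power, rule tendsto_diff[OF tendsto_const F(2)[OF t]])
      then have "(\<lambda>n. wt k * (coef k (u t) - F k n t)\<^sup>2) \<longlonglongrightarrow> 0" by simp
      moreover have "\<forall>\<^sub>F n in sequentially. wt k * (coef k (u t) - F k n t)\<^sup>2 = wt k * (coef k (?D n))\<^sup>2"
        using eventually_gt_at_top[of k] by eventually_elim (simp add: D(2))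
      ultimately show "(\<lambda>n. wt k * (coef k (?D n))\<^sup>2) \<longlonglongrightarrow> 0" by (rule Lim_transform_eventually)
    next
      have "\<bar>wt k * (coef k (?D n))\<^sup>2\<bar> \<le> 9 * (wt k * (coef k (u t))\<^sup>2)" for n k
        using le[of k n] term_nonneg[of k] by (simp only: abs_of_nonneg)
      then show "\<forall>\<^sub>F n in sequentially. \<forall>k. \<bar>wt k * (coef k (?D n))\<^sup>2\<bar> \<le> 9 * (wt k * (coef k (u t))\<^sup>2)"
        by (intro always_eventually allI)
      show "summable (\<lambda>k. 9 * (wt k * (coef k (u t))\<^sup>2))" by (intro summable_mult summable_coef ut)
    qed
    then have "(\<lambda>n. (nrm X (?D n))\<^sup>2) \<longlonglongrightarrow> 0" by (simp add: sq)
    then have "(\<lambda>n. sqrt ((nrm X (?D n))\<^sup>2)) \<longlonglongrightarrow> sqrt 0" by (rule tendsto_real_sqrt)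
    then have "(\<lambda>n. nrm X (?D n)) \<longlonglongrightarrow> 0" using nrm_nonneg[OF D(1)] by simp
    with 1 show ?thesis by blast
  qed
  have "AE t in ?M. t \<in> space ?M" by (rule AE_I2)
  with u have ae: "AE t in ?M. u t \<in> elems X \<and> t \<in> space ?M" by (rule AE_conjI)
  show ?thesis
  proof (rule that)
    show "\<forall>n. simple_in T X (S n)" using S ..
    show "AE t in ?M. (\<lambda>n. nrm X (\<lambda>x. u t x - S n t x)) \<longlonglongrightarrow> 0"
      using ae by eventually_elim (elim conjE, rule step[THEN conjunct2])
    show "\<forall>n. AE t in ?M. nrm X (\<lambda>x. u t x - S n t x) \<le> 3 * nrm X (u t)"
    proof
      fix n
      show "AE t in ?M. nrm X (\<lambda>x. u t x - S n t x) \<le> 3 * nrm X (u t)"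
        using ae by eventually_elim (elim conjE, rule step[THEN conjunct1])
    qed
  qed
qed

lemma bochner_L2_iff:
  "u \<in> bochner_L2 T X \<longleftrightarrow> (AE t in time_measure T. u t \<in> elems X) \<and>
    (\<forall>k. (\<lambda>t. coef k (u t)) \<in> borel_measurable (time_measure T)) \<and>
    integrable (time_measure T) (\<lambda>t. (nrm X (u t))\<^sup>2)" (is "_ = (?ae \<and> ?meas \<and> ?int)")
proof -
  have "strongly_measurable T X u \<longleftrightarrow> ?ae \<and> ?meas"
  proof
    assume "strongly_measurable T X u"
    then show "?ae \<and> ?meas" using measurable_coef unfolding strongly_measurable_def by blast
  next
    assume *: "?ae \<and> ?meas"
    then have ae: ?ae and meas: "(\<lambda>t. coef k (u t)) \<in> borel_measurable (time_measure T)" for k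
      by simp_all
    obtain S where "\<forall>n::nat. simple_in T X (S n)"
      "AE t in time_measure T. (\<lambda>n. nrm X (\<lambda>x. u t x - S n t x)) \<longlonglongrightarrow> 0"
      "\<forall>n. AE t in time_measure T. nrm X (\<lambda>x. u t x - S n t x) \<le> 3 * nrm X (u t)"
      by (rule simple_approximation[OF ae meas])
    with * show "strongly_measurable T X u" unfolding strongly_measurable_def by blast
  qed
  then show ?thesis by (simp add: bochner_L2_def)
qed

lemma bochner_L2D:
  assumes "u \<in> bochner_L2 T X"
  shows "AE t in time_measure T. u t \<in> elems X"
    "(\<lambda>t. coef k (u t)) \<in> borel_measurable (time_measure T)"
    "integrable (time_measure T) (\<lambda>t. (nrm X (u t))\<^sup>2)"
    "integrable (time_measure T) (\<lambda>t. (coef k (u t))\<^sup>2)"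
    "integrable (time_measure T) (\<lambda>t. coef k (u t))"
    "(\<lambda>t. nrm X (u t)) \<in> borel_measurable (time_measure T)"
    "integrable (time_measure T) (\<lambda>t. nrm X (u t))"
proof -
  let ?M = "time_measure T"
  show ae: "AE t in ?M. u t \<in> elems X" and meas: "(\<lambda>t. coef k (u t)) \<in> borel_measurable ?M"
    and int: "integrable ?M (\<lambda>t. (nrm X (u t))\<^sup>2)" for k
    using assms unfolding bochner_L2_iff by blast+
  show sq: "integrable ?M (\<lambda>t. (coef k (u t))\<^sup>2)"
  proof (rule Bochner_Integration.integrable_bound)
    show "integrable ?M (\<lambda>t. (nrm X (u t))\<^sup>2 / wt k)" using int by simp
    show "(\<lambda>t. (coef k (u t))\<^sup>2) \<in> borel_measurable ?M" using meas[of k] by measurable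
    show "AE t in ?M. norm ((coef k (u t))\<^sup>2) \<le> norm ((nrm X (u t))\<^sup>2 / wt k)"
      using ae
    proof eventually_elim
      case (elim t)
      then show ?case using coef_square_le[OF elim, of k] wt_pos[of k] by (simp add: field_simps)
    qed
  qed
  show "integrable ?M (\<lambda>t. coef k (u t))" by (rule time_measure_square_integrable[OF meas sq])
  show nm: "(\<lambda>t. nrm X (u t)) \<in> borel_measurable ?M" by (rule measurable_nrm[OF ae meas])
  show "integrable ?M (\<lambda>t. nrm X (u t))" by (rule time_measure_square_integrable[OF nm int])
qed

text \<open>
  Monotone convergence for the partial sums of the square norm.
\<close>

lemma bochner_L2_norm_sums:
  assumes u: "u \<in> bochner_L2 T X"
  shows "(\<lambda>k. wt k * (\<integral>t. (coef k (u t))\<^sup>2 \<partial>time_measure T)) sums (\<integral>t. (nrm X (u t))\<^sup>2 \<partial>time_measure T)"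
proof -
  let ?M = "time_measure T"
  note U = bochner_L2D[OF u]
  have int: "integrable ?M (\<lambda>t. wt k * (coef k (u t))\<^sup>2)" for k using U(4) by simp
  have "(\<Sum>k<n. \<integral>t. norm (wt k * (coef k (u t))\<^sup>2) \<partial>?M) \<le> (\<integral>t. (nrm X (u t))\<^sup>2 \<partial>?M)" for n
  proof -
    have "(\<Sum>k<n. \<integral>t. norm (wt k * (coef k (u t))\<^sup>2) \<partial>?M) = (\<integral>t. (\<Sum>k<n. wt k * (coef k (u t))\<^sup>2) \<partial>?M)"
      using int by (subst Bochner_Integration.integral_sum) (auto simp: wt_nonneg abs_mult)
    also have "\<dots> \<le> (\<integral>t. (nrm X (u t))\<^sup>2 \<partial>?M)"
    proof (rule integral_mono_AE[OF _ U(3)])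
      show "integrable ?M (\<lambda>t. \<Sum>k<n. wt k * (coef k (u t))\<^sup>2)" using int by (rule Bochner_Integration.integrable_sum)
      show "AE t in ?M. (\<Sum>k<n. wt k * (coef k (u t))\<^sup>2) \<le> (nrm X (u t))\<^sup>2"
        using U(1)
      proof eventually_elim
        case (elim t)
        show ?case unfolding nrm_square[OF elim]
          by (intro sum_le_suminf summable_coef elim) (auto simp: term_nonneg)
      qed
    qed
    finally show ?thesis .
  qed
  then have "summable (\<lambda>k. \<integral>t. norm (wt k * (coef k (u t))\<^sup>2) \<partial>?M)"
    by (intro summableI_nonneg_bounded) auto
  moreover have "AE t in ?M. summable (\<lambda>k. norm (wt k * (coef k (u t))\<^sup>2))"
    using U(1) by eventually_elim (use summable_coef in \<open>simp add: abs_mult wt_nonneg\<close>)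
  ultimately have "(\<lambda>k. \<integral>t. wt k * (coef k (u t))\<^sup>2 \<partial>?M) sums (\<integral>t. (\<Sum>k. wt k * (coef k (u t))\<^sup>2) \<partial>?M)"
    using int by (intro sums_integral)
  moreover have "(\<integral>t. (\<Sum>k. wt k * (coef k (u t))\<^sup>2) \<partial>?M) = (\<integral>t. (nrm X (u t))\<^sup>2 \<partial>?M)"
  proof (rule integral_cong_AE)
    show "(\<lambda>t. \<Sum>k. wt k * (coef k (u t))\<^sup>2) \<in> borel_measurable ?M"
      using U(2) by measurable
    show "(\<lambda>t. (nrm X (u t))\<^sup>2) \<in> borel_measurable ?M" using U(6) by measurable
    show "AE t in ?M. (\<Sum>k. wt k * (coef k (u t))\<^sup>2) = (nrm X (u t))\<^sup>2"
      using U(1) by eventually_elim (simp add: nrm_square)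
  qed
  ultimately show ?thesis by simp
qed

lemma bochner_L2_simple:
  assumes S: "simple_in T X S"
  shows "S \<in> bochner_L2 T X"
proof -
  have sub: "S t \<in> elems X" if "t \<in> {0<..<T}" for t using S that by (auto simp: simple_in_def)
  have "AE t in time_measure T. S t \<in> elems X" by (rule AE_I2) (use sub in simp)
  moreover have "(\<lambda>t. coef k (S t)) \<in> borel_measurable (time_measure T)" for k
    by (rule borel_measurable_integrable[OF integral_simple_in(1)[OF S]])
  moreover have "integrable (time_measure T) (\<lambda>t. (nrm X (S t))\<^sup>2)"
    by (rule integral_simple_in(1)[OF S])
  ultimately show ?thesis unfolding bochner_L2_iff by blast
qed

lemma bochner_L2_diff:
  assumes u: "u \<in> bochner_L2 T X" and v: "v \<in> bochner_L2 T X"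
  shows "(\<lambda>t x. u t x - v t x) \<in> bochner_L2 T X"
proof -
  let ?M = "time_measure T" and ?w = "\<lambda>t x. u t x - v t x"
  note U = bochner_L2D[OF u] and V = bochner_L2D[OF v]
  have ae: "AE t in ?M. u t \<in> elems X \<and> v t \<in> elems X" by (rule AE_conjI[OF U(1) V(1)])
  then have w: "AE t in ?M. ?w t \<in> elems X" by eventually_elim (blast intro: diff_elem)
  have meas: "(\<lambda>t. coef k (?w t)) \<in> borel_measurable ?M" for k
  proof (rule time_measure_measurable_AE)
    show "(\<lambda>t. coef k (u t) - coef k (v t)) \<in> borel_measurable ?M"
      by (rule borel_measurable_diff[OF U(2) V(2)])
    show "AE t in ?M. coef k (u t) - coef k (v t) = coef k (?w t)"
      using ae by eventually_elim (simp add: coef_diff)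
  qed
  have "integrable ?M (\<lambda>t. (nrm X (?w t))\<^sup>2)"
  proof (rule Bochner_Integration.integrable_bound)
    show "integrable ?M (\<lambda>t. 2 * (nrm X (u t))\<^sup>2 + 2 * (nrm X (v t))\<^sup>2)"
      using U(3) V(3) by simp
    show "(\<lambda>t. (nrm X (?w t))\<^sup>2) \<in> borel_measurable ?M"
      by (rule borel_measurable_power[OF measurable_nrm[OF w meas]])
    show "AE t in ?M. norm ((nrm X (?w t))\<^sup>2) \<le> norm (2 * (nrm X (u t))\<^sup>2 + 2 * (nrm X (v t))\<^sup>2)"
      using ae
    proof eventually_elim
      case (elim t)
      then have ut: "u t \<in> elems X" and vt: "v t \<in> elems X" by simp_all
      have "(nrm X (?w t))\<^sup>2 \<le> (\<Sum>k. 2 * (wt k * (coef k (u t))\<^sup>2) + 2 * (wt k * (coef k (v t))\<^sup>2))"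
        unfolding nrm_square[OF diff_elem[OF ut vt]]
      proof (rule suminf_le)
        fix k
        have "(coef k (u t) - coef k (v t))\<^sup>2 \<le> 2 * (coef k (u t))\<^sup>2 + 2 * (coef k (v t))\<^sup>2"
          using zero_le_power2[of "coef k (u t) + coef k (v t)"] by (simp add: power2_eq_square algebra_simps)
        then have "wt k * (coef k (u t) - coef k (v t))\<^sup>2 \<le> wt k * (2 * (coef k (u t))\<^sup>2 + 2 * (coef k (v t))\<^sup>2)"
          by (rule mult_left_mono[OF _ wt_nonneg])
        then show "wt k * (coef k (?w t))\<^sup>2 \<le> 2 * (wt k * (coef k (u t))\<^sup>2) + 2 * (wt k * (coef k (v t))\<^sup>2)"
          by (simp add: coef_diff[OF ut vt] algebra_simps)
      qed (intro summable_add summable_mult summable_coef diff_elem ut vt)+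
      also have "\<dots> = 2 * (nrm X (u t))\<^sup>2 + 2 * (nrm X (v t))\<^sup>2"
        unfolding nrm_square[OF ut] nrm_square[OF vt] suminf_mult[OF summable_coef[OF ut], symmetric]
          suminf_mult[OF summable_coef[OF vt], symmetric]
        by (intro suminf_add[symmetric] summable_mult summable_coef ut vt)
      finally show ?case by simp
    qed
  qed
  with w meas show ?thesis unfolding bochner_L2_iff by blast
qed

lemma bochner_L2_scale:
  assumes u: "u \<in> bochner_L2 T X" and \<psi>: "continuous_on {0..T} \<psi>"
  shows "(\<lambda>t x. \<psi> t * u t x) \<in> bochner_L2 T X"
    "AE t in time_measure T. coef k (\<lambda>x. \<psi> t * u t x) = \<psi> t * coef k (u t)"
proof -
  let ?M = "time_measure T" and ?w = "\<lambda>t x. \<psi> t * u t x"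
  note U = bochner_L2D[OF u]
  have w: "AE t in ?M. ?w t \<in> elems X" using U(1) by eventually_elim (rule scale_elem)
  have cw: "AE t in ?M. coef k (?w t) = \<psi> t * coef k (u t)" for k
    using U(1) by eventually_elim (rule coef_scale)
  then show "AE t in ?M. coef k (?w t) = \<psi> t * coef k (u t)" .
  have meas: "(\<lambda>t. coef k (?w t)) \<in> borel_measurable ?M" for k
  proof (rule time_measure_measurable_AE)
    show "(\<lambda>t. \<psi> t * coef k (u t)) \<in> borel_measurable ?M"
      using integrable_time_measure_mult[OF \<psi> U(5)] by (rule borel_measurable_integrable)
    show "AE t in ?M. \<psi> t * coef k (u t) = coef k (?w t)" using cw[of k] by eventually_elim (rule sym)
  qed
  have "integrable ?M (\<lambda>t. (nrm X (?w t))\<^sup>2)"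
  proof (rule integrable_cong_AE_imp)
    have "continuous_on {0..T} (\<lambda>t. (\<psi> t)\<^sup>2)" by (rule continuous_on_power[OF \<psi>])
    then show "integrable ?M (\<lambda>t. (\<psi> t)\<^sup>2 * (nrm X (u t))\<^sup>2)"
      by (rule integrable_time_measure_mult[OF _ U(3)])
    show "(\<lambda>t. (nrm X (?w t))\<^sup>2) \<in> borel_measurable ?M"
      by (rule borel_measurable_power[OF measurable_nrm[OF w meas]])
    show "AE t in ?M. (\<psi> t)\<^sup>2 * (nrm X (u t))\<^sup>2 = (nrm X (?w t))\<^sup>2"
      using U(1) by eventually_elim (simp add: nrm_scale power_mult_distrib)
  qed
  with w meas show "(\<lambda>t x. \<psi> t * u t x) \<in> bochner_L2 T X" unfolding bochner_L2_iff by blast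
qed

text \<open>
  Jensen's inequality in each coordinate. This is the bound of the norm of an integral in terms of the
  square norms of the integrand.
\<close>

lemma integral_coef_square_le:
  assumes u: "u \<in> bochner_L2 T X" and T: "0 \<le> T"
  shows "summable (\<lambda>k. wt k * (\<integral>t. coef k (u t) \<partial>time_measure T)\<^sup>2)"
    "(\<Sum>k. wt k * (\<integral>t. coef k (u t) \<partial>time_measure T)\<^sup>2) \<le> T * (\<integral>t. (nrm X (u t))\<^sup>2 \<partial>time_measure T)"
proof -
  let ?M = "time_measure T"
  note U = bochner_L2D[OF u] and S = bochner_L2_norm_sums[OF u]
  have le: "wt k * (\<integral>t. coef k (u t) \<partial>?M)\<^sup>2 \<le> T * (wt k * (\<integral>t. (coef k (u t))\<^sup>2 \<partial>?M))" for k
    using mult_left_mono[OF time_measure_Jensen[OF U(2)[of k] U(4)[of k] T] wt_nonneg[of k]] by (simp add: mult.left_commute)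
  have s: "summable (\<lambda>k. T * (wt k * (\<integral>t. (coef k (u t))\<^sup>2 \<partial>?M)))"
    using S by (intro summable_mult) (rule sums_summable)
  show sm: "summable (\<lambda>k. wt k * (\<integral>t. coef k (u t) \<partial>?M)\<^sup>2)"
    by (rule summable_comparison_test'[OF s, of 0]) (use le term_nonneg in simp)
  have "(\<Sum>k. wt k * (\<integral>t. coef k (u t) \<partial>?M)\<^sup>2) \<le> (\<Sum>k. T * (wt k * (\<integral>t. (coef k (u t))\<^sup>2 \<partial>?M)))"
    by (rule suminf_le[OF le sm s])
  also have "\<dots> = T * (\<integral>t. (nrm X (u t))\<^sup>2 \<partial>?M)"
    using sums_mult[OF S, of T] by (rule sums_unique[symmetric])
  finally show "(\<Sum>k. wt k * (\<integral>t. coef k (u t) \<partial>?M)\<^sup>2) \<le> T * (\<integral>t. (nrm X (u t))\<^sup>2 \<partial>?M)" .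
qed

text \<open>
  For simple functions the coordinates of the integral are the integrals of the coordinates. Along the
  simple functions that define the Bochner integral, these numbers tend to both sides.
\<close>

lemma has_integral_in_coef:
  assumes u: "u \<in> bochner_L2 T X" and y: "has_integral_in T X u y"
  shows "coef k y = (\<integral>t. coef k (u t) \<partial>time_measure T)"
proof -
  let ?M = "time_measure T"
  note U = bochner_L2D[OF u]
  obtain S where yX: "y \<in> elems X" and S: "\<And>n::nat. simple_in T X (S n)"
    and L1: "(\<lambda>n. \<integral>\<^sup>+t. ennreal (nrm X (\<lambda>x. u t x - S n t x)) \<partial>?M) \<longlonglongrightarrow> 0"
    and lim: "(\<lambda>n. nrm X (\<lambda>x. simple_integral_in T (S n) x - y x)) \<longlonglongrightarrow> 0"
    using y unfolding has_integral_in_def by blast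
  note D = bochner_L2D[OF bochner_L2_diff[OF u bochner_L2_simple[OF S]]]
  have nn: "(\<integral>\<^sup>+t. ennreal (nrm X (\<lambda>x. u t x - S n t x)) \<partial>?M) =
      ennreal (\<integral>t. nrm X (\<lambda>x. u t x - S n t x) \<partial>?M)" for n
  proof (rule nn_integral_eq_integral[OF D(7)])
    show "AE t in ?M. 0 \<le> nrm X (\<lambda>x. u t x - S n t x)"
      using D(1) by eventually_elim (rule nrm_nonneg)
  qed
  have "(\<integral>t. nrm X (\<lambda>x. u t x - S n t x) \<partial>?M) \<ge> 0" for n
  proof (rule integral_nonneg_AE)
    show "AE t in ?M. 0 \<le> nrm X (\<lambda>x. u t x - S n t x)"
      using D(1) by eventually_elim (rule nrm_nonneg)
  qed
  then have L1': "(\<lambda>n. \<integral>t. nrm X (\<lambda>x. u t x - S n t x) \<partial>?M) \<longlonglongrightarrow> 0"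
    using L1 unfolding nn by (intro tendsto_ennrealD) (simp_all add: ennreal_0[symmetric] del: ennreal_0)
  have "(\<lambda>n. coef k (simple_integral_in T (S n)) - (\<integral>t. coef k (u t) \<partial>?M)) \<longlonglongrightarrow> 0"
  proof (rule Lim_null_comparison)
    show "(\<lambda>n. (\<integral>t. nrm X (\<lambda>x. u t x - S n t x) \<partial>?M) / sqrt (wt k)) \<longlonglongrightarrow> 0"
      by (rule tendsto_divide_zero[OF L1'])
    show "\<forall>\<^sub>F n in sequentially. norm (coef k (simple_integral_in T (S n)) - (\<integral>t. coef k (u t) \<partial>?M))
        \<le> (\<integral>t. nrm X (\<lambda>x. u t x - S n t x) \<partial>?M) / sqrt (wt k)"
    proof (rule always_eventually, rule allI)
      fix n
      have "\<bar>coef k (simple_integral_in T (S n)) - (\<integral>t. coef k (u t) \<partial>?M)\<bar>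
          = \<bar>\<integral>t. coef k (u t) - coef k (S n t) \<partial>?M\<bar>"
        using U(5)[of k] integral_simple_in(1)[OF S[of n], of "coef k"]
        by (simp add: simple_integral_elem[OF S] abs_minus_commute)
      also have "\<dots> \<le> (\<integral>t. \<bar>coef k (u t) - coef k (S n t)\<bar> \<partial>?M)" by (rule integral_abs_bound)
      also have "\<dots> \<le> (\<integral>t. nrm X (\<lambda>x. u t x - S n t x) / sqrt (wt k) \<partial>?M)"
      proof (rule integral_mono_AE)
        show "integrable ?M (\<lambda>t. \<bar>coef k (u t) - coef k (S n t)\<bar>)"
          using U(5)[of k] integral_simple_in(1)[OF S[of n], of "coef k"] by simp
        show "integrable ?M (\<lambda>t. nrm X (\<lambda>x. u t x - S n t x) / sqrt (wt k))" using D(7) by simp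
        show "AE t in ?M. \<bar>coef k (u t) - coef k (S n t)\<bar> \<le> nrm X (\<lambda>x. u t x - S n t x) / sqrt (wt k)"
          using U(1) bochner_L2D(1)[OF bochner_L2_simple[OF S[of n]]]
        proof eventually_elim
          case (elim t)
          show ?case using coef_le[OF diff_elem[OF elim], of k] by (simp add: coef_diff[OF elim])
        qed
      qed
      also have "\<dots> = (\<integral>t. nrm X (\<lambda>x. u t x - S n t x) \<partial>?M) / sqrt (wt k)" by simp
      finally show "norm (coef k (simple_integral_in T (S n)) - (\<integral>t. coef k (u t) \<partial>?M))
        \<le> (\<integral>t. nrm X (\<lambda>x. u t x - S n t x) \<partial>?M) / sqrt (wt k)" by simp
    qed
  qed
  then have 1: "(\<lambda>n. coef k (simple_integral_in T (S n))) \<longlonglongrightarrow> (\<integral>t. coef k (u t) \<partial>?M)"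
    by (rule LIM_zero_cancel)
  have "(\<lambda>n. coef k (simple_integral_in T (S n)) - coef k y) \<longlonglongrightarrow> 0"
  proof (rule Lim_null_comparison)
    show "(\<lambda>n. nrm X (\<lambda>x. simple_integral_in T (S n) x - y x) / sqrt (wt k)) \<longlonglongrightarrow> 0"
      by (rule tendsto_divide_zero[OF lim])
    show "\<forall>\<^sub>F n in sequentially. norm (coef k (simple_integral_in T (S n)) - coef k y)
        \<le> nrm X (\<lambda>x. simple_integral_in T (S n) x - y x) / sqrt (wt k)"
    proof (rule always_eventually, rule allI)
      fix n
      show "norm (coef k (simple_integral_in T (S n)) - coef k y)
          \<le> nrm X (\<lambda>x. simple_integral_in T (S n) x - y x) / sqrt (wt k)"
        using coef_le[OF diff_elem[OF simple_integral_elem(1)[OF S[of n]] yX], of k]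
        by (simp add: coef_diff[OF simple_integral_elem(1)[OF S] yX])
    qed
  qed
  then have "(\<lambda>n. coef k (simple_integral_in T (S n))) \<longlonglongrightarrow> coef k y" by (rule LIM_zero_cancel)
  from LIMSEQ_unique[OF this 1] show ?thesis .
qed

text \<open>
  The simple functions of \<open>simple_approximation\<close> converge in the mean and in the square mean by dominated
  convergence with majorants \<open>3 \<parallel>u\<parallel>\<close> and \<open>9 \<parallel>u\<parallel>\<^sup>2\<close>. Convergence of their integrals to \<open>y\<close> follows from the
  second, through \<open>integral_coef_square_le\<close>.
\<close>

lemma has_integral_inI:
  assumes u: "u \<in> bochner_L2 T X" and T: "0 \<le> T" and y: "y \<in> elems X"
    and coef: "\<And>k. coef k y = (\<integral>t. coef k (u t) \<partial>time_measure T)"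
  shows "has_integral_in T X u y"
proof -
  let ?M = "time_measure T"
  note U = bochner_L2D[OF u]
  obtain S where S': "\<forall>n::nat. simple_in T X (S n)"
    and lim: "AE t in ?M. (\<lambda>n. nrm X (\<lambda>x. u t x - S n t x)) \<longlonglongrightarrow> 0"
    and bd': "\<forall>n. AE t in ?M. nrm X (\<lambda>x. u t x - S n t x) \<le> 3 * nrm X (u t)"
    by (rule simple_approximation[OF U(1,2)])
  note S = S'[THEN spec] and bd = bd'[THEN spec]
  define D where "D n t = (\<lambda>x. u t x - S n t x)" for n t
  have DL: "D n \<in> bochner_L2 T X" for n
    unfolding D_def[abs_def] by (rule bochner_L2_diff[OF u bochner_L2_simple[OF S]])
  note DD = bochner_L2D[OF DL]
  have nonneg: "AE t in ?M. 0 \<le> nrm X (D n t)" for n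
    using DD(1) by eventually_elim (rule nrm_nonneg)
  have L1: "(\<lambda>n. \<integral>t. nrm X (D n t) \<partial>?M) \<longlonglongrightarrow> (\<integral>t. 0 \<partial>?M)"
  proof (rule integral_dominated_convergence[where w = "\<lambda>t. 3 * nrm X (u t)"])
    show "AE t in ?M. norm (nrm X (D n t)) \<le> 3 * nrm X (u t)" for n
      using bd[of n] nonneg[of n] by eventually_elim (simp add: D_def)
    show "AE t in ?M. (\<lambda>n. nrm X (D n t)) \<longlonglongrightarrow> 0" using lim unfolding D_def .
  qed (use U(7) DD(6) in simp_all)
  have L2: "(\<lambda>n. \<integral>t. (nrm X (D n t))\<^sup>2 \<partial>?M) \<longlonglongrightarrow> (\<integral>t. 0 \<partial>?M)"
  proof (rule integral_dominated_convergence[where w = "\<lambda>t. 9 * (nrm X (u t))\<^sup>2"])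
    show "AE t in ?M. norm ((nrm X (D n t))\<^sup>2) \<le> 9 * (nrm X (u t))\<^sup>2" for n
      using bd[of n] nonneg[of n]
    proof eventually_elim
      case (elim t)
      have "(nrm X (D n t))\<^sup>2 \<le> (3 * nrm X (u t))\<^sup>2"
        by (rule power_mono) (use elim in \<open>simp_all add: D_def\<close>)
      then show ?case by (simp add: power_mult_distrib)
    qed
    show "AE t in ?M. (\<lambda>n. (nrm X (D n t))\<^sup>2) \<longlonglongrightarrow> 0"
      using lim unfolding D_def
    proof eventually_elim
      case (elim t)
      show ?case using tendsto_power[OF elim, of 2] by simp
    qed
    show "integrable ?M (\<lambda>t. 9 * (nrm X (u t))\<^sup>2)" using U(3) by simp
    show "(\<lambda>t. (nrm X (D n t))\<^sup>2) \<in> borel_measurable ?M" for n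
      by (rule borel_measurable_power[OF DD(6)])
  qed simp
  have "nrm X (\<lambda>x. simple_integral_in T (S n) x - y x) \<le> sqrt (T * (\<integral>t. (nrm X (D n t))\<^sup>2 \<partial>?M))" for n
  proof -
    have c: "coef k (\<lambda>x. simple_integral_in T (S n) x - y x) = - (\<integral>t. coef k (D n t) \<partial>?M)" for k
    proof -
      have "(\<integral>t. coef k (D n t) \<partial>?M) = (\<integral>t. coef k (u t) - coef k (S n t) \<partial>?M)"
      proof (rule integral_cong_AE[OF DD(2)])
        show "(\<lambda>t. coef k (u t) - coef k (S n t)) \<in> borel_measurable ?M"
          by (rule borel_measurable_diff[OF U(2) bochner_L2D(2)[OF bochner_L2_simple[OF S]]])
        show "AE t in ?M. coef k (D n t) = coef k (u t) - coef k (S n t)"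
          using U(1) bochner_L2D(1)[OF bochner_L2_simple[OF S[of n]]]
          by eventually_elim (simp add: D_def coef_diff)
      qed
      also have "\<dots> = coef k y - coef k (simple_integral_in T (S n))"
        using U(5)[of k] integral_simple_in(1)[OF S[of n], of "coef k"] by (simp add: coef simple_integral_elem[OF S])
      finally show ?thesis by (simp add: coef_diff[OF simple_integral_elem(1)[OF S] y])
    qed
    show ?thesis
      unfolding nrm_eq[OF diff_elem[OF simple_integral_elem(1)[OF S] y]] c
      using integral_coef_square_le(2)[OF DL T, of n] by (intro real_sqrt_le_mono) simp
  qed
  then have le: "norm (nrm X (\<lambda>x. simple_integral_in T (S n) x - y x)) \<le> sqrt (T * (\<integral>t. (nrm X (D n t))\<^sup>2 \<partial>?M))" for n
    using nrm_nonneg[OF diff_elem[OF simple_integral_elem(1)[OF S[of n]] y]] by simp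
  have "(\<lambda>n. sqrt (T * (\<integral>t. (nrm X (D n t))\<^sup>2 \<partial>?M))) \<longlonglongrightarrow> sqrt (T * (\<integral>t. 0 \<partial>?M))"
    by (rule tendsto_real_sqrt, rule tendsto_mult_left, rule L2)
  then have lim0: "(\<lambda>n. sqrt (T * (\<integral>t. (nrm X (D n t))\<^sup>2 \<partial>?M))) \<longlonglongrightarrow> 0" by simp
  have conv: "(\<lambda>n. nrm X (\<lambda>x. simple_integral_in T (S n) x - y x)) \<longlonglongrightarrow> 0"
    by (rule Lim_null_comparison[OF always_eventually[OF allI[OF le]] lim0])
  have "(\<lambda>n. ennreal (\<integral>t. nrm X (D n t) \<partial>?M)) \<longlonglongrightarrow> ennreal 0"
    by (rule tendsto_ennrealI) (use L1 in simp)
  moreover have "(\<integral>\<^sup>+t. ennreal (nrm X (D n t)) \<partial>?M) = ennreal (\<integral>t. nrm X (D n t) \<partial>?M)" for n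
    by (rule nn_integral_eq_integral[OF DD(7) nonneg])
  ultimately have "(\<lambda>n. \<integral>\<^sup>+t. ennreal (nrm X (\<lambda>x. u t x - S n t x)) \<partial>?M) \<longlonglongrightarrow> 0"
    unfolding D_def by simp
  moreover have "strongly_measurable T X u" using u by (simp add: bochner_L2_def)
  ultimately show ?thesis
    unfolding has_integral_in_def using S conv y by blast
qed

lemma weak_time_deriv_coef:
  assumes u: "u \<in> bochner_L2 T X" and uv: "weak_time_deriv T X u v" and \<psi>: "test_function {0<..<T} \<psi>"
  shows "(\<integral>t. deriv \<psi> t * coef k (u t) \<partial>time_measure T) = - (\<integral>t. \<psi> t * coef k (v t) \<partial>time_measure T)"
proof -
  let ?M = "time_measure T"
  obtain y where v: "v \<in> bochner_L2 T X" and y: "has_integral_in T X (\<lambda>t x. deriv \<psi> t * u t x) y"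
    and y': "has_integral_in T X (\<lambda>t x. \<psi> t * v t x) (\<lambda>x. - y x)"
    using uv \<psi> unfolding weak_time_deriv_def by blast
  note d = test_function_derivs[OF \<psi>]
  have c: "continuous_on {0..T} (deriv \<psi>)" "continuous_on {0..T} \<psi>"
    by (rule continuous_on_subset[OF d(2) subset_UNIV], rule continuous_on_subset[OF d(4) subset_UNIV])
  have yX: "y \<in> elems X" using y by (simp add: has_integral_in_def)
  have eq: "(\<integral>t. coef k (\<lambda>x. q t * w t x) \<partial>?M) = (\<integral>t. q t * coef k (w t) \<partial>?M)"
    if w: "w \<in> bochner_L2 T X" and q: "continuous_on {0..T} q" for w q
    by (rule integral_cong_AE[OF bochner_L2D(2)[OF bochner_L2_scale(1)[OF w q]]
          borel_measurable_integrable[OF integrable_time_measure_mult[OF q bochner_L2D(5)[OF w]]]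
          bochner_L2_scale(2)[OF w q]])
  have "coef k y = (\<integral>t. deriv \<psi> t * coef k (u t) \<partial>?M)"
    using has_integral_in_coef[OF bochner_L2_scale(1)[OF u c(1)] y] eq[OF u c(1)] by simp
  moreover have "coef k (\<lambda>x. - y x) = (\<integral>t. \<psi> t * coef k (v t) \<partial>?M)"
    using has_integral_in_coef[OF bochner_L2_scale(1)[OF v c(2)] y'] eq[OF v c(2)] by simp
  moreover have "coef k (\<lambda>x. - y x) = - coef k y" using coef_scale[OF yX, of k "-1"] by simp
  ultimately show ?thesis by simp
qed

text \<open>
  Completeness supplies the element whose coordinates are the integrals of the coordinates of
  \<open>\<psi>' u\<close>.
\<close>

lemma weak_time_derivI:
  assumes u: "u \<in> bochner_L2 T X" and v: "v \<in> bochner_L2 T X" and T: "0 \<le> T"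
    and weak: "\<And>\<psi> k. test_function {0<..<T} \<psi> \<Longrightarrow>
      (\<integral>t. deriv \<psi> t * coef k (u t) \<partial>time_measure T) = - (\<integral>t. \<psi> t * coef k (v t) \<partial>time_measure T)"
  shows "weak_time_deriv T X u v"
  unfolding weak_time_deriv_def
proof (intro conjI allI impI v)
  let ?M = "time_measure T"
  fix \<psi> :: "real \<Rightarrow> real" assume \<psi>: "test_function {0<..<T} \<psi>"
  note d = test_function_derivs[OF \<psi>]
  have c: "continuous_on {0..T} (deriv \<psi>)" "continuous_on {0..T} \<psi>"
    by (rule continuous_on_subset[OF d(2) subset_UNIV], rule continuous_on_subset[OF d(4) subset_UNIV])
  have eq: "(\<integral>t. coef k (\<lambda>x. q t * w t x) \<partial>?M) = (\<integral>t. q t * coef k (w t) \<partial>?M)"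
    if w: "w \<in> bochner_L2 T X" and q: "continuous_on {0..T} q" for w q k
    by (rule integral_cong_AE[OF bochner_L2D(2)[OF bochner_L2_scale(1)[OF w q]]
          borel_measurable_integrable[OF integrable_time_measure_mult[OF q bochner_L2D(5)[OF w]]]
          bochner_L2_scale(2)[OF w q]])
  obtain y where y: "y \<in> elems X" "\<forall>k. coef k y = (\<integral>t. coef k (\<lambda>x. deriv \<psi> t * u t x) \<partial>?M)"
    using complete[OF integral_coef_square_le(1)[OF bochner_L2_scale(1)[OF u c(1)] T]] by blast
  have "has_integral_in T X (\<lambda>t x. deriv \<psi> t * u t x) y"
    by (rule has_integral_inI[OF bochner_L2_scale(1)[OF u c(1)] T y(1)]) (use y(2) in simp)
  moreover have "has_integral_in T X (\<lambda>t x. \<psi> t * v t x) (\<lambda>x. - y x)"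
  proof (rule has_integral_inI[OF bochner_L2_scale(1)[OF v c(2)] T])
    show "(\<lambda>x. - y x) \<in> elems X" using scale_elem[OF y(1), of "-1"] by simp
    show "coef k (\<lambda>x. - y x) = (\<integral>t. coef k (\<lambda>x. \<psi> t * v t x) \<partial>?M)" for k
      using coef_scale[OF y(1), of k "-1"] y(2) weak[OF \<psi>, of k] by (simp add: eq[OF u c(1)] eq[OF v c(2)])
  qed
  ultimately show "\<exists>y. has_integral_in T X (\<lambda>t x. deriv \<psi> t * u t x) y \<and>
      has_integral_in T X (\<lambda>t x. \<psi> t * v t x) (\<lambda>x. - y x)" by blast
qed

lemma initial_value_coef:
  assumes u: "AE t in time_measure T. u t \<in> elems X" and y: "y \<in> elems X" and T: "0 \<le> T" and iv: "initial_value T X u y"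
  obtains w where "continuous_on {0..T} w" "AE t in time_measure T. coef k (u t) = w t" "w 0 = coef k y"
proof -
  obtain w where w: "\<And>t. t \<in> {0..T} \<Longrightarrow> w t \<in> elems X"
    "\<And>t. t \<in> {0..T} \<Longrightarrow> ((\<lambda>r. nrm X (\<lambda>x. w r x - w t x)) \<longlongrightarrow> 0) (at t within {0..T})"
    "AE t in time_measure T. nrm X (\<lambda>x. u t x - w t x) = 0" "nrm X (\<lambda>x. w 0 x - y x) = 0"
    using iv unfolding initial_value_def by blast
  show ?thesis
  proof (rule that[of "\<lambda>t. coef k (w t)"])
    show "continuous_on {0..T} (\<lambda>t. coef k (w t))"
      unfolding continuous_on_def
    proof
      fix t assume t: "t \<in> {0..T}"
      have "((\<lambda>r. coef k (w r) - coef k (w t)) \<longlongrightarrow> 0) (at t within {0..T})"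
      proof (rule Lim_null_comparison)
        show "((\<lambda>r. nrm X (\<lambda>x. w r x - w t x) / sqrt (wt k)) \<longlongrightarrow> 0) (at t within {0..T})"
          by (rule tendsto_divide_zero[OF w(2)[OF t]])
        show "\<forall>\<^sub>F r in at t within {0..T}. norm (coef k (w r) - coef k (w t)) \<le> nrm X (\<lambda>x. w r x - w t x) / sqrt (wt k)"
          unfolding eventually_at_filter
        proof (intro always_eventually allI impI)
          fix r assume r: "r \<in> {0..T}"
          show "norm (coef k (w r) - coef k (w t)) \<le> nrm X (\<lambda>x. w r x - w t x) / sqrt (wt k)"
            using coef_le[OF diff_elem[OF w(1)[OF r] w(1)[OF t]], of k] by (simp add: coef_diff[OF w(1)[OF r] w(1)[OF t]])
        qed
      qed
      then show "((\<lambda>t. coef k (w t)) \<longlongrightarrow> coef k (w t)) (at t within {0..T})" by (rule LIM_zero_cancel)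
    qed
    have "AE t in time_measure T. t \<in> {0..T}" by (rule AE_I2) auto
    with u w(3) show "AE t in time_measure T. coef k (u t) = coef k (w t)"
    proof eventually_elim
      case (elim t)
      then show ?case
        using nrm_zero_iff[OF diff_elem[OF elim(1) w(1)[OF elim(3)]]] coef_diff[OF elim(1) w(1)[OF elim(3)], of k] by simp
    qed
    have "w 0 \<in> elems X" using w(1)[of 0] T by simp
    then show "coef k (w 0) = coef k y"
      using nrm_zero_iff[OF diff_elem[OF _ y]] w(4) coef_diff[OF _ y, of "w 0" k] by simp
  qed
qed

text \<open>
  Coordinatewise continuity together with a summable majorant of the weighted squares gives continuity in
  norm, by dominated convergence of series.
\<close>

lemma initial_valueI:
  assumes T: "0 \<le> T" and w: "\<And>t. t \<in> {0..T} \<Longrightarrow> w t \<in> elems X" and y: "y \<in> elems X"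
    and cont: "\<And>k. continuous_on {0..T} (\<lambda>t. coef k (w t))"
    and bound: "\<And>k t. t \<in> {0..T} \<Longrightarrow> wt k * (coef k (w t))\<^sup>2 \<le> B k" and B: "summable B"
    and w0: "\<And>k. coef k (w 0) = coef k y"
  shows "initial_value T X w y"
proof -
  have conv: "((\<lambda>r. nrm X (\<lambda>x. w r x - w t x)) \<longlongrightarrow> 0) (at t within {0..T})" if t: "t \<in> {0..T}" for t
  proof -
    have "((\<lambda>r. \<Sum>k. wt k * (coef k (w r) - coef k (w t))\<^sup>2) \<longlongrightarrow> 0) (at t within {0..T})"
    proof (rule suminf_tendsto_zero_dominated[where M = "\<lambda>k. 4 * B k"])
      fix k
      have "((\<lambda>r. coef k (w r)) \<longlongrightarrow> coef k (w t)) (at t within {0..T})"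
        using cont[of k] t by (simp add: continuous_on_def)
      then have "((\<lambda>r. wt k * (coef k (w r) - coef k (w t))\<^sup>2) \<longlongrightarrow> wt k * (coef k (w t) - coef k (w t))\<^sup>2) (at t within {0..T})"
        by (intro tendsto_mult_left tendsto_power tendsto_diff tendsto_const)
      then show "((\<lambda>r. wt k * (coef k (w r) - coef k (w t))\<^sup>2) \<longlongrightarrow> 0) (at t within {0..T})" by simp
    next
      show "\<forall>\<^sub>F r in at t within {0..T}. \<forall>k. \<bar>wt k * (coef k (w r) - coef k (w t))\<^sup>2\<bar> \<le> 4 * B k"
        unfolding eventually_at_filter
      proof (intro always_eventually allI impI)
        fix r k assume r: "r \<in> {0..T}"
        have "(coef k (w r) - coef k (w t))\<^sup>2 \<le> 2 * (coef k (w r))\<^sup>2 + 2 * (coef k (w t))\<^sup>2"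
          using zero_le_power2[of "coef k (w r) + coef k (w t)"] by (simp add: power2_eq_square algebra_simps)
        then have "wt k * (coef k (w r) - coef k (w t))\<^sup>2 \<le> wt k * (2 * (coef k (w r))\<^sup>2 + 2 * (coef k (w t))\<^sup>2)"
          by (rule mult_left_mono[OF _ wt_nonneg])
        then show "\<bar>wt k * (coef k (w r) - coef k (w t))\<^sup>2\<bar> \<le> 4 * B k"
          using bound[OF r, of k] bound[OF t, of k] term_nonneg[of k] by (simp add: algebra_simps)
      qed
      show "summable (\<lambda>k. 4 * B k)" by (rule summable_mult[OF B])
    qed
    then have "((\<lambda>r. sqrt (\<Sum>k. wt k * (coef k (w r) - coef k (w t))\<^sup>2)) \<longlongrightarrow> sqrt 0) (at t within {0..T})"
      by (rule tendsto_real_sqrt)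
    moreover have "\<forall>\<^sub>F r in at t within {0..T}. sqrt (\<Sum>k. wt k * (coef k (w r) - coef k (w t))\<^sup>2) = nrm X (\<lambda>x. w r x - w t x)"
      unfolding eventually_at_filter
      by (intro always_eventually allI impI) (simp add: nrm_eq[OF diff_elem[OF w w[OF t]]] coef_diff[OF w w[OF t]])
    ultimately show ?thesis by (simp add: Lim_transform_eventually)
  qed
  have w0e: "w 0 \<in> elems X" using w[of 0] T by simp
  have "AE t in time_measure T. nrm X (\<lambda>x. w t x - w t x) = 0"
  proof (rule AE_I2)
    have "nrm X (\<lambda>_. 0) = 0" using nrm_zero_iff[OF zero_elem] coef_zero by simp
    then show "nrm X (\<lambda>x. w t x - w t x) = 0" for t by simp
  qed
  moreover have "nrm X (\<lambda>x. w 0 x - y x) = 0"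
    using nrm_zero_iff[OF diff_elem[OF w0e y]] by (simp add: coef_diff[OF w0e y] w0)
  ultimately show ?thesis unfolding initial_value_def using w conv by (intro exI[of _ w]) blast
qed

end

lemma (in coord_space) bochner_L2_bounded:
  assumes u: "\<And>t. t \<in> {0..T} \<Longrightarrow> u t \<in> elems X" "\<And>t k. t \<in> {0..T} \<Longrightarrow> coef k (u t) = U k t"
    and U: "\<And>k. continuous_on {0..T} (U k)" "\<And>k t. t \<in> {0..T} \<Longrightarrow> wt k * (U k t)\<^sup>2 \<le> B k" and B: "summable B"
  shows "u \<in> bochner_L2 T X"
proof -
  let ?M = "time_measure T"
  have ae: "AE t in ?M. t \<in> {0..T}" by (rule AE_I2) auto
  have ue: "AE t in ?M. u t \<in> elems X" using ae by eventually_elim (rule u(1))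
  have meas: "(\<lambda>t. coef k (u t)) \<in> borel_measurable ?M" for k
  proof (rule time_measure_measurable_AE)
    show "U k \<in> borel_measurable ?M"
      by (rule borel_measurable_integrable[OF integrable_time_measure_continuous[OF U(1)]])
    show "AE t in ?M. U k t = coef k (u t)" using ae by eventually_elim (simp add: u(2))
  qed
  have "integrable ?M (\<lambda>t. (nrm X (u t))\<^sup>2)"
  proof (rule finite_measure.integrable_const_bound[OF finite_measure_time])
    show "(\<lambda>t. (nrm X (u t))\<^sup>2) \<in> borel_measurable ?M" by (rule borel_measurable_power[OF measurable_nrm[OF ue meas]])
    show "AE t in ?M. norm ((nrm X (u t))\<^sup>2) \<le> suminf B"
      using ae
    proof eventually_elim
      case (elim t)
      have "(nrm X (u t))\<^sup>2 \<le> suminf B"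
        unfolding nrm_square[OF u(1)[OF elim]]
        by (rule suminf_le[OF _ summable_coef[OF u(1)[OF elim]] B]) (simp only: u(2)[OF elim] U(2)[OF elim])
      then show ?case by simp
    qed
  qed
  with ue meas show ?thesis unfolding bochner_L2_iff by blast
qed

section \<open>Weak solutions of the equation of a single mode\<close>

text \<open>
  \<open>(U, V)\<close> is the continuous solution of \<open>U' = V\<close>, \<open>V' = p - \<kappa> U\<close> with initial data \<open>(a, b)\<close>, where the
  derivatives are taken in the weak sense.
\<close>

definition mode_solution :: "real \<Rightarrow> real \<Rightarrow> (real \<Rightarrow> real) \<Rightarrow> real \<Rightarrow> real \<Rightarrow> (real \<Rightarrow> real) \<Rightarrow> (real \<Rightarrow> real) \<Rightarrow> bool" where
  "mode_solution T \<kappa> p a b U V \<longleftrightarrow>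
    continuous_on {0..T} U \<and> continuous_on {0..T} V \<and> U 0 = a \<and> V 0 = b \<and>
    (\<forall>\<psi>. test_function {0<..<T} \<psi> \<longrightarrow>
      (\<integral>t. deriv \<psi> t * U t \<partial>time_measure T) = - (\<integral>t. \<psi> t * V t \<partial>time_measure T) \<and>
      (\<integral>t. deriv \<psi> t * V t \<partial>time_measure T) = - (\<integral>t. \<psi> t * (p t - \<kappa> * U t) \<partial>time_measure T))"

text \<open>
  The frequency is \<open>\<omega> = sqrt \<kappa>\<close>. The square of the pointwise bound of \<open>oscillator_solution\<close> is
  estimated by \<open>(x + y + z)\<^sup>2 \<le> 3 (x\<^sup>2 + y\<^sup>2 + z\<^sup>2)\<close>, and the \<open>L1\<close> norm of \<open>p\<close> by \<open>sqrt T\<close> times its \<open>L2\<close> norm.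
\<close>

lemma mode_solution_exists:
  assumes T: "0 < T" and \<kappa>: "0 < \<kappa>"
    and p: "p \<in> borel_measurable (time_measure T)" "integrable (time_measure T) (\<lambda>t. (p t)\<^sup>2)"
  obtains U V where "mode_solution T \<kappa> p a b U V"
    "\<And>t. t \<in> {0..T} \<Longrightarrow> \<kappa> * (U t)\<^sup>2 \<le> 3 * (\<kappa> * a\<^sup>2 + b\<^sup>2 + 4 * T * (\<integral>t. (p t)\<^sup>2 \<partial>time_measure T))"
    "\<And>t. t \<in> {0..T} \<Longrightarrow> (V t)\<^sup>2 \<le> 3 * (\<kappa> * a\<^sup>2 + b\<^sup>2 + 4 * T * (\<integral>t. (p t)\<^sup>2 \<partial>time_measure T))"
proof -
  let ?M = "time_measure T"
  define \<omega> where "\<omega> = sqrt \<kappa>"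
  have \<omega>: "0 < \<omega>" "\<omega>\<^sup>2 = \<kappa>" using \<kappa> by (simp_all add: \<omega>_def)
  have ip: "integrable ?M p" by (rule time_measure_square_integrable[OF p])
  define G where "G = integral {0..T} (\<lambda>r. \<bar>p r\<bar>)"
  have G: "G\<^sup>2 \<le> T * (\<integral>t. (p t)\<^sup>2 \<partial>?M)"
  proof -
    have "G = (\<integral>t. \<bar>p t\<bar> \<partial>?M)" unfolding G_def using ip by (simp add: integral_time_measure)
    then show ?thesis
      using time_measure_Jensen[of "\<lambda>t. \<bar>p t\<bar>" T] p T by simp
  qed
  have three: "x\<^sup>2 \<le> 3 * (\<kappa> * a\<^sup>2 + b\<^sup>2 + 4 * T * (\<integral>t. (p t)\<^sup>2 \<partial>?M))" if x: "\<bar>x\<bar> \<le> \<omega> * \<bar>a\<bar> + \<bar>b\<bar> + 2 * G" for x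
  proof -
    have tri: "(y + z + w)\<^sup>2 \<le> 3 * (y\<^sup>2 + z\<^sup>2 + w\<^sup>2)" for y z w :: real
      using zero_le_power2[of "y - z"] zero_le_power2[of "y - w"] zero_le_power2[of "z - w"]
      by (simp add: power2_eq_square algebra_simps)
    have "x\<^sup>2 \<le> (\<omega> * \<bar>a\<bar> + \<bar>b\<bar> + 2 * G)\<^sup>2" using power_mono[OF x, of 2] by simp
    also have "\<dots> \<le> 3 * ((\<omega> * \<bar>a\<bar>)\<^sup>2 + \<bar>b\<bar>\<^sup>2 + (2 * G)\<^sup>2)" by (rule tri)
    also have "\<dots> = 3 * (\<kappa> * a\<^sup>2 + b\<^sup>2 + 4 * G\<^sup>2)" by (simp add: power_mult_distrib \<omega>(2))
    also have "\<dots> \<le> 3 * (\<kappa> * a\<^sup>2 + b\<^sup>2 + 4 * T * (\<integral>t. (p t)\<^sup>2 \<partial>?M))" using G by simp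
    finally show ?thesis .
  qed
  show ?thesis
  proof (rule oscillator_solution[OF ip less_imp_le[OF T] \<omega>(1), where g = a and h = b])
    fix U V
    assume cU: "continuous_on {0..T} U" and cV: "continuous_on {0..T} V"
      and U: "\<And>t. t \<in> {0..T} \<Longrightarrow> U t = a + integral {0..t} V"
      and V: "\<And>t. t \<in> {0..T} \<Longrightarrow> V t = b + integral {0..t} (\<lambda>r. p r - \<omega>\<^sup>2 * U r)"
      and bU: "\<And>t. t \<in> {0..T} \<Longrightarrow> \<bar>\<omega> * U t\<bar> \<le> \<omega> * \<bar>a\<bar> + \<bar>b\<bar> + 2 * integral {0..T} (\<lambda>r. \<bar>p r\<bar>)"
      and bV: "\<And>t. t \<in> {0..T} \<Longrightarrow> \<bar>V t\<bar> \<le> \<omega> * \<bar>a\<bar> + \<bar>b\<bar> + 2 * integral {0..T} (\<lambda>r. \<bar>p r\<bar>)"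
    have iV: "integrable ?M V" by (rule integrable_time_measure_continuous[OF cV])
    have iU: "integrable ?M U" by (rule integrable_time_measure_continuous[OF cU])
    have iq: "integrable ?M (\<lambda>r. p r - \<kappa> * U r)" using ip iU by simp
    show thesis
    proof (rule that)
      have zero: "(0::real) \<in> {0..T}" using T by simp
      have "U 0 = a" using U[OF zero] by simp
      moreover have "V 0 = b" using V[OF zero] by simp
      moreover have "(\<integral>t. deriv \<psi> t * U t \<partial>?M) = - (\<integral>t. \<psi> t * V t \<partial>?M)" if "test_function {0<..<T} \<psi>" for \<psi>
        by (rule weak_derivative_of_primitive[OF iV less_imp_le[OF T] U that])
      moreover have "(\<integral>t. deriv \<psi> t * V t \<partial>?M) = - (\<integral>t. \<psi> t * (p t - \<kappa> * U t) \<partial>?M)" if "test_function {0<..<T} \<psi>" for \<psi>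
        by (rule weak_derivative_of_primitive[OF iq less_imp_le[OF T] V[unfolded \<omega>(2)] that])
      ultimately show "mode_solution T \<kappa> p a b U V" unfolding mode_solution_def using cU cV by blast
      fix t assume t: "t \<in> {0..T}"
      show "\<kappa> * (U t)\<^sup>2 \<le> 3 * (\<kappa> * a\<^sup>2 + b\<^sup>2 + 4 * T * (\<integral>t. (p t)\<^sup>2 \<partial>?M))"
        using three[of "\<omega> * U t"] bU[OF t] by (simp add: G_def power_mult_distrib \<omega>(2))
      show "(V t)\<^sup>2 \<le> 3 * (\<kappa> * a\<^sup>2 + b\<^sup>2 + 4 * T * (\<integral>t. (p t)\<^sup>2 \<partial>?M))"
        using three[of "V t"] bV[OF t] by (simp add: G_def)
    qed
  qed
qed

text \<open>
  The difference solves the homogeneous oscillator with zero initial data.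
\<close>

lemma mode_solution_unique:
  assumes T: "0 < T" and \<kappa>: "0 < \<kappa>" and p: "integrable (time_measure T) p"
    and UV: "mode_solution T \<kappa> p a b U V"
    and u: "integrable (time_measure T) u" and v: "integrable (time_measure T) v"
    and u': "\<And>\<psi>. test_function {0<..<T} \<psi> \<Longrightarrow>
      (\<integral>t. deriv \<psi> t * u t \<partial>time_measure T) = - (\<integral>t. \<psi> t * v t \<partial>time_measure T)"
    and v': "\<And>\<psi>. test_function {0<..<T} \<psi> \<Longrightarrow>
      (\<integral>t. deriv \<psi> t * v t \<partial>time_measure T) = - (\<integral>t. \<psi> t * (p t - \<kappa> * u t) \<partial>time_measure T)"
    and u0: "continuous_on {0..T} u0" "AE t in time_measure T. u t = u0 t" "u0 0 = a"
    and v0: "continuous_on {0..T} v0" "AE t in time_measure T. v t = v0 t" "v0 0 = b"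
  shows "AE t in time_measure T. u t = U t" "AE t in time_measure T. v t = V t"
proof -
  let ?M = "time_measure T"
  have cU: "continuous_on {0..T} U" "continuous_on {0..T} V" and init: "U 0 = a" "V 0 = b"
    and U': "\<And>\<psi>. test_function {0<..<T} \<psi> \<Longrightarrow> (\<integral>t. deriv \<psi> t * U t \<partial>?M) = - (\<integral>t. \<psi> t * V t \<partial>?M)"
    and V': "\<And>\<psi>. test_function {0<..<T} \<psi> \<Longrightarrow> (\<integral>t. deriv \<psi> t * V t \<partial>?M) = - (\<integral>t. \<psi> t * (p t - \<kappa> * U t) \<partial>?M)"
    using UV unfolding mode_solution_def by simp_all
  have iU: "integrable ?M U" "integrable ?M V"
    by (rule integrable_time_measure_continuous[OF cU(1)], rule integrable_time_measure_continuous[OF cU(2)])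
  define d where "d t = u t - U t" for t
  define e where "e t = v t - V t" for t
  note IM = integrable_test_function_mult
  have d: "integrable ?M d" and e: "integrable ?M e"
    unfolding d_def[abs_def] e_def[abs_def] using u v iU by simp_all
  have d': "(\<integral>t. deriv \<psi> t * d t \<partial>?M) = - (\<integral>t. \<psi> t * e t \<partial>?M)" if \<psi>: "test_function {0<..<T} \<psi>" for \<psi>
    unfolding d_def e_def right_diff_distrib
    using IM(2)[OF \<psi> u] IM(2)[OF \<psi> iU(1)] IM(1)[OF \<psi> v] IM(1)[OF \<psi> iU(2)] u'[OF \<psi>] U'[OF \<psi>] by simp
  have e': "(\<integral>t. deriv \<psi> t * e t \<partial>?M) = - (\<integral>t. \<psi> t * (- \<kappa> * d t) \<partial>?M)" if \<psi>: "test_function {0<..<T} \<psi>" for \<psi>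
  proof -
    have i: "integrable ?M (\<lambda>t. \<psi> t * (p t - \<kappa> * u t))" "integrable ?M (\<lambda>t. \<psi> t * (p t - \<kappa> * U t))"
      by (rule IM(1)[OF \<psi>], use p u iU in simp)+
    have "(\<integral>t. \<psi> t * (- \<kappa> * d t) \<partial>?M) = (\<integral>t. \<psi> t * (p t - \<kappa> * u t) - \<psi> t * (p t - \<kappa> * U t) \<partial>?M)"
      by (intro Bochner_Integration.integral_cong) (auto simp: d_def algebra_simps)
    also have "\<dots> = (\<integral>t. \<psi> t * (p t - \<kappa> * u t) \<partial>?M) - (\<integral>t. \<psi> t * (p t - \<kappa> * U t) \<partial>?M)"
      by (rule Bochner_Integration.integral_diff[OF i])
    finally have "(\<integral>t. \<psi> t * (- \<kappa> * d t) \<partial>?M) = - (\<integral>t. deriv \<psi> t * v t \<partial>?M) + (\<integral>t. deriv \<psi> t * V t \<partial>?M)"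
      unfolding v'[OF \<psi>] V'[OF \<psi>] by linarith
    moreover have "(\<integral>t. deriv \<psi> t * e t \<partial>?M) = (\<integral>t. deriv \<psi> t * v t \<partial>?M) - (\<integral>t. deriv \<psi> t * V t \<partial>?M)"
      unfolding e_def right_diff_distrib
      by (rule Bochner_Integration.integral_diff[OF IM(2)[OF \<psi> v] IM(2)[OF \<psi> iU(2)]])
    ultimately show ?thesis by linarith
  qed
  have c: "continuous_on {0..T} (\<lambda>t. u0 t - U t)" "continuous_on {0..T} (\<lambda>t. v0 t - V t)"
    by (intro continuous_on_diff u0 v0 cU)+
  have a1: "AE t in ?M. d t = u0 t - U t" using u0(2) by eventually_elim (simp add: d_def)
  have a2: "AE t in ?M. e t = v0 t - V t" using v0(2) by eventually_elim (simp add: e_def)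
  have z: "u0 0 - U 0 = 0" "v0 0 - V 0 = 0" using u0 v0 init by simp_all
  have res1: "AE t in ?M. d t = 0"
    by (rule weak_oscillator_unique(1)[OF T \<kappa> d e _ _ c(1) a1 z(1) c(2) a2 z(2)], erule d', erule e')
  have res2: "AE t in ?M. e t = 0"
    by (rule weak_oscillator_unique(2)[OF T \<kappa> d e _ _ c(1) a1 z(1) c(2) a2 z(2)], erule d', erule e')
  show "AE t in ?M. u t = U t" using res1 by eventually_elim (simp add: d_def)
  show "AE t in ?M. v t = V t" using res2 by eventually_elim (simp add: e_def)
qed

section \<open>The fractional wave equation\<close>

text \<open>
  The setting of the wave equation after the elliptic operator has been diagonalised. The prefixes
  \<open>L\<close>, \<open>H\<close> and \<open>D\<close> below stand for \<open>L2\<close>, the spectral space of order \<open>s\<close> and its dual.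
\<close>

locale spectral_wave =
  fixes \<Omega> :: "(real^'n::finite) set" and lam :: "nat \<Rightarrow> real" and \<phi> :: "nat \<Rightarrow> real^'n \<Rightarrow> real"
    and s T \<mu> :: real
  assumes \<Omega>: "\<Omega> \<in> lmeasurable" and onb: "orthonormal_basis \<Omega> \<phi>"
    and \<mu>: "0 < \<mu>" "\<And>k. \<mu> \<le> lam k" and s: "0 < s" and T: "0 < T"
begin

sublocale L: coord_space "L2_space \<Omega>" "\<lambda>k w. L2_inner \<Omega> w (\<phi> k)" "\<lambda>_. 1" \<phi>
  by (rule L2_coord_space[OF \<Omega> onb])

sublocale H: coord_space "spectral_space \<Omega> lam \<phi> s" "\<lambda>k w. L2_inner \<Omega> w (\<phi> k)" "\<lambda>k. lam k powr s" \<phi>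
  by (rule spectral_coord_space[OF L.coord_space_axioms \<mu> less_imp_le[OF s]])

sublocale D: coord_space "spectral_dual \<Omega> lam \<phi> s" "\<lambda>k F. F (\<phi> k)" "\<lambda>k. 1 / lam k powr s"
    "\<lambda>k w. L2_inner \<Omega> w (\<phi> k)"
  by (rule H.dual_coord_space)

abbreviation "M \<equiv> time_measure T"
abbreviation "\<kappa> k \<equiv> lam k powr s"

lemma T_nonneg: "0 \<le> T" using T by simp

lemma \<kappa>_ge: "\<mu> powr s \<le> \<kappa> k" "0 < \<mu> powr s"
  using \<mu>(1) \<mu>(2)[of k] s by (auto intro: powr_mono2)

lemma le_of_weighted: "\<kappa> k * x\<^sup>2 \<le> B \<Longrightarrow> 1 * x\<^sup>2 \<le> B / \<mu> powr s"
  using \<kappa>_ge mult_right_mono[OF \<kappa>_ge(1)[of k], of "x\<^sup>2"] by (simp add: field_simps)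

lemma divide_weight_le: "x\<^sup>2 \<le> B \<Longrightarrow> 1 / \<kappa> k * x\<^sup>2 \<le> B / \<mu> powr s"
proof -
  assume x: "x\<^sup>2 \<le> B"
  have "1 / \<kappa> k * x\<^sup>2 \<le> 1 / \<mu> powr s * x\<^sup>2"
    using \<kappa>_ge H.wt_pos[of k] by (intro mult_right_mono divide_left_mono) auto
  also have "\<dots> \<le> 1 / \<mu> powr s * B" using x \<kappa>_ge(2) by (intro mult_left_mono) auto
  finally show ?thesis by simp
qed

lemma H_subset_L: "v \<in> elems (spectral_space \<Omega> lam \<phi> s) \<Longrightarrow> v \<in> elems (L2_space \<Omega>)"
  by (simp add: spectral_elems_iff)

lemma L2_nrm_le_H:
  assumes v: "v \<in> elems (spectral_space \<Omega> lam \<phi> s)"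
  shows "(nrm (L2_space \<Omega>) v)\<^sup>2 \<le> (nrm (spectral_space \<Omega> lam \<phi> s) v)\<^sup>2 / \<mu> powr s"
proof -
  have "(\<Sum>k. 1 * (L2_inner \<Omega> v (\<phi> k))\<^sup>2) \<le> (\<Sum>k. \<kappa> k * (L2_inner \<Omega> v (\<phi> k))\<^sup>2 / \<mu> powr s)"
  proof (rule suminf_le)
    show "1 * (L2_inner \<Omega> v (\<phi> k))\<^sup>2 \<le> \<kappa> k * (L2_inner \<Omega> v (\<phi> k))\<^sup>2 / \<mu> powr s" for k
      by (rule le_of_weighted[OF order_refl])
  qed (rule L.summable_coef[OF H_subset_L[OF v]], rule summable_divide[OF H.summable_coef[OF v]])
  also have "\<dots> = (nrm (spectral_space \<Omega> lam \<phi> s) v)\<^sup>2 / \<mu> powr s"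
    by (simp add: suminf_divide H.summable_coef v H.nrm_square)
  finally show ?thesis unfolding L.nrm_square[OF H_subset_L[OF v]] .
qed

lemma bochner_H_subset_L:
  assumes u: "u \<in> bochner_L2 T (spectral_space \<Omega> lam \<phi> s)"
  shows "u \<in> bochner_L2 T (L2_space \<Omega>)"
proof -
  note U = H.bochner_L2D[OF u]
  have e: "AE t in M. u t \<in> elems (L2_space \<Omega>)" using U(1) by eventually_elim (rule H_subset_L)
  have "integrable M (\<lambda>t. (nrm (L2_space \<Omega>) (u t))\<^sup>2)"
  proof (rule Bochner_Integration.integrable_bound)
    show "integrable M (\<lambda>t. (nrm (spectral_space \<Omega> lam \<phi> s) (u t))\<^sup>2 / \<mu> powr s)" using U(3) by simp
    show "(\<lambda>t. (nrm (L2_space \<Omega>) (u t))\<^sup>2) \<in> borel_measurable M"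
      by (rule borel_measurable_power[OF L.measurable_nrm[OF e U(2)]])
    show "AE t in M. norm ((nrm (L2_space \<Omega>) (u t))\<^sup>2) \<le> norm ((nrm (spectral_space \<Omega> lam \<phi> s) (u t))\<^sup>2 / \<mu> powr s)"
      using U(1) by eventually_elim (use L2_nrm_le_H in simp)
  qed
  with e U(2) show ?thesis unfolding L.bochner_L2_iff by blast
qed

text \<open>
  The embedding of \<open>L2\<close> into the dual, by the inequality of Cauchy and Schwarz and the embedding of the
  spectral space into \<open>L2\<close>.
\<close>

lemma L2_inner_dual:
  assumes w: "w \<in> elems (L2_space \<Omega>)"
  shows "L2_inner \<Omega> w \<in> elems (spectral_dual \<Omega> lam \<phi> s)"
    "(nrm (spectral_dual \<Omega> lam \<phi> s) (L2_inner \<Omega> w))\<^sup>2 \<le> (nrm (L2_space \<Omega>) w)\<^sup>2 / \<mu> powr s"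
proof -
  let ?H = "spectral_space \<Omega> lam \<phi> s"
  have lin: "L2_inner \<Omega> w (\<lambda>x. a * v x + b * v' x) = a * L2_inner \<Omega> w v + b * L2_inner \<Omega> w v'"
    if "v \<in> elems ?H" "v' \<in> elems ?H" for v v' a b
    using that by (intro L2_inner_lincomb_right H_subset_L w)
  have "\<bar>L2_inner \<Omega> w v\<bar> \<le> (nrm (L2_space \<Omega>) w / sqrt (\<mu> powr s)) * nrm ?H v" if v: "v \<in> elems ?H" for v
  proof -
    have "nrm (L2_space \<Omega>) v \<le> nrm ?H v / sqrt (\<mu> powr s)"
    proof (rule power2_le_imp_le)
      show "(nrm (L2_space \<Omega>) v)\<^sup>2 \<le> (nrm ?H v / sqrt (\<mu> powr s))\<^sup>2"
        using L2_nrm_le_H[OF v] \<kappa>_ge(2) by (simp add: power_divide)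
    qed (simp add: H.nrm_nonneg v)
    then have "nrm (L2_space \<Omega>) w * nrm (L2_space \<Omega>) v \<le> nrm (L2_space \<Omega>) w * (nrm ?H v / sqrt (\<mu> powr s))"
      by (rule mult_left_mono[OF _ L2_nrm_nonneg])
    with L2_Cauchy_Schwarz[OF w H_subset_L[OF v]] show ?thesis by simp
  qed
  with lin show e: "L2_inner \<Omega> w \<in> elems (spectral_dual \<Omega> lam \<phi> s)"
    unfolding H.dual_elems_iff by blast
  have "(\<Sum>k. 1 / \<kappa> k * (L2_inner \<Omega> w (\<phi> k))\<^sup>2) \<le> (\<Sum>k. 1 * (L2_inner \<Omega> w (\<phi> k))\<^sup>2 / \<mu> powr s)"
  proof (rule suminf_le)
    show "1 / \<kappa> k * (L2_inner \<Omega> w (\<phi> k))\<^sup>2 \<le> 1 * (L2_inner \<Omega> w (\<phi> k))\<^sup>2 / \<mu> powr s" for k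
      using divide_weight_le[OF order_refl] by simp
  qed (rule D.summable_coef[OF e], rule summable_divide[OF L.summable_coef[OF w]])
  also have "\<dots> = (nrm (L2_space \<Omega>) w)\<^sup>2 / \<mu> powr s"
    unfolding L.nrm_square[OF w] by (rule suminf_divide[OF L.summable_coef[OF w]])
  finally show "(nrm (spectral_dual \<Omega> lam \<phi> s) (L2_inner \<Omega> w))\<^sup>2 \<le> (nrm (L2_space \<Omega>) w)\<^sup>2 / \<mu> powr s"
    unfolding D.nrm_square[OF e] .
qed

lemma bochner_L2_dual:
  assumes w: "w \<in> bochner_L2 T (L2_space \<Omega>)"
  shows "(\<lambda>t. L2_inner \<Omega> (w t)) \<in> bochner_L2 T (spectral_dual \<Omega> lam \<phi> s)"
proof -
  note W = L.bochner_L2D[OF w]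
  have e: "AE t in M. L2_inner \<Omega> (w t) \<in> elems (spectral_dual \<Omega> lam \<phi> s)"
    using W(1) by eventually_elim (rule L2_inner_dual)
  have "integrable M (\<lambda>t. (nrm (spectral_dual \<Omega> lam \<phi> s) (L2_inner \<Omega> (w t)))\<^sup>2)"
  proof (rule Bochner_Integration.integrable_bound)
    show "integrable M (\<lambda>t. (nrm (L2_space \<Omega>) (w t))\<^sup>2 / \<mu> powr s)" using W(3) by simp
    show "(\<lambda>t. (nrm (spectral_dual \<Omega> lam \<phi> s) (L2_inner \<Omega> (w t)))\<^sup>2) \<in> borel_measurable M"
      by (rule borel_measurable_power[OF D.measurable_nrm[OF e W(2)]])
    show "AE t in M. norm ((nrm (spectral_dual \<Omega> lam \<phi> s) (L2_inner \<Omega> (w t)))\<^sup>2) \<le> norm ((nrm (L2_space \<Omega>) (w t))\<^sup>2 / \<mu> powr s)"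
      using W(1)
    proof eventually_elim
      case (elim t)
      show ?case using L2_inner_dual(2)[OF elim] by simp
    qed
  qed
  with e W(2) show ?thesis unfolding D.bochner_L2_iff by blast
qed

lemma fractional_power_basis: "fractional_power \<Omega> lam \<phi> s w (\<phi> k) = \<kappa> k * L2_inner \<Omega> w (\<phi> k)"
proof -
  have "(\<lambda>j. \<kappa> j * L2_inner \<Omega> w (\<phi> j) * L2_inner \<Omega> (\<phi> j) (\<phi> k)) sums
      (\<Sum>j\<in>{k}. \<kappa> j * L2_inner \<Omega> w (\<phi> j) * L2_inner \<Omega> (\<phi> j) (\<phi> k))"
    by (rule sums_finite) (auto simp: L.coef_basis)
  then show ?thesis by (simp add: fractional_power_def sums_iff L.coef_basis)
qed

text \<open>
  The dual contains a functional \<open>F\<close> with the coordinates \<open>\<kappa>\<^sub>k w\<^sub>k\<close>, and on the spectral space the series that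
  defines the fractional power converges to \<open>F\<close>.
\<close>

lemma fractional_power_dual:
  assumes w: "w \<in> elems (spectral_space \<Omega> lam \<phi> s)"
  shows "fractional_power \<Omega> lam \<phi> s w \<in> elems (spectral_dual \<Omega> lam \<phi> s)"
proof -
  have "1 / \<kappa> k * (\<kappa> k * L2_inner \<Omega> w (\<phi> k))\<^sup>2 = \<kappa> k * (L2_inner \<Omega> w (\<phi> k))\<^sup>2" for k
    using H.wt_pos[of k] by (simp add: power2_eq_square)
  then have "summable (\<lambda>k. 1 / \<kappa> k * (\<kappa> k * L2_inner \<Omega> w (\<phi> k))\<^sup>2)"
    using H.summable_coef[OF w] by (simp only:)
  from D.complete[OF this] obtain F where F: "F \<in> elems (spectral_dual \<Omega> lam \<phi> s)"
    "\<forall>k. F (\<phi> k) = \<kappa> k * L2_inner \<Omega> w (\<phi> k)" by blast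
  have eq: "fractional_power \<Omega> lam \<phi> s w v = F v" if v: "v \<in> elems (spectral_space \<Omega> lam \<phi> s)" for v
  proof -
    have "(\<lambda>k. \<kappa> k * L2_inner \<Omega> w (\<phi> k) * L2_inner \<Omega> (\<phi> k) v) sums F v"
      using H.dual_sums[OF F(1) v] F(2) by (simp add: L2_inner_commute[of \<Omega> v])
    then show ?thesis by (simp add: fractional_power_def sums_iff)
  qed
  show ?thesis
    using F(1) unfolding H.dual_elems_iff by (simp add: eq H.lincomb)
qed

text \<open>
  The share of mode \<open>k\<close> in the square of the norm of the data.
\<close>

abbreviation "mode_bound f g h k \<equiv> 3 * (\<kappa> k * (L2_inner \<Omega> g (\<phi> k))\<^sup>2 + (L2_inner \<Omega> h (\<phi> k))\<^sup>2 +
    4 * T * (\<integral>t. (L2_inner \<Omega> (f t) (\<phi> k))\<^sup>2 \<partial>M))"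

lemma mode_bound_sums:
  assumes f: "f \<in> bochner_L2 T (L2_space \<Omega>)" and g: "g \<in> elems (spectral_space \<Omega> lam \<phi> s)"
    and h: "h \<in> elems (L2_space \<Omega>)"
  shows "mode_bound f g h sums (3 * ((nrm (spectral_space \<Omega> lam \<phi> s) g)\<^sup>2 + (nrm (L2_space \<Omega>) h)\<^sup>2 +
    4 * T * (bochner_L2_norm T (L2_space \<Omega>) f)\<^sup>2))"
proof -
  have "(\<lambda>k. (L2_inner \<Omega> h (\<phi> k))\<^sup>2) sums (nrm (L2_space \<Omega>) h)\<^sup>2"
    using L.nrm_square_sums[OF h] by simp
  moreover have "(\<lambda>k. \<integral>t. (L2_inner \<Omega> (f t) (\<phi> k))\<^sup>2 \<partial>M) sums (bochner_L2_norm T (L2_space \<Omega>) f)\<^sup>2"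
    using L.bochner_L2_norm_sums[OF f] by (simp add: bochner_L2_norm_def)
  ultimately show ?thesis
    by (intro sums_mult sums_add H.nrm_square_sums g)
qed

lemma mode_bound_le:
  assumes f: "f \<in> bochner_L2 T (L2_space \<Omega>)" and g: "g \<in> elems (spectral_space \<Omega> lam \<phi> s)"
    and h: "h \<in> elems (L2_space \<Omega>)"
  shows "sqrt (suminf (mode_bound f g h)) \<le> sqrt (3 * (1 + 4 * T)) *
    (bochner_L2_norm T (L2_space \<Omega>) f + nrm (spectral_space \<Omega> lam \<phi> s) g + nrm (L2_space \<Omega>) h)"
proof -
  define a b c where "a = bochner_L2_norm T (L2_space \<Omega>) f" "b = nrm (spectral_space \<Omega> lam \<phi> s) g"
    "c = nrm (L2_space \<Omega>) h"
  have nn: "0 \<le> a" "0 \<le> b" "0 \<le> c"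
    by (simp_all add: a_b_c_def bochner_L2_norm_def H.nrm_nonneg[OF g] L2_nrm_nonneg)
  have "suminf (mode_bound f g h) = 3 * (b\<^sup>2 + c\<^sup>2 + 4 * T * a\<^sup>2)"
    using mode_bound_sums[OF f g h] by (simp add: sums_iff a_b_c_def)
  also have "\<dots> \<le> 3 * ((1 + 4 * T) * (a\<^sup>2 + b\<^sup>2 + c\<^sup>2))"
    using T by (intro mult_left_mono) (simp_all add: algebra_simps)
  also have "\<dots> \<le> 3 * ((1 + 4 * T) * (a + b + c)\<^sup>2)"
  proof -
    have "a\<^sup>2 + b\<^sup>2 + c\<^sup>2 \<le> (a + b + c)\<^sup>2"
      using nn by (simp add: power2_eq_square algebra_simps)
    then show ?thesis using T by (intro mult_left_mono) simp_all
  qed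
  finally have "suminf (mode_bound f g h) \<le> (3 * (1 + 4 * T)) * (a + b + c)\<^sup>2"
    by (simp only: mult.assoc)
  then have "sqrt (suminf (mode_bound f g h)) \<le> sqrt ((3 * (1 + 4 * T)) * (a + b + c)\<^sup>2)"
    by (rule real_sqrt_le_mono)
  also have "\<dots> = sqrt (3 * (1 + 4 * T)) * (a + b + c)"
    using nn by (simp add: real_sqrt_mult)
  finally show ?thesis by (simp add: a_b_c_def)
qed

text \<open>
  Row \<open>k\<close> of \<open>U\<close> and \<open>V\<close> holds the coefficients of \<open>\<phi> k\<close> in the solution and in its time derivative.
\<close>

definition modes where
  "modes f g h U V \<longleftrightarrow> (\<forall>k::nat.
    mode_solution T (\<kappa> k) (\<lambda>t. L2_inner \<Omega> (f t) (\<phi> k)) (L2_inner \<Omega> g (\<phi> k)) (L2_inner \<Omega> h (\<phi> k)) (U k) (V k) \<and>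
    (\<forall>t\<in>{0..T}. \<kappa> k * (U k t)\<^sup>2 \<le> mode_bound f g h k \<and> (V k t)\<^sup>2 \<le> mode_bound f g h k))"

lemma modes_exist:
  assumes f: "f \<in> bochner_L2 T (L2_space \<Omega>)"
  shows "\<exists>U V. modes f g h U V"
proof -
  note F = L.bochner_L2D[OF f]
  have "\<exists>U V. mode_solution T (\<kappa> k) (\<lambda>t. L2_inner \<Omega> (f t) (\<phi> k)) (L2_inner \<Omega> g (\<phi> k)) (L2_inner \<Omega> h (\<phi> k)) U V \<and>
    (\<forall>t\<in>{0..T}. \<kappa> k * (U t)\<^sup>2 \<le> mode_bound f g h k \<and> (V t)\<^sup>2 \<le> mode_bound f g h k)" for k
    by (rule mode_solution_exists[OF T H.wt_pos F(2) F(4), of k k "L2_inner \<Omega> g (\<phi> k)" "L2_inner \<Omega> h (\<phi> k)"]) blast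
  then show ?thesis unfolding modes_def by metis
qed

lemma modesD:
  assumes "modes f g h U V"
  shows "mode_solution T (\<kappa> k) (\<lambda>t. L2_inner \<Omega> (f t) (\<phi> k)) (L2_inner \<Omega> g (\<phi> k)) (L2_inner \<Omega> h (\<phi> k)) (U k) (V k)"
    "continuous_on {0..T} (U k)" "continuous_on {0..T} (V k)"
    "U k 0 = L2_inner \<Omega> g (\<phi> k)" "V k 0 = L2_inner \<Omega> h (\<phi> k)"
    "t \<in> {0..T} \<Longrightarrow> \<kappa> k * (U k t)\<^sup>2 \<le> mode_bound f g h k" "t \<in> {0..T} \<Longrightarrow> (V k t)\<^sup>2 \<le> mode_bound f g h k"
proof -
  show *: "mode_solution T (\<kappa> k) (\<lambda>t. L2_inner \<Omega> (f t) (\<phi> k)) (L2_inner \<Omega> g (\<phi> k)) (L2_inner \<Omega> h (\<phi> k)) (U k) (V k)"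
    using assms unfolding modes_def by blast
  show "continuous_on {0..T} (U k)" "continuous_on {0..T} (V k)"
    "U k 0 = L2_inner \<Omega> g (\<phi> k)" "V k 0 = L2_inner \<Omega> h (\<phi> k)"
    using * unfolding mode_solution_def by simp_all
  show "t \<in> {0..T} \<Longrightarrow> \<kappa> k * (U k t)\<^sup>2 \<le> mode_bound f g h k" "t \<in> {0..T} \<Longrightarrow> (V k t)\<^sup>2 \<le> mode_bound f g h k"
    using assms unfolding modes_def by blast+
qed

lemma modes_weak:
  assumes "modes f g h U V" and \<psi>: "test_function {0<..<T} \<psi>"
  shows "(\<integral>t. deriv \<psi> t * U k t \<partial>M) = - (\<integral>t. \<psi> t * V k t \<partial>M)"
    "(\<integral>t. deriv \<psi> t * V k t \<partial>M) = - (\<integral>t. \<psi> t * (L2_inner \<Omega> (f t) (\<phi> k) - \<kappa> k * U k t) \<partial>M)"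
  using modesD(1)[OF assms(1), of k] \<psi> unfolding mode_solution_def by simp_all

text \<open>
  The equation is tested with \<open>\<phi> k\<close>, and the initial values are read off in the same coordinate; then
  uniqueness for the single mode applies. A weak derivative \<open>ut\<close> other than the one that occurs in
  the definition of the solution has the same integrals against test functions, hence the same
  coefficients.
\<close>

lemma weak_solution_modes:
  assumes f: "f \<in> bochner_L2 T (L2_space \<Omega>)" and g: "g \<in> elems (spectral_space \<Omega> lam \<phi> s)"
    and h: "h \<in> elems (L2_space \<Omega>)" and UV: "modes f g h U V"
    and sol: "weak_solution \<Omega> lam \<phi> s T f g h u"
  shows "AE t in M. \<forall>k. L2_inner \<Omega> (u t) (\<phi> k) = U k t"
    and "weak_time_deriv T (L2_space \<Omega>) u ut \<Longrightarrow> AE t in M. \<forall>k. L2_inner \<Omega> (ut t) (\<phi> k) = V k t"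
proof -
  obtain ut' utt where u: "u \<in> bochner_L2 T (spectral_space \<Omega> lam \<phi> s)"
    and ut': "weak_time_deriv T (L2_space \<Omega>) u ut'"
    and utt: "weak_time_deriv T (spectral_dual \<Omega> lam \<phi> s) (\<lambda>t. L2_inner \<Omega> (ut' t)) utt"
    and ig: "initial_value T (L2_space \<Omega>) u g"
    and ih: "initial_value T (spectral_dual \<Omega> lam \<phi> s) (\<lambda>t. L2_inner \<Omega> (ut' t)) (L2_inner \<Omega> h)"
    and eq: "AE t in M. \<forall>v\<in>elems (spectral_space \<Omega> lam \<phi> s).
        utt t v + fractional_power \<Omega> lam \<phi> s (u t) v = L2_inner \<Omega> (f t) v"
    using sol unfolding weak_solution_def by blast
  have uL: "u \<in> bochner_L2 T (L2_space \<Omega>)" by (rule bochner_H_subset_L[OF u])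
  have utL: "ut' \<in> bochner_L2 T (L2_space \<Omega>)" using ut' by (simp add: weak_time_deriv_def)
  have utD: "(\<lambda>t. L2_inner \<Omega> (ut' t)) \<in> bochner_L2 T (spectral_dual \<Omega> lam \<phi> s)" by (rule bochner_L2_dual[OF utL])
  have uttD: "utt \<in> bochner_L2 T (spectral_dual \<Omega> lam \<phi> s)" using utt by (simp add: weak_time_deriv_def)
  have both: "(AE t in M. L2_inner \<Omega> (u t) (\<phi> k) = U k t) \<and> (AE t in M. L2_inner \<Omega> (ut' t) (\<phi> k) = V k t)" for k
  proof -
    obtain u0 where u0: "continuous_on {0..T} u0" "AE t in M. L2_inner \<Omega> (u t) (\<phi> k) = u0 t" "u0 0 = L2_inner \<Omega> g (\<phi> k)"
      by (rule L.initial_value_coef[OF L.bochner_L2D(1)[OF uL] H_subset_L[OF g] T_nonneg ig])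
    obtain v0 where v0: "continuous_on {0..T} v0" "AE t in M. L2_inner \<Omega> (ut' t) (\<phi> k) = v0 t" "v0 0 = L2_inner \<Omega> h (\<phi> k)"
      by (rule D.initial_value_coef[OF D.bochner_L2D(1)[OF utD] L2_inner_dual(1)[OF h] T_nonneg ih])
    have w1: "(\<integral>t. deriv \<psi> t * L2_inner \<Omega> (u t) (\<phi> k) \<partial>M) = - (\<integral>t. \<psi> t * L2_inner \<Omega> (ut' t) (\<phi> k) \<partial>M)"
      if "test_function {0<..<T} \<psi>" for \<psi>
      by (rule L.weak_time_deriv_coef[OF uL ut' that])
    have w2: "(\<integral>t. deriv \<psi> t * L2_inner \<Omega> (ut' t) (\<phi> k) \<partial>M) =
        - (\<integral>t. \<psi> t * (L2_inner \<Omega> (f t) (\<phi> k) - \<kappa> k * L2_inner \<Omega> (u t) (\<phi> k)) \<partial>M)"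
      if \<psi>: "test_function {0<..<T} \<psi>" for \<psi>
    proof -
      have i: "integrable M (\<lambda>t. L2_inner \<Omega> (f t) (\<phi> k) - \<kappa> k * L2_inner \<Omega> (u t) (\<phi> k))"
        using L.bochner_L2D(5)[OF f] L.bochner_L2D(5)[OF uL] by simp
      have "(\<integral>t. \<psi> t * utt t (\<phi> k) \<partial>M) = (\<integral>t. \<psi> t * (L2_inner \<Omega> (f t) (\<phi> k) - \<kappa> k * L2_inner \<Omega> (u t) (\<phi> k)) \<partial>M)"
      proof (rule integral_cong_AE)
        show "(\<lambda>t. \<psi> t * utt t (\<phi> k)) \<in> borel_measurable M"
          by (rule borel_measurable_integrable[OF integrable_test_function_mult(1)[OF \<psi> D.bochner_L2D(5)[OF uttD]]])
        show "(\<lambda>t. \<psi> t * (L2_inner \<Omega> (f t) (\<phi> k) - \<kappa> k * L2_inner \<Omega> (u t) (\<phi> k))) \<in> borel_measurable M"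
          by (rule borel_measurable_integrable[OF integrable_test_function_mult(1)[OF \<psi> i]])
        show "AE t in M. \<psi> t * utt t (\<phi> k) = \<psi> t * (L2_inner \<Omega> (f t) (\<phi> k) - \<kappa> k * L2_inner \<Omega> (u t) (\<phi> k))"
          using eq
        proof eventually_elim
          case (elim t)
          then have "utt t (\<phi> k) + fractional_power \<Omega> lam \<phi> s (u t) (\<phi> k) = L2_inner \<Omega> (f t) (\<phi> k)"
            using H.basis_elem by blast
          then have "utt t (\<phi> k) = L2_inner \<Omega> (f t) (\<phi> k) - \<kappa> k * L2_inner \<Omega> (u t) (\<phi> k)"
            by (simp add: fractional_power_basis)
          then show ?case by simp
        qed
      qed
      with D.weak_time_deriv_coef[OF utD utt \<psi>, of k] show ?thesis by simp
    qed
    have "AE t in M. L2_inner \<Omega> (u t) (\<phi> k) = U k t"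
      by (rule mode_solution_unique(1)[OF T H.wt_pos L.bochner_L2D(5)[OF f] modesD(1)[OF UV]
            L.bochner_L2D(5)[OF uL] L.bochner_L2D(5)[OF utL] _ _ u0 v0], erule w1, erule w2)
    moreover have "AE t in M. L2_inner \<Omega> (ut' t) (\<phi> k) = V k t"
      by (rule mode_solution_unique(2)[OF T H.wt_pos L.bochner_L2D(5)[OF f] modesD(1)[OF UV]
            L.bochner_L2D(5)[OF uL] L.bochner_L2D(5)[OF utL] _ _ u0 v0], erule w1, erule w2)
    ultimately show ?thesis ..
  qed
  then show "AE t in M. \<forall>k. L2_inner \<Omega> (u t) (\<phi> k) = U k t" by (simp add: AE_all_countable)
  assume ut: "weak_time_deriv T (L2_space \<Omega>) u ut"
  have ut2L: "ut \<in> bochner_L2 T (L2_space \<Omega>)" using ut by (simp add: weak_time_deriv_def)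
  have "AE t in M. L2_inner \<Omega> (ut t) (\<phi> k) = V k t" for k
  proof -
    note i1 = L.bochner_L2D(5)[OF ut2L, of k] and i2 = L.bochner_L2D(5)[OF utL, of k]
    have "AE t in M. L2_inner \<Omega> (ut t) (\<phi> k) - L2_inner \<Omega> (ut' t) (\<phi> k) = 0"
    proof (rule fundamental_lemma_calculus_of_variations)
      show "integrable M (\<lambda>t. L2_inner \<Omega> (ut t) (\<phi> k) - L2_inner \<Omega> (ut' t) (\<phi> k))"
        by (rule Bochner_Integration.integrable_diff[OF i1 i2])
      fix \<psi> :: "real \<Rightarrow> real" assume \<psi>: "test_function {0<..<T} \<psi>"
      have "(\<integral>t. \<psi> t * L2_inner \<Omega> (ut t) (\<phi> k) \<partial>M) = (\<integral>t. \<psi> t * L2_inner \<Omega> (ut' t) (\<phi> k) \<partial>M)"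
        using L.weak_time_deriv_coef[OF uL ut \<psi>, of k] L.weak_time_deriv_coef[OF uL ut' \<psi>, of k] by simp
      then show "(\<integral>t. \<psi> t * (L2_inner \<Omega> (ut t) (\<phi> k) - L2_inner \<Omega> (ut' t) (\<phi> k)) \<partial>M) = 0"
        unfolding right_diff_distrib
        using integrable_test_function_mult(1)[OF \<psi> i1] integrable_test_function_mult(1)[OF \<psi> i2] by simp
    qed
    then show ?thesis using both[of k, THEN conjunct2] by eventually_elim simp
  qed
  then show "AE t in M. \<forall>k. L2_inner \<Omega> (ut t) (\<phi> k) = V k t" by (simp add: AE_all_countable)
qed

lemma weak_solution_unique:
  assumes f: "f \<in> bochner_L2 T (L2_space \<Omega>)" and g: "g \<in> elems (spectral_space \<Omega> lam \<phi> s)"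
    and h: "h \<in> elems (L2_space \<Omega>)"
    and u: "weak_solution \<Omega> lam \<phi> s T f g h u" and w: "weak_solution \<Omega> lam \<phi> s T f g h w"
  shows "AE t in M. AE x in lebesgue_on \<Omega>. u t x = w t x"
proof -
  obtain U V where UV: "modes f g h U V" using modes_exist[OF f] by blast
  have L: "AE t in M. v t \<in> elems (L2_space \<Omega>)" if "weak_solution \<Omega> lam \<phi> s T f g h v" for v
    using that bochner_H_subset_L[THEN L.bochner_L2D(1)] unfolding weak_solution_def by blast
  show ?thesis
    using L[OF u] L[OF w] weak_solution_modes(1)[OF f g h UV u] weak_solution_modes(1)[OF f g h UV w]
  proof eventually_elim
    case (elim t)
    have d: "(\<lambda>x. u t x - w t x) \<in> elems (L2_space \<Omega>)" by (rule L.diff_elem[OF elim(1,2)])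
    have "nrm (L2_space \<Omega>) (\<lambda>x. u t x - w t x) = 0"
      unfolding L.nrm_zero_iff[OF d] using elim(3,4) by (simp add: L.coef_diff[OF elim(1,2)])
    then show ?case unfolding L2_nrm_eq_0_iff[OF d] by simp
  qed
qed

lemma weak_solution_estimate:
  assumes f: "f \<in> bochner_L2 T (L2_space \<Omega>)" and g: "g \<in> elems (spectral_space \<Omega> lam \<phi> s)"
    and h: "h \<in> elems (L2_space \<Omega>)"
    and u: "weak_solution \<Omega> lam \<phi> s T f g h u" and ut: "weak_time_deriv T (L2_space \<Omega>) u ut"
  shows "bochner_Linf_norm T (spectral_space \<Omega> lam \<phi> s) u + bochner_Linf_norm T (L2_space \<Omega>) ut
    \<le> ennreal (2 * sqrt (3 * (1 + 4 * T)) *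
      (bochner_L2_norm T (L2_space \<Omega>) f + nrm (spectral_space \<Omega> lam \<phi> s) g + nrm (L2_space \<Omega>) h))"
proof -
  define B where "B = sqrt (suminf (mode_bound f g h))"
  obtain U V where UV: "modes f g h U V" using modes_exist[OF f] by blast
  have sB: "summable (mode_bound f g h)" using mode_bound_sums[OF f g h] by (rule sums_summable)
  have uH: "u \<in> bochner_L2 T (spectral_space \<Omega> lam \<phi> s)" using u unfolding weak_solution_def by blast
  have utL: "ut \<in> bochner_L2 T (L2_space \<Omega>)" using ut by (simp add: weak_time_deriv_def)
  have ae: "AE t in M. t \<in> {0..T}" by (rule AE_I2) auto
  have "AE t in M. nrm (spectral_space \<Omega> lam \<phi> s) (u t) \<le> B"
    using ae H.bochner_L2D(1)[OF uH] weak_solution_modes(1)[OF f g h UV u]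
  proof eventually_elim
    case (elim t)
    have le: "\<kappa> k * (L2_inner \<Omega> (u t) (\<phi> k))\<^sup>2 \<le> mode_bound f g h k" for k
      using modesD(6)[OF UV elim(1), of k] elim(3) by simp
    show ?case unfolding H.nrm_eq[OF elim(2)] B_def
      by (rule real_sqrt_le_mono[OF suminf_le[OF le H.summable_coef[OF elim(2)] sB]])
  qed
  then have 1: "bochner_Linf_norm T (spectral_space \<Omega> lam \<phi> s) u \<le> ennreal B"
    unfolding bochner_Linf_norm_def
    by (intro esssup_I measurable_compose[OF H.bochner_L2D(6)[OF uH] measurable_ennreal])
      (auto elim!: eventually_mono intro: ennreal_leI)
  have "AE t in M. nrm (L2_space \<Omega>) (ut t) \<le> B"
    using ae L.bochner_L2D(1)[OF utL] weak_solution_modes(2)[OF f g h UV u ut]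
  proof eventually_elim
    case (elim t)
    have le: "1 * (L2_inner \<Omega> (ut t) (\<phi> k))\<^sup>2 \<le> mode_bound f g h k" for k
      using modesD(7)[OF UV elim(1), of k] elim(3) by simp
    show ?case unfolding L.nrm_eq[OF elim(2)] B_def
      by (rule real_sqrt_le_mono[OF suminf_le[OF le L.summable_coef[OF elim(2)] sB]])
  qed
  then have 2: "bochner_Linf_norm T (L2_space \<Omega>) ut \<le> ennreal B"
    unfolding bochner_Linf_norm_def
    by (intro esssup_I measurable_compose[OF L.bochner_L2D(6)[OF utL] measurable_ennreal])
      (auto elim!: eventually_mono intro: ennreal_leI)
  have "0 \<le> mode_bound f g h k" for k
    using modesD(7)[OF UV, of 0 k] T order_trans[OF zero_le_power2] by fastforce
  then have "0 \<le> B" unfolding B_def by (intro real_sqrt_ge_zero suminf_nonneg sB)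
  have "bochner_Linf_norm T (spectral_space \<Omega> lam \<phi> s) u + bochner_Linf_norm T (L2_space \<Omega>) ut \<le> ennreal B + ennreal B"
    by (rule add_mono[OF 1 2])
  also have "\<dots> = ennreal (2 * B)" using \<open>0 \<le> B\<close> by (simp add: ennreal_plus[symmetric] del: ennreal_plus)
  also have "\<dots> \<le> ennreal (2 * sqrt (3 * (1 + 4 * T)) *
      (bochner_L2_norm T (L2_space \<Omega>) f + nrm (spectral_space \<Omega> lam \<phi> s) g + nrm (L2_space \<Omega>) h))"
    using mode_bound_le[OF f g h] by (intro ennreal_leI) (simp add: B_def)
  finally show ?thesis .
qed

text \<open>
  At every time of the closed interval the mode amplitudes are the coefficients of an element of the
  respective space, because their weighted squares have the summable majorant \<open>mode_bound\<close>. The second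
  derivative is defined by the equation; that it is one holds coordinatewise.
\<close>

lemma weak_solution_exists:
  assumes f: "f \<in> bochner_L2 T (L2_space \<Omega>)" and g: "g \<in> elems (spectral_space \<Omega> lam \<phi> s)"
    and h: "h \<in> elems (L2_space \<Omega>)"
  shows "\<exists>u. weak_solution \<Omega> lam \<phi> s T f g h u"
proof -
  let ?H = "spectral_space \<Omega> lam \<phi> s" and ?D = "spectral_dual \<Omega> lam \<phi> s" and ?L = "L2_space \<Omega>"
  obtain U V where UV: "modes f g h U V" using modes_exist[OF f] by blast
  note md = modesD[OF UV]
  define B where "B = mode_bound f g h"
  have sB: "summable B" unfolding B_def using mode_bound_sums[OF f g h] by (rule sums_summable)
  have bU: "\<kappa> k * (U k t)\<^sup>2 \<le> B k" and bV: "1 * (V k t)\<^sup>2 \<le> B k" if "t \<in> {0..T}" for k t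
    using md(6,7)[OF that] by (simp_all add: B_def)
  have "\<forall>t\<in>{0..T}. \<exists>w. w \<in> elems ?H \<and> (\<forall>k. L2_inner \<Omega> w (\<phi> k) = U k t)"
  proof
    fix t assume t: "t \<in> {0..T}"
    have "summable (\<lambda>k. \<kappa> k * (U k t)\<^sup>2)"
      by (rule summable_comparison_test'[OF sB, of 0]) (use bU[OF t] H.term_nonneg in simp)
    then show "\<exists>w. w \<in> elems ?H \<and> (\<forall>k. L2_inner \<Omega> w (\<phi> k) = U k t)"
      using H.complete[of "\<lambda>k. U k t"] by blast
  qed
  from bchoice[OF this] obtain u where u: "\<forall>t\<in>{0..T}. u t \<in> elems ?H \<and> (\<forall>k. L2_inner \<Omega> (u t) (\<phi> k) = U k t)" ..
  have "\<forall>t\<in>{0..T}. \<exists>w. w \<in> elems ?L \<and> (\<forall>k. L2_inner \<Omega> w (\<phi> k) = V k t)"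
  proof
    fix t assume t: "t \<in> {0..T}"
    have "summable (\<lambda>k. 1 * (V k t)\<^sup>2)"
      by (rule summable_comparison_test'[OF sB, of 0]) (use bV[OF t] in simp)
    then show "\<exists>w. w \<in> elems ?L \<and> (\<forall>k. L2_inner \<Omega> w (\<phi> k) = V k t)"
      using L.complete[of "\<lambda>k. V k t"] by blast
  qed
  from bchoice[OF this] obtain ut where ut: "\<forall>t\<in>{0..T}. ut t \<in> elems ?L \<and> (\<forall>k. L2_inner \<Omega> (ut t) (\<phi> k) = V k t)" ..
  have uH: "u t \<in> elems ?H" and uc: "L2_inner \<Omega> (u t) (\<phi> k) = U k t"
    and utL: "ut t \<in> elems ?L" and utc: "L2_inner \<Omega> (ut t) (\<phi> k) = V k t" if "t \<in> {0..T}" for t k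
    using u ut that by blast+
  have zero: "(0::real) \<in> {0..T}" using T by simp
  have cu: "continuous_on {0..T} (\<lambda>t. L2_inner \<Omega> (u t) (\<phi> k))" "continuous_on {0..T} (\<lambda>t. L2_inner \<Omega> (ut t) (\<phi> k))" for k
    by (rule continuous_on_eq[OF md(2)], simp add: uc, rule continuous_on_eq[OF md(3)], simp add: utc)
  have bu: "u \<in> bochner_L2 T ?H"
    by (rule H.bochner_L2_bounded[OF uH uc md(2) bU sB])
  have but: "ut \<in> bochner_L2 T ?L"
    by (rule L.bochner_L2_bounded[OF utL utc md(3) bV sB])
  define frac where "frac t = fractional_power \<Omega> lam \<phi> s (u t)" for t
  have bfrac: "frac \<in> bochner_L2 T ?D"
  proof (rule D.bochner_L2_bounded[where U = "\<lambda>k t. \<kappa> k * U k t", OF _ _ _ _ sB])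
    show "frac t \<in> elems ?D" if "t \<in> {0..T}" for t
      unfolding frac_def by (rule fractional_power_dual[OF uH[OF that]])
    show "frac t (\<phi> k) = \<kappa> k * U k t" if "t \<in> {0..T}" for t k
      by (simp only: frac_def fractional_power_basis uc[OF that])
    show "continuous_on {0..T} (\<lambda>t. \<kappa> k * U k t)" for k by (intro continuous_intros md(2))
    fix k t assume t: "t \<in> {0..T}"
    have "1 / \<kappa> k * (\<kappa> k * U k t)\<^sup>2 = \<kappa> k * (U k t)\<^sup>2"
      using H.wt_pos[of k] by (simp add: power2_eq_square)
    then show "1 / \<kappa> k * (\<kappa> k * U k t)\<^sup>2 \<le> B k" using bU[OF t] by simp
  qed
  (* The equation solved for the second time derivative. *)
  define utt where "utt t = (\<lambda>v. L2_inner \<Omega> (f t) v - frac t v)" for t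
  have butt: "utt \<in> bochner_L2 T ?D"
    unfolding utt_def[abs_def] by (rule D.bochner_L2_diff[OF bochner_L2_dual[OF f] bfrac])
  have 1: "weak_time_deriv T ?L u ut"
  proof (rule L.weak_time_derivI[OF bochner_H_subset_L[OF bu] but T_nonneg])
    fix \<psi> k assume \<psi>: "test_function {0<..<T} \<psi>"
    have "(\<integral>t. deriv \<psi> t * L2_inner \<Omega> (u t) (\<phi> k) \<partial>M) = (\<integral>t. deriv \<psi> t * U k t \<partial>M)"
      "(\<integral>t. \<psi> t * L2_inner \<Omega> (ut t) (\<phi> k) \<partial>M) = (\<integral>t. \<psi> t * V k t \<partial>M)"
      by (intro Bochner_Integration.integral_cong refl; simp add: uc utc)+
    then show "(\<integral>t. deriv \<psi> t * L2_inner \<Omega> (u t) (\<phi> k) \<partial>M) = - (\<integral>t. \<psi> t * L2_inner \<Omega> (ut t) (\<phi> k) \<partial>M)"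
      using modes_weak(1)[OF UV \<psi>, of k] by simp
  qed
  have 2: "weak_time_deriv T ?D (\<lambda>t. L2_inner \<Omega> (ut t)) utt"
  proof (rule D.weak_time_derivI[OF bochner_L2_dual[OF but] butt T_nonneg])
    fix \<psi> k assume \<psi>: "test_function {0<..<T} \<psi>"
    have "(\<integral>t. deriv \<psi> t * L2_inner \<Omega> (ut t) (\<phi> k) \<partial>M) = (\<integral>t. deriv \<psi> t * V k t \<partial>M)"
      by (intro Bochner_Integration.integral_cong refl) (simp add: utc)
    moreover have "(\<integral>t. \<psi> t * utt t (\<phi> k) \<partial>M) = (\<integral>t. \<psi> t * (L2_inner \<Omega> (f t) (\<phi> k) - \<kappa> k * U k t) \<partial>M)"
      by (intro Bochner_Integration.integral_cong refl) (simp add: utt_def frac_def fractional_power_basis uc)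
    ultimately show "(\<integral>t. deriv \<psi> t * L2_inner \<Omega> (ut t) (\<phi> k) \<partial>M) = - (\<integral>t. \<psi> t * utt t (\<phi> k) \<partial>M)"
      using modes_weak(2)[OF UV \<psi>, of k] by simp
  qed
  have sB': "summable (\<lambda>k. B k / \<mu> powr s)" by (rule summable_divide[OF sB])
  have 3: "initial_value T ?L u g"
  proof (rule L.initial_valueI[OF T_nonneg H_subset_L[OF uH] H_subset_L[OF g] cu(1) _ sB'])
    show "1 * (L2_inner \<Omega> (u t) (\<phi> k))\<^sup>2 \<le> B k / \<mu> powr s" if "t \<in> {0..T}" for k t
      unfolding uc[OF that] by (rule le_of_weighted[OF bU[OF that]])
    show "L2_inner \<Omega> (u 0) (\<phi> k) = L2_inner \<Omega> g (\<phi> k)" for k by (simp only: uc[OF zero] md(4))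
  qed
  have 4: "initial_value T ?D (\<lambda>t. L2_inner \<Omega> (ut t)) (L2_inner \<Omega> h)"
  proof (rule D.initial_valueI[OF T_nonneg L2_inner_dual(1)[OF utL] L2_inner_dual(1)[OF h] cu(2) _ sB'])
    show "1 / \<kappa> k * (L2_inner \<Omega> (ut t) (\<phi> k))\<^sup>2 \<le> B k / \<mu> powr s" if "t \<in> {0..T}" for k t
      unfolding utc[OF that] using divide_weight_le[of "V k t" "B k" k] bV[OF that, of k] by simp
    show "L2_inner \<Omega> (ut 0) (\<phi> k) = L2_inner \<Omega> h (\<phi> k)" for k by (simp only: utc[OF zero] md(5))
  qed
  have 5: "AE t in M. \<forall>v\<in>elems ?H. utt t v + fractional_power \<Omega> lam \<phi> s (u t) v = L2_inner \<Omega> (f t) v"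
    by (rule AE_I2) (simp add: utt_def frac_def)
  show ?thesis unfolding weak_solution_def using bu 1 2 3 4 5 by blast
qed

end

theorem theorem3p3:
  fixes \<Omega> :: "(real^'n::finite) set"
    and A :: "real^'n \<Rightarrow> real^'n^'n" and c :: "real^'n \<Rightarrow> real"
    and lam :: "nat \<Rightarrow> real" and \<phi> :: "nat \<Rightarrow> real^'n \<Rightarrow> real"
    and s T :: real
  assumes "open \<Omega>" and "bounded \<Omega>" and "convex \<Omega>"
    and "admissible_coeffs \<Omega> A c"
    and "eigensystem \<Omega> A c lam \<phi>"
    and "0 < s" and "s < 1" and "0 < T"
  shows "\<exists>C>0. \<forall>f g h.
    f \<in> bochner_L2 T (L2_space \<Omega>) \<longrightarrow>
    g \<in> elems (spectral_space \<Omega> lam \<phi> s) \<longrightarrow>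
    h \<in> elems (L2_space \<Omega>) \<longrightarrow>
      (\<exists>u. weak_solution \<Omega> lam \<phi> s T f g h u) \<and>
      (\<forall>u w. weak_solution \<Omega> lam \<phi> s T f g h u \<longrightarrow> weak_solution \<Omega> lam \<phi> s T f g h w \<longrightarrow>
         (AE t in time_measure T. AE x in lebesgue_on \<Omega>. u t x = w t x)) \<and>
      (\<forall>u ut. weak_solution \<Omega> lam \<phi> s T f g h u \<longrightarrow> weak_time_deriv T (L2_space \<Omega>) u ut \<longrightarrow>
         bochner_Linf_norm T (spectral_space \<Omega> lam \<phi> s) u + bochner_Linf_norm T (L2_space \<Omega>) ut
           \<le> ennreal (C * (bochner_L2_norm T (L2_space \<Omega>) f
                           + nrm (spectral_space \<Omega> lam \<phi> s) g + nrm (L2_space \<Omega>) h)))"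
proof -
  obtain \<mu> where \<mu>: "0 < \<mu>" "\<forall>k. \<mu> \<le> lam k"
    using eigenvalues_bounded_below[OF assms(1,2,4,5)] by blast
  interpret spectral_wave \<Omega> lam \<phi> s T \<mu>
  proof
    show "\<Omega> \<in> lmeasurable" using assms(1,2) by (intro bounded_set_imp_lmeasurable) simp_all
    show "orthonormal_basis \<Omega> \<phi>" using assms(5) by (simp add: eigensystem_def)
  qed (use \<mu> assms in simp_all)
  have "0 < 2 * sqrt (3 * (1 + 4 * T))" using T by simp
  then show ?thesis
    using weak_solution_exists weak_solution_unique weak_solution_estimate
    by (intro exI[of _ "2 * sqrt (3 * (1 + 4 * T))"] conjI allI impI) assumption+
qed

end
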